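(* Let $N \geq 2$. For any $1 \leq i \leq N-1$, the law of the semicircle-renormalised GUE eigengap $g_i^{(N)}$ is log-concave and supported on $[0,\infty)$.
   Context: An $N\times N$ GUE random matrix is a Hermitian random matrix $X$ with density proportional to $e^{-\mathrm{tr}(X^2)}$. Its ordered eigenvalues $\lambda_1^{(N)} \leq \cdots \leq \lambda_N^{(N)}$ have joint density on $\mathbb{R}^N$ $$p_N(t_1,\ldots,t_N) = C_N \prod_{1 \leq i<j \leq N}(t_j-t_i)^2 \exp\Big\{-\sum_{i=1}^N t_i^2\Big\} \mathbf{1}\{t_1 \leq \cdots \leq t_N\},$$ where $C_N$ is the normalisation constant. The semicircle density is $\rho_{\mathrm{sc}}(x) = \frac{2}{\pi}(1-x^2)_+^{1/2}$. For $1 \leq i \leq N-1$, $\gamma_{i/N} \in (-1,1)$ is the quantile defined by $\frac{i}{N} = \int_{-\infty}^{\gamma_{i/N}} \rho_{\mathrm{sc}}(x)\,\mathrm{d}x$. The semicircle-renormalised eigengap is $$g_i^{(N)} := \sqrt{N/2}\;\rho_{\mathrm{sc}}(\gamma_{i/N})\,\big(\lambda_{i+1}^{(N)} - \lambda_i^{(N)}\big), \qquad 1 \leq i \leq N-1.$$ A probability measure $\mu$ on $\mathbb{R}^n$ is log-concave if for all Borel sets $A,B \subseteq \mathbb{R}^n$ and all $\lambda \in (0,1)$, $\mu(\lambda A + (1-\lambda)B) \geq \mu(A)^\lambda \mu(B)^{1-\lambda}$, where $\lambda A + (1-\lambda) B = \{\lambda a + (1-\lambda) b : a \in A, b \in B\}$.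 If $\mu$ has a density $f$ with respect to Lebesgue measure, this is equivalent to $f$ being expressible as $f = e^{-V}$ with $V:\mathbb{R}^n \to \mathbb{R}\cup\{+\infty\}$ convex. "Supported on $[0,\infty)$" means that $[0,\infty)$ has full measure. *)

theory Defs
  imports
    "HOL-Probability.Probability"
    "HOL-Computational_Algebra.Polynomial"
begin

unbundle no fps_syntax

text \<open>
  Throughout, \<open>N\<close>-by-\<open>N\<close> complex matrices are elements of \<^typ>\<open>complex^'n^'n\<close>, with
  \<open>N = CARD('n)\<close>.
\<close>

section \<open>GUE random matrices\<close>

definition hermitian :: "complex^'n^'n \<Rightarrow> bool" where
  "hermitian A \<longleftrightarrow> (\<forall>i j. A $ i $ j = cnj (A $ j $ i))"

text \<open>
  Real coordinates on the real vector space of Hermitian matrices. The map is linear, bijective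
  onto the Hermitian matrices and isometric for the Frobenius norm (see the lemmas below), so it
  carries Lebesgue measure to Lebesgue measure on the Hermitian matrices. It needs no order on the
  index type, unlike the coordinates given by the upper triangle, which differ from it by a linear
  map and hence give the same measure up to a constant factor.
\<close>
definition herm_of :: "real^'n^'n \<Rightarrow> complex^'n^'n" where
  "herm_of Y = (\<chi> i j. Complex ((Y $ i $ j + Y $ j $ i) / 2) ((Y $ i $ j - Y $ j $ i) / 2))"

definition herm_lborel :: "(complex^'n^'n) measure" where
  "herm_lborel = distr lborel borel herm_of"

definition GUE_matrix :: "'w measure \<Rightarrow> ('w \<Rightarrow> complex^'n^'n) \<Rightarrow> bool" where
  "GUE_matrix M X \<longleftrightarrow>
     (\<forall>\<omega>\<in>space M. hermitian (X \<omega>)) \<and>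
     (\<exists>c>0. distributed M herm_lborel X (\<lambda>A. ennreal (c * exp (- Re (trace (A ** A))))))"

lemma hermitian_herm_of: "hermitian (herm_of Y)"
  by (simp add: hermitian_def herm_of_def complex_eq_iff field_simps)

lemma linear_herm_of: "linear herm_of"
  by (rule linearI) (simp_all add: herm_of_def vec_eq_iff complex_eq_iff field_simps)

lemma bij_betw_herm_of: "bij_betw herm_of UNIV {A. hermitian A}"
proof (rule bij_betwI[where g = "\<lambda>A. \<chi> i j. Re (A $ i $ j) + Im (A $ i $ j)"])
  show "herm_of \<in> UNIV \<rightarrow> {A. hermitian A}"
    by (simp add: hermitian_herm_of)
  show "(\<chi> i j. Re (herm_of Y $ i $ j) + Im (herm_of Y $ i $ j)) = Y" for Y :: "real^'n^'n"
    by (simp add: herm_of_def vec_eq_iff field_simps)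
  show "herm_of (\<chi> i j. Re (A $ i $ j) + Im (A $ i $ j)) = A"
    if "A \<in> {A. hermitian A}" for A :: "complex^'n^'n"
  proof -
    have *: "Re (A $ j $ i) = Re (A $ i $ j)" "Im (A $ j $ i) = - Im (A $ i $ j)" for i j
    proof -
      have "A $ j $ i = cnj (A $ i $ j)"
        using that unfolding hermitian_def by blast
      then show "Re (A $ j $ i) = Re (A $ i $ j)" "Im (A $ j $ i) = - Im (A $ i $ j)"
        by simp_all
    qed
    have "herm_of (\<chi> i j. Re (A $ i $ j) + Im (A $ i $ j)) $ i $ j = A $ i $ j" for i j
      using *[of i j] by (simp add: herm_of_def complex_eq_iff)
    then show ?thesis
      by (simp add: vec_eq_iff)
  qed
qed simp

lemma norm_herm_of: "norm (herm_of Y) = norm Y"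
proof -
  have "(\<Sum>i\<in>UNIV. \<Sum>j\<in>UNIV. (cmod (herm_of Y $ i $ j))\<^sup>2) =
        (\<Sum>i\<in>UNIV. \<Sum>j\<in>UNIV. (Y $ i $ j)\<^sup>2 / 2 + (Y $ j $ i)\<^sup>2 / 2)"
    by (intro sum.cong refl) (simp add: herm_of_def cmod_power2, simp add: power2_eq_square field_simps)
  also have "\<dots> = (\<Sum>i\<in>UNIV. \<Sum>j\<in>UNIV. (Y $ i $ j)\<^sup>2 / 2) + (\<Sum>i\<in>UNIV. \<Sum>j\<in>UNIV. (Y $ j $ i)\<^sup>2 / 2)"
    by (simp add: sum.distrib)
  also have "(\<Sum>i\<in>UNIV. \<Sum>j\<in>UNIV. (Y $ j $ i)\<^sup>2 / 2) = (\<Sum>i\<in>UNIV. \<Sum>j\<in>UNIV. (Y $ i $ j)\<^sup>2 / 2)"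
    by (rule sum.swap)
  finally have "(\<Sum>i\<in>UNIV. \<Sum>j\<in>UNIV. (cmod (herm_of Y $ i $ j))\<^sup>2) = (\<Sum>i\<in>UNIV. \<Sum>j\<in>UNIV. (Y $ i $ j)\<^sup>2)"
    by (simp flip: sum_divide_distrib)
  then show ?thesis
    by (simp add: norm_vec_def L2_set_def sum_nonneg)
qed


section \<open>Ordered eigenvalues and eigengaps\<close>

definition charpoly :: "complex^'n^'n \<Rightarrow> complex poly" where
  "charpoly A = det (\<chi> i j. (if i = j then [:0, 1:] else 0) - [:A $ i $ j:])"

text \<open>
  The eigenvalues with multiplicity, in increasing order. The eigenvalues of a Hermitian matrix are
  real, so that taking real parts only changes the type.
\<close>
definition eigenvalue_list :: "complex^'n^'n \<Rightarrow> real list" where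
  "eigenvalue_list A = sorted_list_of_multiset (image_mset Re (proots (charpoly A)))"

text \<open>Eigenvalues are numbered from 1 to \<open>N\<close>, list positions from 0 to \<open>N - 1\<close>.\<close>
definition ordered_eigenvalue :: "nat \<Rightarrow> complex^'n^'n \<Rightarrow> real" where
  "ordered_eigenvalue k A = eigenvalue_list A ! (k - 1)"

definition semicircle_density :: "real \<Rightarrow> real" where
  "semicircle_density x = 2 / pi * sqrt (max 0 (1 - x\<^sup>2))"

definition semicircle_quantile :: "real \<Rightarrow> real" where
  "semicircle_quantile q =
     (THE x. x \<in> {-1<..<1} \<and> q = (LINT t:{..x}|lborel. semicircle_density t))"

definition eigengap :: "nat \<Rightarrow> complex^'n^'n \<Rightarrow> real" where
  "eigengap i A =
     sqrt (real CARD('n) / 2) * semicircle_density (semicircle_quantile (real i / real CARD('n))) *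
     (ordered_eigenvalue (i + 1) A - ordered_eigenvalue i A)"

lemma semicircle_primitive_deriv:
  assumes t: "-1 < t" "t < 1"
  shows "((\<lambda>x. c + (x * sqrt (1 - x\<^sup>2) + arcsin x) / pi) has_real_derivative semicircle_density t) (at t)"
proof -
  have t2: "t\<^sup>2 < 1"
    using t by (simp add: abs_square_less_1 abs_less_iff)
  then have s: "sqrt (1 - t\<^sup>2) > 0" "(sqrt (1 - t\<^sup>2))\<^sup>2 = 1 - t\<^sup>2"
    by simp_all
  have "((\<lambda>x. c + (x * sqrt (1 - x\<^sup>2) + arcsin x) / pi) has_real_derivative
      ((sqrt (1 - t\<^sup>2) + t * (inverse (sqrt (1 - t\<^sup>2)) / 2 * (- 2 * t))) + inverse (sqrt (1 - t\<^sup>2))) / pi) (at t)"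
    using t t2 by (auto intro!: derivative_eq_intros simp: field_simps)
  moreover have "sqrt (1 - t\<^sup>2) + t * (inverse (sqrt (1 - t\<^sup>2)) / 2 * (- 2 * t)) + inverse (sqrt (1 - t\<^sup>2))
      = sqrt (1 - t\<^sup>2) + (sqrt (1 - t\<^sup>2))\<^sup>2 / sqrt (1 - t\<^sup>2)"
    unfolding s(2) using s(1) by (simp add: field_simps power2_eq_square)
  moreover have "\<dots> = 2 * sqrt (1 - t\<^sup>2)"
  proof -
    have "y + y\<^sup>2 / y = 2 * y" if "y > 0" for y :: real
      using that by (simp add: power2_eq_square)
    then show ?thesis
      using s(1) by blast
  qed
  moreover have "2 * sqrt (1 - t\<^sup>2) / pi = semicircle_density t"
    using t2 by (simp add: semicircle_density_def)
  ultimately show ?thesis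
    by (simp only:)
qed

lemma semicircle_cdf:
  assumes x: "x \<in> {-1..1}"
  shows "(LINT t:{..x}|lborel. semicircle_density t) = 1/2 + (x * sqrt (1 - x\<^sup>2) + arcsin x) / pi"
proof -
  let ?F = "\<lambda>x. (x * sqrt (1 - x\<^sup>2) + arcsin x) / pi"
  have nn: "semicircle_density t \<ge> 0" for t
    by (simp add: semicircle_density_def)
  have hi: "(semicircle_density has_integral ?F x - ?F (-1)) {-1..x}"
  proof (rule fundamental_theorem_of_calculus_interior)
    show "continuous_on {-1..x} ?F"
      using x by (intro continuous_intros) auto
    fix t assume t: "t \<in> {-1<..<x}"
    then show "(?F has_vector_derivative semicircle_density t) (at t)"
      using semicircle_primitive_deriv[of t 0] x
      by (simp add: has_real_derivative_iff_has_vector_derivative)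
  qed (use x in auto)
  have cont: "continuous_on {-1..x} semicircle_density"
    unfolding semicircle_density_def by (intro continuous_intros)
  have si: "set_integrable lborel {-1..x} semicircle_density"
    by (rule borel_integrable_atLeastAtMost') (rule cont)
  have "(LINT t:{..x}|lborel. semicircle_density t) = (LINT t:{-1..x}|lborel. semicircle_density t)"
    unfolding set_lebesgue_integral_def
  proof (rule Bochner_Integration.integral_cong[OF refl])
    fix t :: real
    show "indicator {..x} t *\<^sub>R semicircle_density t = indicator {-1..x} t *\<^sub>R semicircle_density t"
      by (cases "t < -1") (auto simp: indicator_def semicircle_density_def max_def abs_square_less_1
          abs_square_le_1)
  qed
  also have "\<dots> = integral {-1..x} semicircle_density"
    by (rule set_borel_integral_eq_integral(2)[OF si])
  also have "\<dots> = ?F x - ?F (-1)"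
    using hi by (rule integral_unique)
  finally show ?thesis
    by simp
qed

lemma semicircle_quantile_unique_exists:
  assumes q: "0 < q" "q < 1"
  shows "\<exists>!x. x \<in> {-1<..<1} \<and> q = (LINT t:{..x}|lborel. semicircle_density t)"
proof -
  let ?F = "\<lambda>x::real. 1/2 + (x * sqrt (1 - x\<^sup>2) + arcsin x) / pi"
  have cont: "continuous_on {-1..1} ?F"
    by (intro continuous_intros) auto
  have F1: "?F (-1) = 0" "?F 1 = 1"
    by simp_all
  obtain x where x: "-1 \<le> x" "x \<le> 1" "?F x = q"
    using IVT'[of ?F "-1" q 1] cont q F1 by auto
  have x': "x \<in> {-1<..<1}"
    using x q F1 by (cases "x = -1"; cases "x = 1") auto
  have F: "?F y = (LINT t:{..y}|lborel. semicircle_density t)" if "y \<in> {-1<..<1}" for y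
    using that by (intro semicircle_cdf[symmetric]) auto
  have mono: "?F a < ?F b" if ab: "-1 < a" "a < b" "b < 1" for a b
  proof (rule DERIV_pos_imp_increasing[OF ab(2)])
    fix t assume t: "a \<le> t" "t \<le> b"
    then have t1: "-1 < t" "t < 1"
      using ab by auto
    then have "semicircle_density t > 0"
      by (simp add: semicircle_density_def abs_square_less_1 abs_less_iff)
    then show "\<exists>y. (?F has_real_derivative y) (at t) \<and> 0 < y"
      using semicircle_primitive_deriv[OF t1] by blast
  qed
  show ?thesis
  proof (rule ex1I[of _ x])
    show "x \<in> {-1<..<1} \<and> q = (LINT t:{..x}|lborel. semicircle_density t)"
      using x' x(3) F[OF x'] by simp
    fix y assume y: "y \<in> {-1<..<1} \<and> q = (LINT t:{..y}|lborel. semicircle_density t)"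
    then have "?F y = ?F x"
      using F[of y] x(3) by simp
    then show "y = x"
      using mono[of x y] mono[of y x] x' y by (cases x y rule: linorder_cases) auto
  qed
qed


section \<open>Log-concave probability measures\<close>

text \<open>
  The Minkowski combination of two Borel sets is analytic, but need not be Borel. It is measurable
  for the completion of \<open>\<mu>\<close>, and its completed measure is its outer measure.
\<close>
definition log_concave_measure :: "'a::euclidean_space measure \<Rightarrow> bool" where
  "log_concave_measure \<mu> \<longleftrightarrow>
     prob_space \<mu> \<and> sets \<mu> = sets borel \<and>
     (\<forall>A\<in>sets borel. \<forall>B\<in>sets borel. \<forall>l\<in>{0<..<1}.
        outer_measure_of \<mu> {l *\<^sub>R a + (1 - l) *\<^sub>R b |a b. a \<in> A \<and> b \<in> B}
          \<ge> ennreal (measure \<mu> A powr l * measure \<mu> B powr (1 - l)))"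

end

theory Submission
  imports Defs "Jordan_Normal_Form.Char_Poly"
begin

text \<open>
  The gap is a linear function of the ordered spectrum, so it suffices to show that the ordered
  spectrum has a log-concave density on \<open>\<real>\<^sup>N\<close>: by the Prekopa-Leindler inequality
  (\<open>prekopa_leindler\<close>) linear images inherit log-concavity (\<open>pl_le_marginal\<close>). The density in
  question is proportional to \<open>vdm z * gt_volume z * exp (- |z|\<^sup>2)\<close> on the chamber of strictly increasing
  vectors, where \<open>vdm\<close> is the Vandermonde product and \<open>gt_volume z\<close> is the volume of the
  polytope of Gelfand-Tsetlin patterns with top row \<open>z\<close>. Each factor is log-concave: \<open>vdm\<close> is a product
  of positive linear forms on the convex chamber, the Gaussian factor is clear, and \<open>gt_volume\<close> is a
  marginal of the indicator of a convex set, to which Prekopa-Leindler applies again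
  (\<open>pl_le_gt_volume\<close>). The volume \<open>gt_volume z\<close> is a constant multiple of \<open>vdm z\<close>, so that this
  is the usual density with the squared Vandermonde product, but the argument works with
  the volume itself.

  The density is obtained by induction on the size of the matrix (\<open>nn_integral_eigs\<close>). A Hermitian matrix of size \<open>n + 1\<close> is one of size \<open>n\<close>, bordered by
  a column \<open>v\<close>, its adjoint and a real corner \<open>a\<close>. If \<open>U\<close> diagonalises the smaller matrix, with eigenvalues
  \<open>mu\<close>, then conjugation by \<open>U\<close> turns the bordered matrix into an arrow matrix whose border is a
  rotation of \<open>v\<close>. The rotation preserves Lebesgue measure (\<open>nn_integral_isometry\<close>), and the
  characteristic polynomial of the arrow matrix depends on the border only through the squared moduli \<open>r\<close> of its
  entries (\<open>roots_bordered\<close>), whose joint law is Lebesgue measure on the positive orthant up to a factor \<open>2 * pi\<close> for each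
  (\<open>nn_integral_polar\<close>). So the spectrum is distributed as the roots of the polynomial
  \[ (x - a) \prod_j (x - \mu_j) - \sum_j r_j \prod_{k \neq j} (x - \mu_k) \]
  with \<open>a\<close> real and all \<open>r\<^sub>j\<close> positive. Two triangular changes of variables give the law of these roots.
  The map from \<open>(a, r)\<close> to the coefficients has Jacobian \<open>vdm mu\<close> (\<open>nn_integral_arrow_coeffs\<close>), and
  the map from ordered roots to coefficients has Jacobian \<open>vdm z\<close> (\<open>nn_integral_at_roots\<close>). The positivity of the
  \<open>r\<^sub>j\<close> means exactly that \<open>z\<close> strictly interlaces \<open>mu\<close> (\<open>interlaces_imp_pos\<close>, \<open>pos_imp_interlaces\<close>).
  The new spectrum therefore has density \<open>vdm z / vdm mu\<close> on the interlacing \<open>z\<close>; the factor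
  \<open>vdm mu\<close> cancels the one from the induction hypothesis, and integrating the rest over \<open>mu\<close> is the
  recursion for \<open>gt_volume\<close>.
\<close>

hide_const (open) Order.top

section \<open>The Prekopa-Leindler inequality\<close>

text \<open>
  The inequality \<open>u\<^sup>l * v\<^sup>1\<^sup>-\<^sup>l \<le> w\<close> for extended nonnegative reals, tested on positive finite lower bounds
  of \<open>u\<close> and \<open>v\<close>. This gives the value 0 to the left-hand side when \<open>u\<close> or \<open>v\<close> vanishes, also if the other one is
  infinite, and avoids powers of infinity.
\<close>
definition pl_le :: "real \<Rightarrow> ennreal \<Rightarrow> ennreal \<Rightarrow> ennreal \<Rightarrow> bool" where
  "pl_le l u v w \<longleftrightarrow> (\<forall>a>0. \<forall>b>0. ennreal a \<le> u \<longrightarrow> ennreal b \<le> v \<longrightarrow>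
     ennreal (a powr l * b powr (1 - l)) \<le> w)"

lemma weighted_am_gm:
  fixes a b l :: real
  assumes "0 < a" "0 < b" "0 < l" "l < 1"
  shows "a powr l * b powr (1 - l) \<le> l * a + (1 - l) * b"
proof -
  have "exp ((1 - l) *\<^sub>R ln b + l *\<^sub>R ln a) \<le> (1 - l) * exp (ln b) + l * exp (ln a)"
    using convex_onD[OF exp_convex, of l "ln b" "ln a"] assms by simp
  then show ?thesis
    using assms by (simp add: powr_def exp_add[symmetric] algebra_simps)
qed

lemma emeasure_lborel_affine_vimage:
  fixes A :: "real set"
  assumes [measurable]: "A \<in> sets borel" and "c > 0"
  shows "emeasure lborel {y. (y - t) / c \<in> A} = ennreal c * emeasure lborel A"
proof -
  have [measurable]: "{y. (y - t) / c \<in> A} \<in> sets borel"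
    using measurable_sets[of "\<lambda>y. (y - t) / c" borel borel A] by (simp add: vimage_def)
  have "emeasure lborel {y. (y - t) / c \<in> A} = (\<integral>\<^sup>+y. indicator {y. (y - t) / c \<in> A} y \<partial>lborel)"
    by simp
  also have "\<dots> = ennreal \<bar>c\<bar> * (\<integral>\<^sup>+x. indicator {y. (y - t) / c \<in> A} (t + c * x) \<partial>lborel)"
    using assms by (intro nn_integral_real_affine) auto
  also have "(\<lambda>x. indicator {y. (y - t) / c \<in> A} (t + c * x)) = (indicator A :: real \<Rightarrow> ennreal)"
    using assms by (auto simp: indicator_def fun_eq_iff)
  finally show ?thesis using assms by simp
qed

text \<open>
  The one-dimensional Brunn-Minkowski inequality: fixing one point near the right end of \<open>A\<close> and one near the left
  end of \<open>B\<close>, the set \<open>C\<close> contains scaled copies of \<open>A\<close> and of \<open>B\<close> that are almost disjoint. Stating it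
  for any measurable \<open>C\<close> that contains the combination avoids the question whether the
  latter is measurable.
\<close>
lemma brunn_minkowski_real_bounded:
  fixes A B C :: "real set"
  assumes l: "0 < l" "l < 1"
    and [measurable]: "A \<in> sets borel" "B \<in> sets borel" "C \<in> sets borel"
    and ne: "A \<noteq> {}" "B \<noteq> {}" and bd: "bounded A" "bounded B"
    and C: "\<And>a b. a \<in> A \<Longrightarrow> b \<in> B \<Longrightarrow> l * a + (1 - l) * b \<in> C"
  shows "ennreal l * emeasure lborel A + ennreal (1 - l) * emeasure lborel B \<le> emeasure lborel C"
proof (rule ennreal_le_epsilon)
  fix e :: real assume e: "0 < e"
  have bdd: "bdd_above A" "bdd_below B"
    using bd bounded_imp_bdd_above bounded_imp_bdd_below by auto
  \<comment> \<open>With \<open>k\<close> close to the right end of \<open>A\<close> and \<open>m\<close> close to the left end of \<open>B\<close>, the copies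
    \<open>l A + (1 - l) m\<close> and \<open>l k + (1 - l) B\<close> overlap in length at most \<open>e\<close>.\<close>
  obtain k where k: "k \<in> A" "Sup A - e < k"
    using e less_cSupE[of "Sup A - e" A] ne by auto
  obtain m where m: "m \<in> B" "m < Inf B + e"
    using e cInf_lessD[of B "Inf B + e"] ne by auto
  let ?A = "{y. (y - (1 - l) * m) / l \<in> A}" and ?B = "{y. (y - l * k) / (1 - l) \<in> B}"
  have [measurable]: "?A \<in> sets borel" "?B \<in> sets borel"
    using measurable_sets[of "\<lambda>y. (y - (1 - l) * m) / l" borel borel A]
      measurable_sets[of "\<lambda>y. (y - l * k) / (1 - l)" borel borel B] by (simp_all add: vimage_def)
  have sub: "?A \<union> ?B \<subseteq> C"
  proof
    fix y assume "y \<in> ?A \<union> ?B"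
    then show "y \<in> C"
      using C[of "(y - (1 - l) * m) / l" m] C[of k "(y - l * k) / (1 - l)"] k m l by auto
  qed
  have int: "?A \<inter> ?B \<subseteq> {l * k + (1 - l) * Inf B .. l * Sup A + (1 - l) * m}"
  proof
    fix y assume y: "y \<in> ?A \<inter> ?B"
    then have 1: "(y - (1 - l) * m) / l \<le> Sup A" using bdd by (auto intro: cSup_upper)
    have 2: "Inf B \<le> (y - l * k) / (1 - l)" using bdd y by (auto intro: cInf_lower)
    show "y \<in> {l * k + (1 - l) * Inf B .. l * Sup A + (1 - l) * m}"
      using 1 2 l by (auto simp: field_simps)
  qed
  have len: "l * Sup A + (1 - l) * m - (l * k + (1 - l) * Inf B) \<le> e"
  proof -
    have "l * (Sup A - k) \<le> l * e" using k l by (intro mult_left_mono) auto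
    moreover have "(1 - l) * (m - Inf B) \<le> (1 - l) * e" using m l by (intro mult_left_mono) auto
    ultimately show ?thesis by (simp add: algebra_simps)
  qed
  have "emeasure lborel (?A \<inter> ?B)
      \<le> emeasure lborel {l * k + (1 - l) * Inf B .. l * Sup A + (1 - l) * m}"
    using int by (intro emeasure_mono) auto
  also have "\<dots> \<le> ennreal e"
    using len by (auto simp: emeasure_lborel_Icc_eq intro: ennreal_leI)
  finally have i: "emeasure lborel (?A \<inter> ?B) \<le> ennreal e" .
  have "ennreal l * emeasure lborel A + ennreal (1 - l) * emeasure lborel B
      = emeasure lborel ?A + emeasure lborel ?B"
    using l by (simp add: emeasure_lborel_affine_vimage)
  also have "\<dots> = emeasure lborel (?A \<union> ?B) + emeasure lborel (?A \<inter> ?B)"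
    by (rule emeasure_Un_Int) auto
  also have "\<dots> \<le> emeasure lborel C + ennreal e"
    using sub i by (intro add_mono emeasure_mono) auto
  finally show "ennreal l * emeasure lborel A + ennreal (1 - l) * emeasure lborel B
      \<le> emeasure lborel C + ennreal e" .
qed

text \<open>
  Exhaustion by the bounded sets \<open>A \<inter> {-n..n}\<close> removes the boundedness.
\<close>
lemma brunn_minkowski_real:
  fixes A B C :: "real set"
  assumes l: "0 < l" "l < 1"
    and [measurable]: "A \<in> sets borel" "B \<in> sets borel" "C \<in> sets borel"
    and ne: "A \<noteq> {}" "B \<noteq> {}"
    and C: "\<And>a b. a \<in> A \<Longrightarrow> b \<in> B \<Longrightarrow> l * a + (1 - l) * b \<in> C"
  shows "ennreal l * emeasure lborel A + ennreal (1 - l) * emeasure lborel B \<le> emeasure lborel C"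
proof -
  have lim: "(\<lambda>n. emeasure lborel (S \<inter> {-real n..real n})) \<longlonglongrightarrow> emeasure lborel S"
    if [measurable]: "S \<in> sets borel" for S :: "real set"
  proof -
    have "(\<lambda>n. emeasure lborel (S \<inter> {-real n..real n})) \<longlonglongrightarrow> emeasure lborel (\<Union>n. S \<inter> {-real n..real n})"
      by (rule Lim_emeasure_incseq) (auto simp: incseq_def)
    also have "(\<Union>n. S \<inter> {-real n..real n}) = S"
    proof (intro equalityI subsetI)
      fix x assume "x \<in> S"
      moreover obtain n where "\<bar>x\<bar> \<le> real n" using real_arch_simple by blast
      ultimately show "x \<in> (\<Union>n. S \<inter> {-real n..real n})" by (auto intro!: exI[of _ n])
    qed auto
    finally show ?thesis .
  qed
  obtain a b where ab: "a \<in> A" "b \<in> B" using ne by auto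
  obtain N where N: "\<bar>a\<bar> \<le> real N" "\<bar>b\<bar> \<le> real N"
    using real_arch_simple[of "max \<bar>a\<bar> \<bar>b\<bar>"] by auto
  show ?thesis
  proof (rule tendsto_upperbound)
    show "(\<lambda>n. ennreal l * emeasure lborel (A \<inter> {-real n..real n})
        + ennreal (1 - l) * emeasure lborel (B \<inter> {-real n..real n}))
      \<longlonglongrightarrow> ennreal l * emeasure lborel A + ennreal (1 - l) * emeasure lborel B"
      by (intro tendsto_add ennreal_tendsto_cmult lim) auto
    show "\<forall>\<^sub>F n in sequentially. ennreal l * emeasure lborel (A \<inter> {-real n..real n})
        + ennreal (1 - l) * emeasure lborel (B \<inter> {-real n..real n}) \<le> emeasure lborel C"
    proof (rule eventually_sequentiallyI[of N])
      fix n assume "N \<le> n"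
      then have "a \<in> A \<inter> {-real n..real n}" "b \<in> B \<inter> {-real n..real n}"
        using ab N by auto
      then show "ennreal l * emeasure lborel (A \<inter> {-real n..real n})
        + ennreal (1 - l) * emeasure lborel (B \<inter> {-real n..real n}) \<le> emeasure lborel C"
        by (intro brunn_minkowski_real_bounded l)
           (auto intro: C bounded_subset[of "{-real n..real n}"])
    qed
  qed simp
qed

lemma layer_integral:
  assumes c: "0 < c"
  shows "(\<integral>\<^sup>+\<theta>. ennreal c * indicator {\<theta>. 0 < \<theta> \<and> \<theta> < 1 \<and> ennreal (\<theta> * c) < u} \<theta> \<partial>lborel)
    = min u (ennreal c)"
proof (cases u)
  case (real r)
  have "{\<theta>. 0 < \<theta> \<and> \<theta> < 1 \<and> ennreal (\<theta> * c) < u} = {0<..<min 1 (r / c)}"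
  proof -
    have "ennreal (\<theta> * c) < u \<longleftrightarrow> \<theta> < r / c" if "0 < \<theta>" for \<theta>
      using that c real by (simp add: ennreal_less_iff pos_less_divide_eq)
    then show ?thesis by auto
  qed
  moreover have "(\<integral>\<^sup>+\<theta>. ennreal c * indicator {0<..<min 1 (r / c)} \<theta> \<partial>lborel)
     = ennreal c * ennreal (min 1 (r / c))"
    using c real by (subst nn_integral_cmult_indicator) auto
  moreover have "\<dots> = ennreal (min c r)"
  proof -
    have "c * min 1 (r / c) = min c r" using c by (simp add: min_mult_distrib_left)
    then show ?thesis using c real by (subst ennreal_mult[symmetric]) auto
  qed
  moreover have "ennreal (min c r) = min u (ennreal c)"
    using c real by (auto simp: min_def)
  ultimately show ?thesis by simp
next
  case top
  have "{\<theta>. 0 < \<theta> \<and> \<theta> < 1 \<and> ennreal (\<theta> * c) < u} = {0<..<1}"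
    using top by auto
  moreover have "(\<integral>\<^sup>+\<theta>. ennreal c * indicator {0<..<1::real} \<theta> \<partial>lborel) = ennreal c"
    by (subst nn_integral_cmult_indicator) auto
  ultimately show ?thesis using top by simp
qed

text \<open>
  The levels are parametrised by the fraction \<open>\<theta>\<close> of a fixed height \<open>c\<close>. Two functions with different
  suprema are later compared at equal fractions.
\<close>
lemma layer_cake:
  fixes f :: "real \<Rightarrow> ennreal"
  assumes [measurable]: "f \<in> borel_measurable borel" and c: "0 < c"
  shows "(\<integral>\<^sup>+x. min (f x) (ennreal c) \<partial>lborel)
    = ennreal c * (\<integral>\<^sup>+\<theta>\<in>{0<..<1}. emeasure lborel {x. ennreal (\<theta> * c) < f x} \<partial>lborel)"
proof -
  have "(\<integral>\<^sup>+x. min (f x) (ennreal c) \<partial>lborel)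
    = (\<integral>\<^sup>+x. \<integral>\<^sup>+\<theta>. ennreal c * indicator {\<theta>. 0 < \<theta> \<and> \<theta> < 1 \<and> ennreal (\<theta> * c) < f x} \<theta> \<partial>lborel \<partial>lborel)"
    by (simp only: layer_integral[OF c])
  also have "\<dots> = (\<integral>\<^sup>+\<theta>. \<integral>\<^sup>+x. ennreal c * indicator {\<theta>. 0 < \<theta> \<and> \<theta> < 1 \<and> ennreal (\<theta> * c) < f x} \<theta> \<partial>lborel \<partial>lborel)"
    by (rule lborel_pair.Fubini') (simp add: indicator_def, measurable)
  also have "\<dots> = (\<integral>\<^sup>+\<theta>. ennreal c * (emeasure lborel {x. ennreal (\<theta> * c) < f x} * indicator {0<..<1} \<theta>) \<partial>lborel)"
  proof (rule nn_integral_cong)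
    fix \<theta> :: real
    have "(\<integral>\<^sup>+x. ennreal c * indicator {\<theta>. 0 < \<theta> \<and> \<theta> < 1 \<and> ennreal (\<theta> * c) < f x} \<theta> \<partial>lborel)
      = (\<integral>\<^sup>+x. (ennreal c * indicator {0<..<1} \<theta>) * indicator {x. ennreal (\<theta> * c) < f x} x \<partial>lborel)"
      by (rule nn_integral_cong) (auto simp: indicator_def)
    also have "\<dots> = (ennreal c * indicator {0<..<1} \<theta>) * emeasure lborel {x. ennreal (\<theta> * c) < f x}"
      by (rule nn_integral_cmult_indicator) measurable
    finally show "(\<integral>\<^sup>+x. ennreal c * indicator {\<theta>. 0 < \<theta> \<and> \<theta> < 1 \<and> ennreal (\<theta> * c) < f x} \<theta> \<partial>lborel)
      = ennreal c * (emeasure lborel {x. ennreal (\<theta> * c) < f x} * indicator {0<..<1} \<theta>)"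
      by (simp add: mult_ac)
  qed
  also have "\<dots> = ennreal c * (\<integral>\<^sup>+\<theta>\<in>{0<..<1}. emeasure lborel {x. ennreal (\<theta> * c) < f x} \<partial>lborel)"
  proof (rule nn_integral_cmult)
    have "(\<lambda>\<theta>. emeasure lborel {x \<in> space lborel. ennreal (\<theta> * c) < f x}) \<in> borel_measurable lborel"
      by measurable
    then show "(\<lambda>\<theta>. emeasure lborel {x. ennreal (\<theta> * c) < f x} * indicator {0<..<1} \<theta>) \<in> borel_measurable lborel"
      by simp
  qed
  finally show ?thesis .
qed

text \<open>
  At the heights \<open>\<theta> s\<close>, \<open>\<theta> t\<close> and \<open>\<theta> S\<close>, where \<open>s\<close> and \<open>t\<close> are the suprema of \<open>f\<close> and \<open>g\<close> and
  \<open>S = s\<^sup>l * t\<^sup>1\<^sup>-\<^sup>l\<close>, the superlevel sets satisfy the hypothesis of the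
  Brunn-Minkowski inequality. Integrating over \<open>\<theta>\<close> bounds the integral of \<open>h\<close> from below by
  \<open>S * (l * F / s + (1 - l) * G / t)\<close>, and the weighted inequality of arithmetic and geometric means finishes.
\<close>
lemma prekopa_leindler_real_bounded:
  fixes f g h :: "real \<Rightarrow> ennreal"
  assumes l: "0 < l" "l < 1"
    and [measurable]: "f \<in> borel_measurable borel" "g \<in> borel_measurable borel" "h \<in> borel_measurable borel"
    and bd: "\<And>x. f x \<le> ennreal K" "\<And>x. g x \<le> ennreal K"
    and pl: "\<And>x y. pl_le l (f x) (g y) (h (l * x + (1 - l) * y))"
  shows "pl_le l (\<integral>\<^sup>+x. f x \<partial>lborel) (\<integral>\<^sup>+x. g x \<partial>lborel) (\<integral>\<^sup>+x. h x \<partial>lborel)"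
  unfolding pl_le_def
proof (intro allI impI)
  fix a b :: real
  assume a: "0 < a" "ennreal a \<le> (\<integral>\<^sup>+x. f x \<partial>lborel)" and b: "0 < b" "ennreal b \<le> (\<integral>\<^sup>+x. g x \<partial>lborel)"
  have sup: "\<exists>s>0. (SUP x. u x) = ennreal s"
    if "\<And>x. u x \<le> ennreal K" "ennreal a \<le> (\<integral>\<^sup>+x. u x \<partial>lborel)" "0 < a" for u :: "real \<Rightarrow> ennreal" and a
  proof -
    have "(SUP x. u x) \<le> ennreal K" using that by (auto intro: SUP_least)
    then have "(SUP x. u x) < top" using ennreal_less_top order_le_less_trans by blast
    then obtain s where s: "(SUP x. u x) = ennreal s" "0 \<le> s"
      by (metis less_top_ennreal)
    have "s \<noteq> 0"
    proof
      assume "s = 0"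
      then have "u x = 0" for x using s SUP_upper[of x UNIV u] by simp
      then show False using that by simp
    qed
    then show ?thesis using s by (auto intro!: exI[of _ s])
  qed
  obtain s where s: "0 < s" "(SUP x. f x) = ennreal s" using sup[OF bd(1) a(2,1)] by auto
  obtain t where t: "0 < t" "(SUP x. g x) = ennreal t" using sup[OF bd(2) b(2,1)] by auto
  have fs: "f x \<le> ennreal s" and gt: "g x \<le> ennreal t" for x
    using s t SUP_upper[of x UNIV f] SUP_upper[of x UNIV g] by auto
  define S where "S = s powr l * t powr (1 - l)"
  have S: "0 < S" using s t by (simp add: S_def)
  \<comment> \<open>Normalising by the suprema makes both superlevel sets nonempty for every \<open>\<theta> < 1\<close>, as the
    Brunn-Minkowski inequality requires.\<close>
  have level: "ennreal l * emeasure lborel {x. ennreal (\<theta> * s) < f x}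
      + ennreal (1 - l) * emeasure lborel {x. ennreal (\<theta> * t) < g x}
      \<le> emeasure lborel {x. ennreal (\<theta> * S) < h x}" if \<theta>: "0 < \<theta>" "\<theta> < 1" for \<theta>
  proof (rule brunn_minkowski_real[OF l])
    show "{x. ennreal (\<theta> * s) < f x} \<in> sets borel" "{x. ennreal (\<theta> * t) < g x} \<in> sets borel"
      "{x. ennreal (\<theta> * S) < h x} \<in> sets borel" by measurable
    have "ennreal (\<theta> * s) < (SUP x. f x)"
      using s \<theta> by (simp add: ennreal_less_iff)
    then show "{x. ennreal (\<theta> * s) < f x} \<noteq> {}" by (auto simp: less_SUP_iff)
    have "ennreal (\<theta> * t) < (SUP x. g x)"
      using t \<theta> by (simp add: ennreal_less_iff)
    then show "{x. ennreal (\<theta> * t) < g x} \<noteq> {}" by (auto simp: less_SUP_iff)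
    fix x y assume xy: "x \<in> {x. ennreal (\<theta> * s) < f x}" "y \<in> {x. ennreal (\<theta> * t) < g x}"
    obtain a where a: "f x = ennreal a" "0 \<le> a"
      using fs[of x] by (metis ennreal_cases ennreal_less_top top.extremum_strict order_le_less_trans)
    obtain b where b: "g y = ennreal b" "0 \<le> b"
      using gt[of y] by (metis ennreal_cases ennreal_less_top top.extremum_strict order_le_less_trans)
    have ab: "\<theta> * s < a" "\<theta> * t < b"
      using xy a b s t \<theta> by (auto simp: ennreal_less_iff)
    moreover have pos: "0 < \<theta> * s" "0 < \<theta> * t" using s t \<theta> by auto
    ultimately have ab0: "0 < a" "0 < b" by linarith+
    have "\<theta> * S = (\<theta> powr l * \<theta> powr (1 - l)) * S"
      using \<theta> by (simp add: powr_add[symmetric])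
    also have "\<dots> = (\<theta> * s) powr l * (\<theta> * t) powr (1 - l)"
      using \<theta> s t by (simp add: S_def powr_mult)
    also have "\<dots> < a powr l * b powr (1 - l)"
      using ab pos l by (intro mult_strict_mono powr_less_mono2) auto
    finally have "ennreal (\<theta> * S) < ennreal (a powr l * b powr (1 - l))"
      using \<theta> S by (simp add: ennreal_less_iff)
    also have "\<dots> \<le> h (l * x + (1 - l) * y)"
      using pl[of x y] a b ab0 by (auto simp: pl_le_def)
    finally show "l * x + (1 - l) * y \<in> {x. ennreal (\<theta> * S) < h x}" by simp
  qed
  define Phi where "Phi u c = (\<integral>\<^sup>+\<theta>\<in>{0<..<1}. emeasure lborel {x. ennreal (\<theta> * c) < u x} \<partial>lborel)"
    for u :: "real \<Rightarrow> ennreal" and c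
  have [measurable]: "(\<lambda>\<theta>. emeasure lborel {x. ennreal (\<theta> * c) < u x}) \<in> borel_measurable lborel"
    if [measurable]: "u \<in> borel_measurable borel" for u :: "real \<Rightarrow> ennreal" and c
  proof -
    have "(\<lambda>\<theta>. emeasure lborel {x \<in> space lborel. ennreal (\<theta> * c) < u x}) \<in> borel_measurable lborel"
      by measurable
    then show ?thesis by simp
  qed
  have F: "(\<integral>\<^sup>+x. f x \<partial>lborel) = ennreal s * Phi f s"
    using layer_cake[of f s] s fs by (simp add: Phi_def min_absorb1)
  have G: "(\<integral>\<^sup>+x. g x \<partial>lborel) = ennreal t * Phi g t"
    using layer_cake[of g t] t gt by (simp add: Phi_def min_absorb1)
  have H: "ennreal S * Phi h S \<le> (\<integral>\<^sup>+x. h x \<partial>lborel)"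
    using layer_cake[of h S] S by (auto simp: Phi_def intro!: nn_integral_mono simp flip: layer_cake)
  have "ennreal l * Phi f s + ennreal (1 - l) * Phi g t
    = (\<integral>\<^sup>+\<theta>\<in>{0<..<1}. (ennreal l * emeasure lborel {x. ennreal (\<theta> * s) < f x}
      + ennreal (1 - l) * emeasure lborel {x. ennreal (\<theta> * t) < g x}) \<partial>lborel)"
    unfolding Phi_def
    by (subst nn_integral_cmult[symmetric], measurable, subst nn_integral_cmult[symmetric], measurable,
        subst nn_integral_add[symmetric], measurable) (auto intro!: nn_integral_cong simp: algebra_simps)
  also have "\<dots> \<le> Phi h S"
    unfolding Phi_def using level by (intro nn_integral_mono) (auto simp: indicator_def)
  finally have key: "ennreal l * Phi f s + ennreal (1 - l) * Phi g t \<le> Phi h S" .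
  have div: "ennreal (a / s) \<le> P" if "ennreal a \<le> ennreal s * P" "0 < s" "0 < a" for a s P
  proof (cases P)
    case (real r)
    then show ?thesis using that by (simp add: ennreal_mult[symmetric] field_simps)
  qed simp
  have "ennreal (a powr l * b powr (1 - l)) = ennreal S * ennreal ((a / s) powr l * (b / t) powr (1 - l))"
    using s t a b by (simp add: S_def powr_divide ennreal_mult[symmetric])
  also have "\<dots> \<le> ennreal S * ennreal (l * (a / s) + (1 - l) * (b / t))"
    using s t a b l by (intro mult_left_mono ennreal_leI weighted_am_gm) auto
  also have "\<dots> = ennreal S * (ennreal l * ennreal (a / s) + ennreal (1 - l) * ennreal (b / t))"
  proof -
    have "0 \<le> a / s" "0 \<le> b / t" using s t a b by auto
    then have "ennreal (l * (a / s) + (1 - l) * (b / t))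
      = ennreal l * ennreal (a / s) + ennreal (1 - l) * ennreal (b / t)"
      using l by (subst ennreal_plus) (auto simp only: ennreal_mult mult_nonneg_nonneg less_imp_le diff_ge_0_iff_ge)
    then show ?thesis by simp
  qed
  also have "\<dots> \<le> ennreal S * (ennreal l * Phi f s + ennreal (1 - l) * Phi g t)"
    using div[of a s] div[of b t] a b s t F G by (intro mult_left_mono add_mono) auto
  also have "\<dots> \<le> ennreal S * Phi h S"
    by (intro mult_left_mono key) auto
  also note H
  finally show "ennreal (a powr l * b powr (1 - l)) \<le> (\<integral>\<^sup>+x. h x \<partial>lborel)" .
qed

text \<open>
  Shrinking both bounds by a common factor \<open>\<rho> < 1\<close> leaves room for approximating \<open>u\<close> and \<open>v\<close> from below.
\<close>
lemma pl_leI_scaled: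
  assumes l: "0 < l" "l < 1"
    and "\<And>a b \<rho>. \<lbrakk>0 < a; 0 < b; ennreal a \<le> u; ennreal b \<le> v; 0 < \<rho>; \<rho> < 1\<rbrakk> \<Longrightarrow>
      ennreal ((\<rho> * a) powr l * (\<rho> * b) powr (1 - l)) \<le> w"
  shows "pl_le l u v w"
  unfolding pl_le_def
proof (intro allI impI)
  fix a b :: real assume ab: "0 < a" "0 < b" "ennreal a \<le> u" "ennreal b \<le> v"
  define X where "X = a powr l * b powr (1 - l)"
  have X: "0 < X" using ab by (simp add: X_def)
  have *: "ennreal (\<rho> * X) \<le> w" if "0 < \<rho>" "\<rho> < 1" for \<rho>
  proof -
    have "(\<rho> * a) powr l * (\<rho> * b) powr (1 - l) = (\<rho> powr l * \<rho> powr (1 - l)) * X"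
      using ab that by (simp add: X_def powr_mult)
    also have "\<dots> = \<rho> * X" using that by (simp add: powr_add[symmetric])
    finally show ?thesis using assms(3)[OF ab that] by simp
  qed
  have "ennreal X \<le> w"
  proof (rule ccontr)
    assume "\<not> ennreal X \<le> w"
    then have "w < ennreal X" by simp
    then obtain z where z: "w = ennreal z" "0 \<le> z" "z < X"
      by (cases w) (auto simp: ennreal_less_iff)
    have "(z / X + 1) / 2 * X \<le> z"
      using *[of "(z / X + 1) / 2"] z X by (auto simp: field_simps)
    then show False using z X by (simp add: field_simps)
  qed
  then show "ennreal (a powr l * b powr (1 - l)) \<le> w" by (simp add: X_def)
qed

lemma prekopa_leindler_real:
  fixes f g h :: "real \<Rightarrow> ennreal"
  assumes l: "0 < l" "l < 1"
    and [measurable]: "f \<in> borel_measurable borel" "g \<in> borel_measurable borel" "h \<in> borel_measurable borel"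
    and pl: "\<And>x y. pl_le l (f x) (g y) (h (l * x + (1 - l) * y))"
  shows "pl_le l (\<integral>\<^sup>+x. f x \<partial>lborel) (\<integral>\<^sup>+x. g x \<partial>lborel) (\<integral>\<^sup>+x. h x \<partial>lborel)"
proof (rule pl_leI_scaled[OF l])
  fix a b \<rho> :: real
  assume ab: "0 < a" "0 < b" "ennreal a \<le> (\<integral>\<^sup>+x. f x \<partial>lborel)" "ennreal b \<le> (\<integral>\<^sup>+x. g x \<partial>lborel)"
    and \<rho>: "0 < \<rho>" "\<rho> < 1"
  have trunc: "\<exists>n. ennreal (\<rho> * a) \<le> (\<integral>\<^sup>+x. min (u x) (ennreal (real n)) \<partial>lborel)"
    if [measurable]: "u \<in> borel_measurable borel" and a: "0 < a" "ennreal a \<le> (\<integral>\<^sup>+x. u x \<partial>lborel)"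
    for u :: "real \<Rightarrow> ennreal" and a
  proof -
    have "(SUP n. min v (ennreal (real n))) = v" for v :: ennreal
    proof (cases v)
      case (real r)
      obtain n where n: "r \<le> real n" using real_arch_simple by blast
      show ?thesis
      proof (rule antisym)
        show "v \<le> (SUP n. min v (ennreal (real n)))"
          using n real by (intro SUP_upper2[of n]) (auto intro: ennreal_leI)
      qed (auto intro: SUP_least)
    next
      case top
      then show ?thesis using ennreal_SUP_of_nat_eq_top unfolding ennreal_of_nat_eq_real_of_nat by (simp only: min_top)
    qed
    then have "(\<integral>\<^sup>+x. u x \<partial>lborel) = (\<integral>\<^sup>+x. (SUP n. min (u x) (ennreal (real n))) \<partial>lborel)"
      by simp
    also have "\<dots> = (SUP n. \<integral>\<^sup>+x. min (u x) (ennreal (real n)) \<partial>lborel)"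
    proof (rule nn_integral_monotone_convergence_SUP)
      show "incseq (\<lambda>n x. min (u x) (ennreal (real n)))"
        by (intro monoI le_funI min.mono ennreal_leI) auto
    qed measurable
    finally have eq: "(\<integral>\<^sup>+x. u x \<partial>lborel) = (SUP n. \<integral>\<^sup>+x. min (u x) (ennreal (real n)) \<partial>lborel)" .
    have "ennreal (\<rho> * a) < ennreal a"
      using a(1) \<rho> by (simp add: ennreal_less_iff)
    also have "\<dots> \<le> (SUP n. \<integral>\<^sup>+x. min (u x) (ennreal (real n)) \<partial>lborel)"
      using a(2) eq by simp
    finally show ?thesis
      unfolding less_SUP_iff by (blast intro: less_imp_le)
  qed
  obtain n where n: "ennreal (\<rho> * a) \<le> (\<integral>\<^sup>+x. min (f x) (ennreal (real n)) \<partial>lborel)"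
    using trunc[OF _ ab(1,3)] by auto
  obtain m where m: "ennreal (\<rho> * b) \<le> (\<integral>\<^sup>+x. min (g x) (ennreal (real m)) \<partial>lborel)"
    using trunc[OF _ ab(2,4)] by auto
  have "pl_le l (\<integral>\<^sup>+x. min (f x) (ennreal (real n)) \<partial>lborel)
      (\<integral>\<^sup>+x. min (g x) (ennreal (real m)) \<partial>lborel) (\<integral>\<^sup>+x. h x \<partial>lborel)"
  proof (rule prekopa_leindler_real_bounded[OF l, where K = "real (max n m)"])
    fix x y
    show "min (f x) (ennreal (real n)) \<le> ennreal (real (max n m))"
      by (rule min.coboundedI2) (simp add: ennreal_leI)
    show "min (g x) (ennreal (real m)) \<le> ennreal (real (max n m))"
      by (rule min.coboundedI2) (simp add: ennreal_leI)
    show "pl_le l (min (f x) (ennreal (real n))) (min (g y) (ennreal (real m))) (h (l * x + (1 - l) * y))"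
      using pl[of x y] unfolding pl_le_def by (metis min.boundedE)
  qed measurable
  from this[unfolded pl_le_def, rule_format, OF _ _ n m]
  show "ennreal ((\<rho> * a) powr l * (\<rho> * b) powr (1 - l)) \<le> (\<integral>\<^sup>+x. h x \<partial>lborel)"
    using ab(1,2) \<rho> by simp
qed

abbreviation lborel_on :: "'i set \<Rightarrow> ('i \<Rightarrow> real) measure" where
  "lborel_on I \<equiv> PiM I (\<lambda>_. lborel)"

interpretation lborel_prod: product_sigma_finite "\<lambda>_::'i. lborel :: real measure"
  by standard

lemma sigma_finite_lborel_on: "finite I \<Longrightarrow> sigma_finite_measure (lborel_on I)"
  by (rule lborel_prod.sigma_finite)

text \<open>
  Induction on the index set: for fixed last coordinates the induction hypothesis compares the
  integrals over the remaining ones, and the resulting functions of the last coordinate satisfy the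
  hypothesis of the one-dimensional inequality. Here \<open>h\<close> is any function dominating the combination.
\<close>
theorem prekopa_leindler:
  fixes f g h :: "('i \<Rightarrow> real) \<Rightarrow> ennreal"
  assumes I: "finite I" and l: "0 < l" "l < 1"
    and "f \<in> borel_measurable (lborel_on I)" "g \<in> borel_measurable (lborel_on I)"
      "h \<in> borel_measurable (lborel_on I)"
    and "\<And>x y. x \<in> extensional I \<Longrightarrow> y \<in> extensional I \<Longrightarrow>
      pl_le l (f x) (g y) (h (\<lambda>i\<in>I. l * x i + (1 - l) * y i))"
  shows "pl_le l (\<integral>\<^sup>+x. f x \<partial>lborel_on I) (\<integral>\<^sup>+x. g x \<partial>lborel_on I) (\<integral>\<^sup>+x. h x \<partial>lborel_on I)"
  using I assms(4-)
proof (induction I arbitrary: f g h rule: finite_induct)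
  case empty
  have "(\<lambda>i\<in>{}. l * (undefined::real) + (1 - l) * undefined) = (\<lambda>i::'i. undefined)"
    by (simp add: restrict_def)
  then show ?case
    using empty(4)[of "\<lambda>_. undefined" "\<lambda>_. undefined"] by (simp add: lborel_prod.nn_integral_empty)
next
  case (insert i I)
  note [measurable] = insert.prems(1-3)
  interpret I: sigma_finite_measure "lborel_on I" by (rule sigma_finite_lborel_on) fact
  have eq: "(\<integral>\<^sup>+x. u x \<partial>lborel_on (insert i I)) = (\<integral>\<^sup>+y. (\<integral>\<^sup>+x. u (x(i := y)) \<partial>lborel_on I) \<partial>lborel)"
    if "u \<in> borel_measurable (lborel_on (insert i I))" for u :: "('i \<Rightarrow> real) \<Rightarrow> ennreal"
    using insert.hyps that by (rule lborel_prod.product_nn_integral_insert_rev)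
  have comp: "(\<lambda>x. u (x(i := y))) \<in> borel_measurable (lborel_on I)"
    if [measurable]: "u \<in> borel_measurable (lborel_on (insert i I))" for u :: "('i \<Rightarrow> real) \<Rightarrow> ennreal" and y
    by measurable
  show ?case
    unfolding eq[OF insert.prems(1)] eq[OF insert.prems(2)] eq[OF insert.prems(3)]
  proof (rule prekopa_leindler_real[OF l])
    fix s t :: real
    show "pl_le l (\<integral>\<^sup>+x. f (x(i := s)) \<partial>lborel_on I) (\<integral>\<^sup>+x. g (x(i := t)) \<partial>lborel_on I)
        (\<integral>\<^sup>+x. h (x(i := l * s + (1 - l) * t)) \<partial>lborel_on I)"
    proof (rule insert.IH[OF comp[OF insert.prems(1)] comp[OF insert.prems(2)] comp[OF insert.prems(3)]])
      fix x y :: "'i \<Rightarrow> real" assume xy: "x \<in> extensional I" "y \<in> extensional I"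
      have eq2: "(\<lambda>j\<in>I. l * x j + (1 - l) * y j)(i := l * s + (1 - l) * t)
         = (\<lambda>j\<in>insert i I. l * (x(i := s)) j + (1 - l) * (y(i := t)) j)"
        using insert.hyps by (intro ext) (simp add: restrict_def)
      have ext2: "x(i := s) \<in> extensional (insert i I)" "y(i := t) \<in> extensional (insert i I)"
        using xy by (simp_all add: extensional_def)
      show "pl_le l (f (x(i := s))) (g (y(i := t)))
          (h ((\<lambda>j\<in>I. l * x j + (1 - l) * y j)(i := l * s + (1 - l) * t)))"
        unfolding eq2 by (rule insert.prems(4)[OF ext2])
    qed
  qed measurable
qed

section \<open>Measurable roots of real polynomials\<close>

text \<open>
  The monic polynomial \<open>x\<^sup>n + c\<^sub>0 x\<^sup>n\<^sup>-\<^sup>1 + \<dots> + c\<^sub>n\<^sub>-\<^sub>1\<close> in Horner form. With the leading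
  coefficients first, the last coefficient is the one that is adjusted when a root is prescribed, and all the
  changes of coordinates below become triangular.
\<close>
primrec hp :: "nat \<Rightarrow> (nat \<Rightarrow> real) \<Rightarrow> real \<Rightarrow> real" where
  "hp 0 c x = 1"
| "hp (Suc n) c x = x * hp n c x + c n"

text \<open>
  The partial values of Horner's scheme at \<open>t\<close> are the coefficients of the quotient by \<open>x - t\<close>.
\<close>
definition deflate :: "real \<Rightarrow> (nat \<Rightarrow> real) \<Rightarrow> nat \<Rightarrow> real" where
  "deflate t c k = hp (Suc k) c t"

lemma hp_cong: "(\<And>k. k < n \<Longrightarrow> c k = d k) \<Longrightarrow> hp n c x = hp n d x"
  by (induction n) simp_all

lemma deflate_cong: "(\<And>j. j \<le> k \<Longrightarrow> c j = d j) \<Longrightarrow> deflate t c k = deflate t d k"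
  unfolding deflate_def by (rule hp_cong) simp

lemma hp_deflate: "hp (Suc n) c x = (x - t) * hp n (deflate t c) x + hp (Suc n) c t"
proof (induction n)
  case (Suc n)
  have "hp (Suc (Suc n)) c x = x * ((x - t) * hp n (deflate t c) x + hp (Suc n) c t) + c (Suc n)"
    using Suc by simp
  also have "\<dots> = (x - t) * hp (Suc n) (deflate t c) x + hp (Suc (Suc n)) c t"
    by (simp add: deflate_def algebra_simps)
  finally show ?case .
qed simp

lemma isCont_hp: "isCont (hp n c) x"
proof (induction n)
  case 0 then show ?case by simp
next
  case (Suc n)
  then show ?case by (simp only: hp.simps continuous_intros)
qed

lemma isCont_eq_off_point:
  fixes f g :: "real \<Rightarrow> real"
  assumes "isCont f t" "isCont g t" "\<And>x. x \<noteq> t \<Longrightarrow> f x = g x"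
  shows "f x = g x"
proof (cases "x = t")
  case True
  have "(f \<longlongrightarrow> f t) (at t)" using assms(1) by (simp add: isCont_def)
  moreover have "(f \<longlongrightarrow> g t) (at t)"
  proof (rule Lim_transform_eventually)
    show "(g \<longlongrightarrow> g t) (at t)" using assms(2) by (simp add: isCont_def)
    show "\<forall>\<^sub>F x in at t. g x = f x" using assms(3) by (auto simp: eventually_at_filter)
  qed
  ultimately have "f t = g t" by (intro tendsto_unique[of "at t"]) auto
  then show ?thesis using True by simp
qed (use assms in auto)

lemma isCont_eq_rat:
  fixes f g :: "real \<Rightarrow> real"
  assumes "\<And>x. isCont f x" "\<And>x. isCont g x" "\<And>q. f (real_of_rat q) = g (real_of_rat q)"
  shows "f x = g x"
proof (rule ccontr)
  assume ne: "f x \<noteq> g x"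
  have "isCont (\<lambda>x. f x - g x) x" using assms by (intro continuous_intros)
  then have "((\<lambda>x. f x - g x) \<longlongrightarrow> f x - g x) (at x)" by (simp add: isCont_def)
  then have "\<forall>\<^sub>F y in at x. f y - g y \<noteq> 0"
    by (rule tendsto_imp_eventually_ne) (use ne in simp)
  then obtain d where d: "d > 0" "\<And>y. y \<noteq> x \<Longrightarrow> \<bar>y - x\<bar> < d \<Longrightarrow> f y - g y \<noteq> 0"
    unfolding eventually_at dist_real_def by blast
  obtain q where "x < real_of_rat q" "real_of_rat q < x + d"
    using d of_rat_dense[of x "x + d"] by auto
  then show False using d(2)[of "real_of_rat q"] assms(3)[of q] by auto
qed

definition strict_incr :: "nat \<Rightarrow> (nat \<Rightarrow> real) \<Rightarrow> bool" where
  "strict_incr n lam \<longleftrightarrow> (\<forall>j<n. \<forall>i<j. lam i < lam j)"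

text \<open>
  The largest root, for polynomials with only real roots. It is written with an infimum over the rationals
  because this is visibly measurable in the coefficients; \<open>(q - t)\<^sup>n \<le> p q\<close> for all \<open>q > t\<close>
  characterises the upper bounds \<open>t\<close> of the roots. For other polynomials the value is
  meaningless but still measurable.
\<close>
definition top_root :: "nat \<Rightarrow> (nat \<Rightarrow> real) \<Rightarrow> real" where
  "top_root n c = real_of_ereal (INF t::rat.
     if \<forall>q. t < q \<longrightarrow> (real_of_rat q - real_of_rat t) ^ n \<le> hp n c (real_of_rat q)
     then ereal (real_of_rat t) else \<infinity>)"

text \<open>
  The roots in increasing order: the largest one is split off and the quotient is treated recursively.
\<close>
primrec roots :: "nat \<Rightarrow> (nat \<Rightarrow> real) \<Rightarrow> nat \<Rightarrow> real" where
  "roots 0 c = (\<lambda>_. undefined)"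
| "roots (Suc n) c = (roots n (deflate (top_root (Suc n) c) c))(n := top_root (Suc n) c)"

lemma roots_extensional: "roots n c \<in> extensional {..<n}"
proof (induction n arbitrary: c)
  case (Suc n)
  then show ?case by (auto simp: extensional_def)
qed (simp add: extensional_def)

lemma top_root_eq:
  assumes hp: "\<And>x. hp (Suc n) c x = (\<Prod>k<Suc n. x - lam k)"
    and mono: "\<And>k. k \<le> n \<Longrightarrow> lam k \<le> lam n"
  shows "top_root (Suc n) c = lam n"
proof -
  have iff: "(\<forall>q. t < q \<longrightarrow> (real_of_rat q - real_of_rat t) ^ Suc n \<le> hp (Suc n) c (real_of_rat q))
      \<longleftrightarrow> lam n \<le> real_of_rat t" (is "?L \<longleftrightarrow> ?R") for t
  proof
    assume R: ?R
    show ?L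
    proof (intro allI impI)
      fix q assume "t < q"
      then have tq: "real_of_rat t < real_of_rat q" by (simp add: of_rat_less)
      have "(real_of_rat q - real_of_rat t) ^ Suc n = (\<Prod>k<Suc n. real_of_rat q - real_of_rat t)"
        by simp
      also have "\<dots> \<le> (\<Prod>k<Suc n. real_of_rat q - lam k)"
      proof (rule prod_mono)
        fix k assume "k \<in> {..<Suc n}"
        then have "lam k \<le> lam n" using mono by simp
        then show "0 \<le> real_of_rat q - real_of_rat t \<and>
            real_of_rat q - real_of_rat t \<le> real_of_rat q - lam k"
          using R tq by linarith
      qed
      finally show "(real_of_rat q - real_of_rat t) ^ Suc n \<le> hp (Suc n) c (real_of_rat q)"
        by (simp only: hp)
    qed
  next
    assume L: ?L
    show ?R
    proof (rule ccontr)
      assume nR: "\<not> ?R"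
      let ?f = "\<lambda>x. hp (Suc n) c x - (x - real_of_rat t) ^ Suc n"
      have z: "hp (Suc n) c (lam n) = 0" by (subst hp) simp
      have neg: "?f (lam n) < 0" using nR unfolding z by (simp del: power_Suc)
      have "isCont ?f (lam n)" by (intro continuous_intros isCont_hp)
      then have "(?f \<longlongrightarrow> ?f (lam n)) (at (lam n))" by (simp only: isCont_def)
      from order_tendstoD(2)[OF this neg] obtain d where
        d: "d > 0" "\<And>y. y \<noteq> lam n \<Longrightarrow> \<bar>y - lam n\<bar> < d \<Longrightarrow> ?f y < 0"
        by (auto simp: eventually_at dist_real_def simp del: power_Suc hp.simps)
      obtain q where q: "lam n < real_of_rat q" "real_of_rat q < lam n + d"
        using d(1) of_rat_dense[of "lam n" "lam n + d"] by auto
      have "real_of_rat t < real_of_rat q" using q nR by linarith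
      then have "t < q" by (simp add: of_rat_less)
      then have "0 \<le> ?f (real_of_rat q)" using L by (simp del: power_Suc hp.simps)
      then show False using d(2)[of "real_of_rat q"] q by (simp del: power_Suc hp.simps)
    qed
  qed
  have "(INF t::rat. if \<forall>q. t < q \<longrightarrow> (real_of_rat q - real_of_rat t) ^ Suc n \<le> hp (Suc n) c (real_of_rat q)
     then ereal (real_of_rat t) else \<infinity>) = ereal (lam n)"
    unfolding iff
  proof (rule antisym)
    show "(INF t::rat. if lam n \<le> real_of_rat t then ereal (real_of_rat t) else \<infinity>) \<le> ereal (lam n)"
    proof (rule ereal_le_epsilon2)
      fix e :: real assume "0 < e"
      then obtain q where q: "lam n < real_of_rat q" "real_of_rat q < lam n + e"
        using of_rat_dense[of "lam n" "lam n + e"] by auto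
      then show "(INF t::rat. if lam n \<le> real_of_rat t then ereal (real_of_rat t) else \<infinity>) \<le> ereal (lam n) + ereal e"
        by (intro INF_lower2[of q]) simp_all
    qed
    show "ereal (lam n) \<le> (INF t::rat. if lam n \<le> real_of_rat t then ereal (real_of_rat t) else \<infinity>)"
      by (rule INF_greatest) simp
  qed
  then show ?thesis unfolding top_root_def by simp
qed

lemma isCont_prod_diff: "isCont (\<lambda>x. \<Prod>k<n. x - lam k :: real) x"
  by (intro continuous_intros)

lemma hp_deflate_root:
  assumes hp: "\<And>x. hp (Suc n) c x = (\<Prod>k<Suc n. x - lam k)"
  shows "hp n (deflate (lam n) c) x = (\<Prod>k<n. x - lam k)"
proof (rule isCont_eq_off_point[where t = "lam n" and f = "hp n (deflate (lam n) c)" and g = "\<lambda>x. \<Prod>k<n. x - lam k"])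
  fix x assume x: "x \<noteq> lam n"
  have "hp (Suc n) c (lam n) = 0" by (subst hp) simp
  then have "(x - lam n) * hp n (deflate (lam n) c) x = (x - lam n) * (\<Prod>k<n. x - lam k)"
    using hp_deflate[of n c x "lam n"] hp[of x] by (simp add: mult.commute)
  then show "hp n (deflate (lam n) c) x = (\<Prod>k<n. x - lam k)" using x by simp
qed (rule isCont_hp isCont_prod_diff)+

lemma roots_unique:
  assumes "\<And>x. hp n c x = (\<Prod>k<n. x - lam k)"
    and "\<And>i j. i \<le> j \<Longrightarrow> j < n \<Longrightarrow> lam i \<le> lam j" and "k < n"
  shows "roots n c k = lam k"
  using assms
proof (induction n arbitrary: c k)
  case (Suc n)
  have top: "top_root (Suc n) c = lam n"
    by (rule top_root_eq) (use Suc.prems in auto)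
  show ?case
  proof (cases "k = n")
    case False
    then have "roots n (deflate (lam n) c) k = lam k"
      using Suc.prems hp_deflate_root[OF Suc.prems(1)] by (intro Suc.IH) simp_all
    then show ?thesis using top False by simp
  qed (simp add: top)
qed simp

lemma measurable_hp [measurable (raw)]:
  assumes "\<And>k. k < n \<Longrightarrow> (\<lambda>w. c w k) \<in> borel_measurable M" "t \<in> borel_measurable M"
  shows "(\<lambda>w. hp n (c w) (t w)) \<in> borel_measurable M"
  using assms
proof (induction n)
  case (Suc n)
  have [measurable]: "(\<lambda>w. hp n (c w) (t w)) \<in> borel_measurable M" using Suc by simp
  have [measurable]: "(\<lambda>w. c w n) \<in> borel_measurable M" using Suc by simp
  note Suc.prems(2)[measurable]
  show ?case by simp
qed simp

lemma measurable_top_root: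
  assumes "\<And>k. k < n \<Longrightarrow> (\<lambda>w. c w k) \<in> borel_measurable M"
  shows "(\<lambda>w. top_root n (c w)) \<in> borel_measurable M"
proof -
  have [measurable]: "(\<lambda>w. hp n (c w) x) \<in> borel_measurable M" for x
    using assms by (intro measurable_hp) auto
  show ?thesis unfolding top_root_def by measurable
qed

lemma measurable_roots:
  assumes "\<And>k. k < n \<Longrightarrow> (\<lambda>w. c w k) \<in> borel_measurable M" "i < n"
  shows "(\<lambda>w. roots n (c w) i) \<in> borel_measurable M"
  using assms
proof (induction n arbitrary: c i)
  case (Suc n)
  have top: "(\<lambda>w. top_root (Suc n) (c w)) \<in> borel_measurable M"
    using Suc.prems(1) by (rule measurable_top_root)
  show ?case
  proof (cases "i = n")
    case False
    have "(\<lambda>w. deflate (top_root (Suc n) (c w)) (c w) k) \<in> borel_measurable M" if "k < n" for k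
      unfolding deflate_def using Suc.prems(1) that top by (intro measurable_hp) auto
    then show ?thesis using False Suc.IH[of "\<lambda>w. deflate (top_root (Suc n) (c w)) (c w)" i] Suc.prems(2)
      by simp
  qed (simp add: top)
qed simp

lemma measurable_roots_PiM:
  assumes "\<And>k. k < n \<Longrightarrow> (\<lambda>w. c w k) \<in> borel_measurable M"
  shows "(\<lambda>w. roots n (c w)) \<in> measurable M (lborel_on {..<n})"
proof (rule measurable_PiM_single')
  show "(\<lambda>w. roots n (c w) i) \<in> measurable M lborel" if "i \<in> {..<n}" for i
    using measurable_roots[of n c M i, OF assms] that by simp
  show "(\<lambda>w. roots n (c w)) \<in> space M \<rightarrow> (\<Pi>\<^sub>E i\<in>{..<n}. space lborel)"
    using roots_extensional by (auto simp: PiE_def)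
qed

text \<open>
  The polynomial has \<open>n\<close> different real roots. Comparing it with the product at rational points only makes
  this a measurable condition, and continuity extends the identity to all reals.
\<close>
definition simple_rooted :: "nat \<Rightarrow> (nat \<Rightarrow> real) \<Rightarrow> bool" where
  "simple_rooted n c \<longleftrightarrow> strict_incr n (roots n c) \<and>
     (\<forall>q. hp n c (real_of_rat q) = (\<Prod>k<n. real_of_rat q - roots n c k))"

lemma simple_rootedD:
  assumes "simple_rooted n c"
  shows "strict_incr n (roots n c)" "hp n c x = (\<Prod>k<n. x - roots n c k)"
proof -
  show "strict_incr n (roots n c)" using assms by (simp add: simple_rooted_def)
  show "hp n c x = (\<Prod>k<n. x - roots n c k)"
    by (rule isCont_eq_rat[where f = "hp n c" and g = "\<lambda>x. \<Prod>k<n. x - roots n c k"]) (use assms in \<open>auto simp: simple_rooted_def intro: isCont_hp isCont_prod_diff\<close>)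
qed

lemma strict_incr_le: "strict_incr n lam \<Longrightarrow> i \<le> j \<Longrightarrow> j < n \<Longrightarrow> lam i \<le> lam j"
  unfolding strict_incr_def by (cases "i = j") (auto intro: less_imp_le)

lemma simple_rootedI:
  assumes inc: "strict_incr n lam" and hp: "\<And>x. hp n c x = (\<Prod>k<n. x - lam k)"
  shows "simple_rooted n c" "k < n \<Longrightarrow> roots n c k = lam k"
proof -
  have r: "roots n c k = lam k" if "k < n" for k
    by (rule roots_unique[OF hp strict_incr_le[OF inc] that])
  then show "k < n \<Longrightarrow> roots n c k = lam k" .
  have "(\<Prod>k<n. x - roots n c k) = (\<Prod>k<n. x - lam k)" for x
    using r by (intro prod.cong) auto
  moreover have "strict_incr n (roots n c)"
    using inc r by (simp add: strict_incr_def)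
  ultimately show "simple_rooted n c"
    unfolding simple_rooted_def using hp by simp
qed

lemma measurable_strict_incr [measurable (raw)]:
  assumes "\<And>k. k < n \<Longrightarrow> (\<lambda>w. r w k) \<in> borel_measurable M"
  shows "Measurable.pred M (\<lambda>w. strict_incr n (r w))"
proof -
  have "Measurable.pred M (\<lambda>w. j < n \<longrightarrow> i < j \<longrightarrow> r w i < r w j)" for i j
  proof (cases "j < n \<and> i < j")
    case True
    then have [measurable]: "(\<lambda>w. r w i) \<in> borel_measurable M" "(\<lambda>w. r w j) \<in> borel_measurable M"
      using assms[of i] assms[of j] by auto
    show ?thesis using True by simp
  qed auto
  then have "Measurable.pred M (\<lambda>w. \<forall>j. \<forall>i. j < n \<longrightarrow> i < j \<longrightarrow> r w i < r w j)"
    by (intro pred_intros_countable)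
  also have "(\<lambda>w. \<forall>j. \<forall>i. j < n \<longrightarrow> i < j \<longrightarrow> r w i < r w j) = (\<lambda>w. strict_incr n (r w))"
    by (auto simp: strict_incr_def fun_eq_iff)
  finally show ?thesis .
qed

lemma measurable_simple_rooted:
  assumes "\<And>k. k < n \<Longrightarrow> (\<lambda>w. c w k) \<in> borel_measurable M"
  shows "Measurable.pred M (\<lambda>w. simple_rooted n (c w))"
proof -
  have 1: "(\<lambda>w. roots n (c w) k) \<in> borel_measurable M" if "k < n" for k
    using assms that by (rule measurable_roots)
  have [measurable]: "Measurable.pred M (\<lambda>w. strict_incr n (roots n (c w)))"
    using 1 by (rule measurable_strict_incr)
  have [measurable]: "(\<lambda>w. hp n (c w) x) \<in> borel_measurable M" for x
    using assms by (intro measurable_hp) auto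
  have [measurable]: "(\<lambda>w. \<Prod>k<n. x - roots n (c w) k) \<in> borel_measurable M" for x
    using 1 by (intro borel_measurable_prod borel_measurable_diff) auto
  show ?thesis unfolding simple_rooted_def by measurable
qed

section \<open>Changes of variables\<close>

lemma absolutely_integrable_on_iff_nn:
  fixes u :: "real \<Rightarrow> real"
  assumes [measurable]: "u \<in> borel_measurable borel" "E \<in> sets borel" and nn: "\<And>x. 0 \<le> u x"
  shows "u absolutely_integrable_on E \<longleftrightarrow> (\<integral>\<^sup>+x. ennreal (u x) * indicator E x \<partial>lborel) < \<infinity>"
    and "u absolutely_integrable_on E \<Longrightarrow>
      (\<integral>\<^sup>+x. ennreal (u x) * indicator E x \<partial>lborel) = ennreal (integral E u)"
proof -
  have eq: "(\<integral>\<^sup>+x. ennreal (u x) * indicator E x \<partial>lborel) = (\<integral>\<^sup>+x. ennreal (indicator E x * u x) \<partial>lborel)"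
    by (intro nn_integral_cong) (simp split: split_indicator)
  have iff: "u absolutely_integrable_on E \<longleftrightarrow> integrable lborel (\<lambda>x. indicator E x * u x)"
    unfolding set_integrable_def by (simp add: integrable_completion)
  show "u absolutely_integrable_on E \<longleftrightarrow> (\<integral>\<^sup>+x. ennreal (u x) * indicator E x \<partial>lborel) < \<infinity>"
    unfolding iff eq integrable_iff_bounded using nn by simp
  show "(\<integral>\<^sup>+x. ennreal (u x) * indicator E x \<partial>lborel) = ennreal (integral E u)"
    if "u absolutely_integrable_on E"
  proof -
    have "integral E u = (LINT x:E|lebesgue. u x)"
      using that by (rule set_lebesgue_integral_eq_integral(2)[symmetric])
    also have "\<dots> = (LINT x|lborel. indicator E x * u x)"
      unfolding set_lebesgue_integral_def by (simp add: integral_completion)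
    finally show ?thesis
      unfolding eq using that nn by (simp add: iff nn_integral_eq_integral)
  qed
qed

text \<open>
  The change of variables theorem for absolutely integrable functions, extended to the case in which both
  sides are infinite.
\<close>
lemma emeasure_image_deriv:
  fixes g g' :: "real \<Rightarrow> real"
  assumes [measurable]: "E \<in> sets borel" "g ` E \<in> sets borel" "g' \<in> borel_measurable borel"
    and der: "\<And>x. x \<in> E \<Longrightarrow> (g has_real_derivative g' x) (at x)" and inj: "inj_on g E"
  shows "emeasure lborel (g ` E) = (\<integral>\<^sup>+x. ennreal \<bar>g' x\<bar> * indicator E x \<partial>lborel)"
proof -
  have E: "E \<in> sets lebesgue" using assms(1) by simp
  have *: "(\<lambda>x. \<bar>g' x\<bar>) absolutely_integrable_on E \<and> integral E (\<lambda>x. \<bar>g' x\<bar>) = b \<longleftrightarrow>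
      (\<lambda>_. 1::real) absolutely_integrable_on (g ` E) \<and> integral (g ` E) (\<lambda>_. 1::real) = b" for b
    using has_absolute_integral_change_of_variables_1'[OF E _ inj, of g' "\<lambda>_. 1" b] der
    by (simp add: has_field_derivative_at_within)
  have m: "emeasure lborel (g ` E) = (\<integral>\<^sup>+x. ennreal 1 * indicator (g ` E) x \<partial>lborel)"
    by simp
  show ?thesis
  proof (cases "(\<lambda>_. 1::real) absolutely_integrable_on (g ` E)")
    case True
    then have 1: "(\<lambda>x. \<bar>g' x\<bar>) absolutely_integrable_on E"
      "integral E (\<lambda>x. \<bar>g' x\<bar>) = integral (g ` E) (\<lambda>_. 1::real)"
      using * by auto
    show ?thesis
      unfolding m
      by (subst absolutely_integrable_on_iff_nn(2)[OF _ _ _ True], simp, simp, simp,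
          subst absolutely_integrable_on_iff_nn(2)[OF _ _ _ 1(1)]) (simp_all add: 1)
  next
    case False
    then have "\<not> (\<lambda>x. \<bar>g' x\<bar>) absolutely_integrable_on E"
      using * by blast
    then have "(\<integral>\<^sup>+x. ennreal \<bar>g' x\<bar> * indicator E x \<partial>lborel) = \<infinity>"
      using absolutely_integrable_on_iff_nn(1)[of "\<lambda>x. \<bar>g' x\<bar>" E] by (simp add: less_top[symmetric])
    moreover have "emeasure lborel (g ` E) = \<infinity>"
      using False absolutely_integrable_on_iff_nn(1)[of "\<lambda>_. 1" "g ` E"] unfolding m
      by (simp add: less_top[symmetric])
    ultimately show ?thesis by simp
  qed
qed

text \<open>
  For indicators \<open>u\<close> this is \<open>emeasure_image_deriv\<close>, applied to subsets of \<open>E\<close>; the general case is the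
  equality of the two measures.
\<close>
lemma nn_integral_change_of_variable:
  fixes g g' :: "real \<Rightarrow> real" and u :: "real \<Rightarrow> ennreal"
  assumes [measurable]: "E \<in> sets borel" "g ` E \<in> sets borel" "g' \<in> borel_measurable borel"
      "g \<in> borel_measurable borel" "u \<in> borel_measurable borel"
    and der: "\<And>x. x \<in> E \<Longrightarrow> (g has_real_derivative g' x) (at x)" and inj: "inj_on g E"
  shows "(\<integral>\<^sup>+y. indicator (g ` E) y * u y \<partial>lborel)
    = (\<integral>\<^sup>+x. (ennreal \<bar>g' x\<bar> * indicator E x) * u (g x) \<partial>lborel)"
proof -
  let ?d = "density lborel (\<lambda>x. ennreal \<bar>g' x\<bar> * indicator E x)"
  have eq: "distr ?d borel g = density lborel (indicator (g ` E))"
  proof (rule measure_eqI)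
    fix B assume "B \<in> sets (distr ?d borel g)"
    then have [measurable]: "B \<in> sets borel" by simp
    have im: "g ` (E \<inter> g -` B) = g ` E \<inter> B" by auto
    have [measurable]: "g -` B \<in> sets borel"
      using measurable_sets[of g borel borel B] by simp
    have "emeasure (distr ?d borel g) B = (\<integral>\<^sup>+x. (ennreal \<bar>g' x\<bar> * indicator E x) * indicator (g -` B) x \<partial>lborel)"
      by (simp add: emeasure_distr emeasure_density)
    also have "\<dots> = (\<integral>\<^sup>+x. ennreal \<bar>g' x\<bar> * indicator (E \<inter> g -` B) x \<partial>lborel)"
      by (intro nn_integral_cong) (simp split: split_indicator)
    also have "\<dots> = emeasure lborel (g ` (E \<inter> g -` B))"
      by (rule emeasure_image_deriv[symmetric])
         (use der inj in \<open>auto simp: im intro: inj_on_subset\<close>)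
    also have "\<dots> = emeasure (density lborel (indicator (g ` E))) B"
      unfolding im by (simp add: emeasure_density indicator_inter_arith[symmetric])
    finally show "emeasure (distr ?d borel g) B = emeasure (density lborel (indicator (g ` E))) B" .
  qed simp
  have "(\<integral>\<^sup>+y. indicator (g ` E) y * u y \<partial>lborel) = (\<integral>\<^sup>+y. u y \<partial>density lborel (indicator (g ` E)))"
    by (subst nn_integral_density) auto
  also have "\<dots> = (\<integral>\<^sup>+y. u y \<partial>distr ?d borel g)" by (simp only: eq)
  also have "\<dots> = (\<integral>\<^sup>+x. u (g x) \<partial>?d)" by (rule nn_integral_distr) auto
  also have "\<dots> = (\<integral>\<^sup>+x. (ennreal \<bar>g' x\<bar> * indicator E x) * u (g x) \<partial>lborel)"
    by (subst nn_integral_density) auto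
  finally show ?thesis .
qed

lemma PiM_Suc_insert: "lborel_on {..<Suc n} = lborel_on (insert n {..<n})"
  by (simp add: lessThan_Suc)

lemma nn_integral_lborel_Suc:
  assumes "f \<in> borel_measurable (lborel_on {..<Suc n})"
  shows "(\<integral>\<^sup>+c. f c \<partial>lborel_on {..<Suc n}) = (\<integral>\<^sup>+c. \<integral>\<^sup>+y. f (c(n := y)) \<partial>lborel \<partial>lborel_on {..<n})"
    and "(\<integral>\<^sup>+c. f c \<partial>lborel_on {..<Suc n}) = (\<integral>\<^sup>+y. \<integral>\<^sup>+c. f (c(n := y)) \<partial>lborel_on {..<n} \<partial>lborel)"
  using assms unfolding PiM_Suc_insert
  by (intro lborel_prod.product_nn_integral_insert lborel_prod.product_nn_integral_insert_rev; simp)+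

lemma measurable_upd_Suc:
  assumes "f \<in> measurable M (lborel_on {..<n})" "h \<in> borel_measurable M"
  shows "(\<lambda>w. (f w)(n := h w)) \<in> measurable M (lborel_on {..<Suc n})"
  using assms by (intro measurable_fun_upd[where J = "{..<n}"]) auto

lemma measurable_nn_integral_lborel_on:
  assumes "finite I" "case_prod f \<in> borel_measurable (N \<Otimes>\<^sub>M lborel_on I)"
  shows "(\<lambda>x. \<integral>\<^sup>+y. f x y \<partial>lborel_on I) \<in> borel_measurable N"
proof -
  interpret sigma_finite_measure "lborel_on I" by (rule sigma_finite_lborel_on) fact
  show ?thesis using assms(2) by (rule borel_measurable_nn_integral)
qed

lemma Fubini_lborel_on:
  fixes f :: "('i \<Rightarrow> real) \<Rightarrow> real \<Rightarrow> ennreal"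
  assumes I: "finite I" and f: "case_prod f \<in> borel_measurable (lborel_on I \<Otimes>\<^sub>M lborel)"
  shows "(\<integral>\<^sup>+x. \<integral>\<^sup>+y. f x y \<partial>lborel \<partial>lborel_on I) = (\<integral>\<^sup>+y. \<integral>\<^sup>+x. f x y \<partial>lborel_on I \<partial>lborel)"
proof -
  interpret pair_sigma_finite "lborel_on I" "lborel :: real measure"
    by (intro pair_sigma_finite.intro sigma_finite_lborel_on I sigma_finite_lborel)
  show ?thesis using Fubini'[OF f] by simp
qed

lemma nn_integral_lborel_translate:
  fixes f :: "real \<Rightarrow> ennreal"
  assumes "f \<in> borel_measurable borel"
  shows "(\<integral>\<^sup>+y. f (y + t) \<partial>lborel) = (\<integral>\<^sup>+y. f y \<partial>lborel)"
  using nn_integral_real_affine[OF assms, of 1 t] by (simp add: add.commute)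

lemma measurable_component_lborel: "k < n \<Longrightarrow> (\<lambda>c. c k) \<in> borel_measurable (lborel_on {..<n})"
  using measurable_component_singleton[of k "{..<n}" "\<lambda>_. lborel"] by simp

text \<open>
  Shifting each coordinate by a function of the earlier ones is a composition of translations along the
  axes, hence preserves Lebesgue measure.
\<close>
lemma nn_integral_triangular:
  fixes \<phi> :: "nat \<Rightarrow> (nat \<Rightarrow> real) \<Rightarrow> real"
  assumes cong: "\<And>k c d. (\<And>j. j < k \<Longrightarrow> c j = d j) \<Longrightarrow> \<phi> k c = \<phi> k d"
    and meas: "\<And>k m. k < m \<Longrightarrow> \<phi> k \<in> borel_measurable (lborel_on {..<m})"
    and "g \<in> borel_measurable (lborel_on {..<n})"
  shows "(\<integral>\<^sup>+c. g (\<lambda>k\<in>{..<n}. c k + \<phi> k c) \<partial>lborel_on {..<n}) = (\<integral>\<^sup>+c. g c \<partial>lborel_on {..<n})"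
  using assms(3)
proof (induction n arbitrary: g)
  case 0
  then show ?case by (simp add: lborel_prod.nn_integral_empty restrict_def del: nn_integral_const)
next
  case (Suc n)
  note [measurable] = Suc.prems
  let ?T = "\<lambda>n c. \<lambda>k\<in>{..<n}. c k + \<phi> k c"
  have T: "?T n \<in> measurable (lborel_on {..<m}) (lborel_on {..<n})" if "n \<le> m" for n m
  proof (rule measurable_restrict)
    fix i assume "i \<in> {..<n}"
    then have "i < m" using that by simp
    have "(\<lambda>c. c i + \<phi> i c) \<in> borel_measurable (lborel_on {..<m})"
      by (intro borel_measurable_add measurable_component_lborel meas \<open>i < m\<close>)
    then show "(\<lambda>c. c i + \<phi> i c) \<in> measurable (lborel_on {..<m}) lborel" by simp
  qed
  have upd: "?T (Suc n) (c(n := y)) = (?T n c)(n := y + \<phi> n c)" for c y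
  proof
    fix k
    have "\<phi> k (c(n := y)) = \<phi> k c" if "k \<le> n" using that by (intro cong) simp
    then show "?T (Suc n) (c(n := y)) k = ((?T n c)(n := y + \<phi> n c)) k"
      by (auto simp: restrict_def less_Suc_eq)
  qed
  let ?g = "\<lambda>u. \<integral>\<^sup>+y. g (u(n := y)) \<partial>lborel"
  have gu: "(\<lambda>y. g (u(n := y))) \<in> borel_measurable borel" if u: "u \<in> space (lborel_on {..<n})" for u
  proof -
    have "(\<lambda>y. u(n := y)) \<in> measurable borel (lborel_on {..<Suc n})"
      by (rule measurable_upd_Suc) (use u in auto)
    from measurable_compose[OF this Suc.prems] show ?thesis .
  qed
  have g': "?g \<in> borel_measurable (lborel_on {..<n})"
  proof -
    have "(\<lambda>p. (fst p)(n := snd p)) \<in> measurable (lborel_on {..<n} \<Otimes>\<^sub>M lborel) (lborel_on {..<Suc n})"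
      by (rule measurable_upd_Suc) auto
    from measurable_compose[OF this Suc.prems] show ?thesis
      by (intro lborel.borel_measurable_nn_integral) (simp only: case_prod_beta')
  qed
  have "(\<integral>\<^sup>+c. g (?T (Suc n) c) \<partial>lborel_on {..<Suc n})
    = (\<integral>\<^sup>+c. \<integral>\<^sup>+y. g (?T (Suc n) (c(n := y))) \<partial>lborel \<partial>lborel_on {..<n})"
    by (rule nn_integral_lborel_Suc(1)) (rule measurable_compose[OF T[OF order_refl] Suc.prems])
  also have "\<dots> = (\<integral>\<^sup>+c. ?g (?T n c) \<partial>lborel_on {..<n})"
    unfolding upd
  proof (rule nn_integral_cong)
    fix c assume c: "c \<in> space (lborel_on {..<n})"
    have "?T n c \<in> space (lborel_on {..<n})"
      using measurable_space[OF T[OF order_refl] c] .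
    from nn_integral_lborel_translate[OF gu[OF this]]
    show "(\<integral>\<^sup>+y. g ((?T n c)(n := y + \<phi> n c)) \<partial>lborel) = ?g (?T n c)" .
  qed
  also have "\<dots> = (\<integral>\<^sup>+c. ?g c \<partial>lborel_on {..<n})"
    by (rule Suc.IH[OF g'])
  also have "\<dots> = (\<integral>\<^sup>+c. g c \<partial>lborel_on {..<Suc n})"
    by (rule nn_integral_lborel_Suc(1)[symmetric]) fact
  finally show ?case .
qed

text \<open>
  Each entry of \<open>deflate t c\<close> is \<open>c k\<close> plus a function of the earlier coefficients.
\<close>
lemma nn_integral_deflate:
  assumes "g \<in> borel_measurable (lborel_on {..<n})"
  shows "(\<integral>\<^sup>+c. g (restrict (deflate t c) {..<n}) \<partial>lborel_on {..<n}) = (\<integral>\<^sup>+c. g c \<partial>lborel_on {..<n})"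
proof -
  have eq: "restrict (deflate t c) {..<n} = (\<lambda>k\<in>{..<n}. c k + t * hp k c t)" for c
    by (simp add: deflate_def restrict_def fun_eq_iff)
  show ?thesis
    unfolding eq
  proof (rule nn_integral_triangular[OF _ _ assms])
    fix k m :: nat assume "k < m"
    then show "(\<lambda>c. t * hp k c t) \<in> borel_measurable (lborel_on {..<m})"
      by (intro borel_measurable_times borel_measurable_const measurable_hp measurable_component_lborel) auto
  qed (simp cong: hp_cong)
qed

definition vdm :: "nat \<Rightarrow> (nat \<Rightarrow> real) \<Rightarrow> real" where
  "vdm n z = (\<Prod>j<n. \<Prod>i<j. z j - z i)"

lemma vdm_Suc: "vdm (Suc n) z = vdm n z * (\<Prod>i<n. z n - z i)"
  by (simp add: vdm_def)

lemma vdm_cong: "(\<And>k. k < n \<Longrightarrow> z k = z' k) \<Longrightarrow> vdm n z = vdm n z'"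
  unfolding vdm_def by (intro prod.cong) auto

lemma strict_incr_cong: "(\<And>k. k < n \<Longrightarrow> z k = z' k) \<Longrightarrow> strict_incr n z = strict_incr n z'"
  unfolding strict_incr_def by auto

lemma strict_incr_Suc: "strict_incr (Suc n) z \<longleftrightarrow> strict_incr n z \<and> (\<forall>k<n. z k < z n)"
  unfolding strict_incr_def by (auto simp: less_Suc_eq)

lemma vdm_pos: "strict_incr n z \<Longrightarrow> 0 < vdm n z"
  unfolding vdm_def strict_incr_def by (intro prod_pos) auto

lemma measurable_vdm:
  assumes "\<And>k. k < n \<Longrightarrow> (\<lambda>w. r w k) \<in> borel_measurable M"
  shows "(\<lambda>w. vdm n (r w)) \<in> borel_measurable M"
  unfolding vdm_def using assms by (intro borel_measurable_prod borel_measurable_diff) auto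

section \<open>From coefficients to ordered roots\<close>

text \<open>
  Vary only the last coefficient of a polynomial, and parametrise it by the root \<open>t\<close> that it produces. The
  polynomial is then \<open>x - t\<close> times a quotient with coefficients \<open>deflate t c\<close>, and the derivative of the
  coefficient with respect to \<open>t\<close> is minus the quotient at \<open>t\<close>. On the set \<open>E\<close>, where \<open>t\<close> exceeds
  the roots of the quotient, this parametrisation is injective, because \<open>t\<close> is recovered as the largest root.
\<close>
lemma horner_slice:
  fixes c :: "nat \<Rightarrow> real" and n :: nat
  assumes g_def: "g = (\<lambda>t. - t * hp n c t)"
    and E_def: "E = {t. simple_rooted n (deflate t c) \<and> (\<forall>k<n. roots n (deflate t c) k < t)}"
  shows "hp (Suc n) (c(n := g t)) x = (x - t) * hp n (deflate t c) x"
    and "(g has_real_derivative - hp n (deflate t c) t) (at t)"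
    and "t \<in> E \<Longrightarrow> simple_rooted (Suc n) (c(n := g t))"
    and "t \<in> E \<Longrightarrow> k < Suc n \<Longrightarrow> roots (Suc n) (c(n := g t)) k = ((roots n (deflate t c))(n := t)) k"
    and "inj_on g E"
    and "g ` E = {y. simple_rooted (Suc n) (c(n := y))}"
    and "E \<in> sets borel"
    and "g ` E \<in> sets borel"
proof -
  have hpn: "hp n (c(n := y)) x = hp n c x" for x y
    by (rule hp_cong) simp
  have defl: "hp n (deflate t (c(n := y))) x = hp n (deflate t c) x" for x y t
    by (rule hp_cong, rule deflate_cong) simp
  have zero: "hp (Suc n) (c(n := g t)) t = 0" for t
    by (simp add: hpn g_def)
  show fact: "hp (Suc n) (c(n := g t)) x = (x - t) * hp n (deflate t c) x" for t x
    using hp_deflate[of n "c(n := g t)" x t] zero defl by simp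
  have diff: "g x - g t = (- hp n (deflate t c) x) * (x - t)" for t x
    using fact[of t x] by (simp add: hpn g_def algebra_simps)
  show "(g has_real_derivative - hp n (deflate t c) t) (at t)" for t
    unfolding CARAT_DERIV
    using diff by (intro exI[of _ "\<lambda>x. - hp n (deflate t c) x"] conjI allI continuous_intros isCont_hp) simp_all
  have mem: "strict_incr (Suc n) ((roots n (deflate t c))(n := t))"
    "hp (Suc n) (c(n := g t)) x = (\<Prod>k<Suc n. x - ((roots n (deflate t c))(n := t)) k)" if "t \<in> E" for t x
  proof -
    have sr: "simple_rooted n (deflate t c)" and lt: "\<forall>k<n. roots n (deflate t c) k < t"
      using that by (auto simp: E_def)
    have "strict_incr n ((roots n (deflate t c))(n := t)) = strict_incr n (roots n (deflate t c))"
      by (rule strict_incr_cong) simp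
    then show "strict_incr (Suc n) ((roots n (deflate t c))(n := t))"
      using simple_rootedD(1)[OF sr] lt by (simp add: strict_incr_Suc)
    have "(\<Prod>k<n. x - ((roots n (deflate t c))(n := t)) k) = (\<Prod>k<n. x - roots n (deflate t c) k)"
      by (intro prod.cong) auto
    then show "hp (Suc n) (c(n := g t)) x = (\<Prod>k<Suc n. x - ((roots n (deflate t c))(n := t)) k)"
      unfolding fact simple_rootedD(2)[OF sr, of x] by (simp add: mult.commute)
  qed
  show sr: "simple_rooted (Suc n) (c(n := g t))" if "t \<in> E" for t
    by (rule simple_rootedI(1)[OF mem[OF that]])
  show rt: "roots (Suc n) (c(n := g t)) k = ((roots n (deflate t c))(n := t)) k" if "t \<in> E" "k < Suc n" for t k
    by (rule simple_rootedI(2)[OF mem[OF that(1)] that(2)])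
  show "inj_on g E"
  proof (rule inj_onI)
    fix s t assume st: "s \<in> E" "t \<in> E" "g s = g t"
    have r: "roots (Suc n) (c(n := g t)) n = t" if "t \<in> E" for t
      using rt[OF that lessI] unfolding fun_upd_same .
    show "s = t" using r[OF st(1)] unfolding st(3) r[OF st(2)] by (rule sym)
  qed
  show im: "g ` E = {y. simple_rooted (Suc n) (c(n := y))}"
  proof (intro equalityI subsetI)
    fix y assume "y \<in> {y. simple_rooted (Suc n) (c(n := y))}"
    then have y: "simple_rooted (Suc n) (c(n := y))" by simp
    let ?r = "roots (Suc n) (c(n := y))" let ?t = "?r n"
    note D = simple_rootedD[OF y]
    have "hp (Suc n) (c(n := y)) ?t = 0"
      unfolding D(2) by (simp del: roots.simps)
    then have gy: "g ?t = y" by (simp add: hpn g_def del: roots.simps)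
    have q: "hp n (deflate ?t c) x = (\<Prod>k<n. x - ?r k)" for x
      using hp_deflate_root[of n "c(n := y)" ?r x] D(2) defl by (simp del: roots.simps)
    have inc: "strict_incr n ?r" "\<forall>k<n. ?r k < ?t" using D(1) unfolding strict_incr_Suc by blast+
    have "?t \<in> E"
      unfolding E_def using simple_rootedI[OF inc(1) q] inc(2) by (simp del: roots.simps)
    then have "g ?t \<in> g ` E" by (rule imageI)
    then show "y \<in> g ` E" by (simp only: gy)
  qed (use sr in blast)
  have m: "(\<lambda>t. deflate t c k) \<in> borel_measurable borel" for k
    unfolding deflate_def by (intro measurable_hp) auto
  have [measurable]: "Measurable.pred borel (\<lambda>t. simple_rooted n (deflate t c))"
    by (rule measurable_simple_rooted) (rule m)
  have 2: "Measurable.pred borel (\<lambda>t. k < n \<longrightarrow> roots n (deflate t c) k < t)" for k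
  proof (cases "k < n")
    case True
    have [measurable]: "(\<lambda>t. roots n (deflate t c) k) \<in> borel_measurable borel"
      by (rule measurable_roots[OF m True])
    show ?thesis using True by simp
  qed simp
  show "E \<in> sets borel" unfolding E_def using 2 by measurable
  have "Measurable.pred borel (\<lambda>y. simple_rooted (Suc n) (c(n := y)))"
  proof (rule measurable_simple_rooted)
    fix k show "(\<lambda>y. (c(n := y)) k) \<in> borel_measurable borel" by (cases "k = n") auto
  qed
  then show "g ` E \<in> sets borel" unfolding im by simp
qed

lemma measurable_pred_less_all:
  fixes r :: "'w \<Rightarrow> nat \<Rightarrow> real" and t :: "'w \<Rightarrow> real"
  assumes "\<And>k. k < n \<Longrightarrow> (\<lambda>w. r w k) \<in> borel_measurable M" "t \<in> borel_measurable M"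
  shows "Measurable.pred M (\<lambda>w. \<forall>k<n. r w k < t w)"
proof -
  have "Measurable.pred M (\<lambda>w. k < n \<longrightarrow> r w k < t w)" for k
  proof (cases "k < n")
    case True
    note assms(1)[OF True, measurable] assms(2)[measurable]
    show ?thesis using True by simp
  qed simp
  then show ?thesis by (rule pred_intros_countable)
qed

lemma roots_cong:
  assumes "\<And>k. k < n \<Longrightarrow> d k = d' k"
  shows "roots n d = roots n d'"
  using assms
proof (induction n arbitrary: d d')
  case (Suc n)
  have hpeq: "hp (Suc n) d x = hp (Suc n) d' x" for x by (rule hp_cong) (rule Suc.prems)
  have t: "top_root (Suc n) d = top_root (Suc n) d'" unfolding top_root_def hpeq by (rule refl)
  have "roots n (deflate (top_root (Suc n) d') d) = roots n (deflate (top_root (Suc n) d') d')"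
    by (rule Suc.IH) (auto intro!: deflate_cong Suc.prems)
  then show ?case using t by simp
qed simp

text \<open>
  Polynomials without \<open>n\<close> different real roots are given the value 0.
\<close>
definition at_roots :: "nat \<Rightarrow> ((nat \<Rightarrow> real) \<Rightarrow> ennreal) \<Rightarrow> (nat \<Rightarrow> real) \<Rightarrow> ennreal" where
  "at_roots n G c = (if simple_rooted n c then G (roots n c) else 0)"

text \<open>
  The integrand \<open>G\<close> against the Vandermonde weight on the chamber of strictly increasing vectors.
\<close>
definition vdm_weighted :: "nat \<Rightarrow> ((nat \<Rightarrow> real) \<Rightarrow> ennreal) \<Rightarrow> (nat \<Rightarrow> real) \<Rightarrow> ennreal" where
  "vdm_weighted n G z = (if strict_incr n z then ennreal (vdm n z) * G z else 0)"

text \<open>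
  The factor of \<open>vdm\<close> that belongs to the largest entry \<open>t\<close>, times \<open>G\<close>, as a function of the other entries.
\<close>
definition top_slice :: "nat \<Rightarrow> ((nat \<Rightarrow> real) \<Rightarrow> ennreal) \<Rightarrow> real \<Rightarrow> (nat \<Rightarrow> real) \<Rightarrow> ennreal" where
  "top_slice n G t z = (if \<forall>k<n. z k < t then ennreal (\<Prod>k<n. t - z k) * G (z(n := t)) else 0)"

lemma measurable_at_roots:
  assumes "G \<in> borel_measurable (lborel_on {..<n})" "\<And>k. k < n \<Longrightarrow> (\<lambda>w. c w k) \<in> borel_measurable M"
  shows "(\<lambda>w. at_roots n G (c w)) \<in> borel_measurable M"
proof -
  have [measurable]: "(\<lambda>w. G (roots n (c w))) \<in> borel_measurable M"
    by (rule measurable_compose[OF measurable_roots_PiM assms(1)]) (rule assms(2))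
  have [measurable]: "Measurable.pred M (\<lambda>w. simple_rooted n (c w))"
    by (rule measurable_simple_rooted) (rule assms(2))
  show ?thesis unfolding at_roots_def by measurable
qed

lemma measurable_vdm_weighted:
  assumes [measurable]: "G \<in> borel_measurable (lborel_on {..<n})"
  shows "vdm_weighted n G \<in> borel_measurable (lborel_on {..<n})"
proof -
  have [measurable]: "vdm n \<in> borel_measurable (lborel_on {..<n})"
    by (rule measurable_vdm) (rule measurable_component_lborel)
  have [measurable]: "Measurable.pred (lborel_on {..<n}) (strict_incr n)"
    by (rule measurable_strict_incr) (rule measurable_component_lborel)
  show ?thesis unfolding vdm_weighted_def by measurable
qed

lemma measurable_top_slice:
  assumes "G \<in> borel_measurable (lborel_on {..<Suc n})"
    and t[measurable]: "t \<in> borel_measurable M" and z[measurable]: "z \<in> measurable M (lborel_on {..<n})"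
  shows "(\<lambda>w. top_slice n G (t w) (z w)) \<in> borel_measurable M"
proof -
  have zk[measurable]: "(\<lambda>w. z w k) \<in> borel_measurable M" if "k < n" for k
    by (rule measurable_compose[OF z measurable_component_lborel[OF that]])
  have [measurable]: "(\<lambda>w. G ((z w)(n := t w))) \<in> borel_measurable M"
    by (rule measurable_compose[OF measurable_upd_Suc[OF z t] assms(1)])
  have [measurable]: "Measurable.pred M (\<lambda>w. \<forall>k<n. z w k < t w)"
    by (rule measurable_pred_less_all[OF zk t])
  have [measurable]: "(\<lambda>w. \<Prod>k<n. t w - z w k) \<in> borel_measurable M"
    by (intro borel_measurable_prod borel_measurable_diff t zk) simp
  show ?thesis unfolding top_slice_def by measurable
qed

lemma at_roots_cong: "(\<And>k. k < n \<Longrightarrow> d k = d' k) \<Longrightarrow> at_roots n G d = at_roots n G d'"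
proof -
  assume eq: "\<And>k. k < n \<Longrightarrow> d k = d' k"
  have r: "roots n d = roots n d'" by (rule roots_cong) (rule eq)
  have h: "hp n d x = hp n d' x" for x by (rule hp_cong) (rule eq)
  show ?thesis unfolding at_roots_def simple_rooted_def r h by (rule refl)
qed

lemma nn_integral_at_roots_slice:
  assumes G: "G \<in> borel_measurable (lborel_on {..<Suc n})" and c: "c \<in> space (lborel_on {..<n})"
  shows "(\<integral>\<^sup>+y. at_roots (Suc n) G (c(n := y)) \<partial>lborel)
    = (\<integral>\<^sup>+t. at_roots n (top_slice n G t) (deflate t c) \<partial>lborel)"
proof -
  define g where "g = (\<lambda>t. - t * hp n c t)"
  define E where "E = {t. simple_rooted n (deflate t c) \<and> (\<forall>k<n. roots n (deflate t c) k < t)}"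
  note H = horner_slice[OF g_def E_def]
  have uc: "(\<lambda>y. at_roots (Suc n) G (c(n := y))) \<in> borel_measurable borel"
  proof (rule measurable_at_roots[OF G])
    fix k show "(\<lambda>y. (c(n := y)) k) \<in> borel_measurable borel" by (cases "k = n") auto
  qed
  have m1: "(\<lambda>t. - hp n (deflate t c) t) \<in> borel_measurable borel"
    unfolding deflate_def by (intro borel_measurable_uminus measurable_hp) auto
  have m2: "g \<in> borel_measurable borel"
    unfolding g_def by (intro borel_measurable_times borel_measurable_uminus measurable_hp) auto
  have ind: "indicator (g ` E) y * at_roots (Suc n) G (c(n := y)) = at_roots (Suc n) G (c(n := y))" for y
    unfolding H(6) at_roots_def by (cases "simple_rooted (Suc n) (c(n := y))") simp_all
  have pt: "(ennreal \<bar>- hp n (deflate t c) t\<bar> * indicator E t) * at_roots (Suc n) G (c(n := g t))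
    = at_roots n (top_slice n G t) (deflate t c)" for t
  proof (cases "t \<in> E")
    case True
    then have sr: "simple_rooted n (deflate t c)" and lt: "\<forall>k<n. roots n (deflate t c) k < t"
      unfolding E_def by blast+
    have 0: "0 \<le> (\<Prod>k<n. t - roots n (deflate t c) k)"
      by (rule prod_nonneg) (use lt in \<open>auto intro: less_imp_le\<close>)
    have 1: "\<bar>- hp n (deflate t c) t\<bar> = (\<Prod>k<n. t - roots n (deflate t c) k)"
      unfolding simple_rootedD(2)[OF sr, of t] using 0 by simp
    have 2: "roots (Suc n) (c(n := g t)) = (roots n (deflate t c))(n := t)"
    proof
      fix k
      show "roots (Suc n) (c(n := g t)) k = ((roots n (deflate t c))(n := t)) k"
      proof (cases "k < Suc n")
        case k: True
        show ?thesis by (rule H(4)[OF True k])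
      next
        case False
        then show ?thesis
          using roots_extensional[of "Suc n" "c(n := g t)"] roots_extensional[of n "deflate t c"]
          by (simp add: extensional_def del: roots.simps)
      qed
    qed
    have i: "(indicator E t :: ennreal) = 1" by (rule indicator_simps(1)[OF True])
    show ?thesis
      unfolding at_roots_def if_P[OF sr] if_P[OF H(3)[OF True]] top_slice_def if_P[OF lt] 1 2 i
      by (simp only: mult_1_right)
  next
    case False
    have i: "(indicator E t :: ennreal) = 0" by (rule indicator_simps(2)[OF False])
    have "at_roots n (top_slice n G t) (deflate t c) = 0"
    proof (cases "simple_rooted n (deflate t c)")
      case sr: True
      have "\<not> (\<forall>k<n. roots n (deflate t c) k < t)" using False sr unfolding E_def by blast
      then show ?thesis unfolding at_roots_def top_slice_def if_P[OF sr] by (rule if_not_P)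
    qed (simp add: at_roots_def)
    then show ?thesis unfolding i by simp
  qed
  have "(\<integral>\<^sup>+y. at_roots (Suc n) G (c(n := y)) \<partial>lborel)
      = (\<integral>\<^sup>+y. indicator (g ` E) y * at_roots (Suc n) G (c(n := y)) \<partial>lborel)"
    unfolding ind by (rule refl)
  also have "\<dots> = (\<integral>\<^sup>+t. (ennreal \<bar>- hp n (deflate t c) t\<bar> * indicator E t)
      * at_roots (Suc n) G (c(n := g t)) \<partial>lborel)"
    by (rule nn_integral_change_of_variable[OF H(7) H(8) m1 m2 uc H(2) H(5)])
  also have "\<dots> = (\<integral>\<^sup>+t. at_roots n (top_slice n G t) (deflate t c) \<partial>lborel)"
    unfolding pt by (rule refl)
  finally show ?thesis .
qed

lemma vdm_weighted_top_slice:
  "vdm_weighted n (top_slice n G t) z = vdm_weighted (Suc n) G (z(n := t))"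
proof -
  have 1: "strict_incr n (z(n := t)) = strict_incr n z" by (rule strict_incr_cong) simp
  have 2: "vdm n (z(n := t)) = vdm n z" by (rule vdm_cong) simp
  have 3: "(\<Prod>i<n. (z(n := t)) n - (z(n := t)) i) = (\<Prod>i<n. t - z i)" by (intro prod.cong) auto
  show ?thesis
  proof (cases "strict_incr n z \<and> (\<forall>k<n. z k < t)")
    case True
    then have zz: "strict_incr n z" "\<forall>k<n. z k < t" by blast+
    have "0 \<le> (\<Prod>i<n. t - z i)" by (rule prod_nonneg) (use zz(2) in \<open>auto intro: less_imp_le\<close>)
    then have 4: "ennreal (vdm n z * (\<Prod>i<n. t - z i)) = ennreal (vdm n z) * ennreal (\<Prod>i<n. t - z i)"
      using vdm_pos[OF zz(1)] by (simp add: ennreal_mult)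
    have 5: "strict_incr (Suc n) (z(n := t))" using zz 1 by (simp add: strict_incr_Suc)
    show ?thesis
      unfolding vdm_weighted_def top_slice_def if_P[OF zz(1)] if_P[OF zz(2)] if_P[OF 5] vdm_Suc 2 3 4
      by (rule mult.assoc[symmetric])
  next
    case False
    have 5: "\<not> strict_incr (Suc n) (z(n := t))" using False 1 by (simp add: strict_incr_Suc)
    show ?thesis
    proof (cases "strict_incr n z")
      case True
      then have "\<not> (\<forall>k<n. z k < t)" using False by blast
      then have 6: "top_slice n G t z = 0" unfolding top_slice_def by (rule if_not_P)
      show ?thesis unfolding vdm_weighted_def if_not_P[OF 5] 6 by simp
    qed (simp add: vdm_weighted_def if_not_P[OF 5])
  qed
qed

text \<open>
  The Jacobian of the map from ordered roots to coefficients is the Vandermonde product. By induction: the last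
  coefficient is replaced by the largest root \<open>t\<close>, with the Jacobian \<open>\<Prod>k<n. t - z k\<close> from
  \<open>horner_slice\<close>; for fixed \<open>t\<close> the remaining coefficients are replaced by those of the quotient, at no cost
  (\<open>nn_integral_deflate\<close>), and the induction hypothesis applies to the quotient.
\<close>
theorem nn_integral_at_roots:
  assumes "G \<in> borel_measurable (lborel_on {..<n})"
  shows "(\<integral>\<^sup>+c. at_roots n G c \<partial>lborel_on {..<n}) = (\<integral>\<^sup>+z. vdm_weighted n G z \<partial>lborel_on {..<n})"
  using assms
proof (induction n arbitrary: G)
  case 0
  have "roots 0 c = (\<lambda>_. undefined)" for c by simp
  then show ?case
    by (simp add: lborel_prod.nn_integral_empty at_roots_def vdm_weighted_def simple_rooted_def
        strict_incr_def vdm_def del: nn_integral_const)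
next
  case (Suc n)
  note G = Suc.prems
  have m_slice: "top_slice n G t \<in> borel_measurable (lborel_on {..<n})" for t
    by (rule measurable_top_slice[OF G, of "\<lambda>_. t" _ "\<lambda>z. z"]) simp_all
  have m_at: "at_roots (Suc n) G \<in> borel_measurable (lborel_on {..<Suc n})"
    by (rule measurable_at_roots[OF G]) (rule measurable_component_lborel)
  have m_at': "at_roots n (top_slice n G t) \<in> borel_measurable (lborel_on {..<n})" for t
    by (rule measurable_at_roots[OF m_slice]) (rule measurable_component_lborel)
  have m_pair: "(\<lambda>(c, t). at_roots n (top_slice n G t) (deflate t c))
      \<in> borel_measurable (lborel_on {..<n} \<Otimes>\<^sub>M lborel)"
  proof -
    have d: "(\<lambda>p. deflate (snd p) (fst p) k) \<in> borel_measurable (lborel_on {..<n} \<Otimes>\<^sub>M lborel)" if "k < n" for k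
      unfolding deflate_def using that
      by (intro measurable_hp measurable_compose[OF measurable_fst measurable_component_lborel]) auto
    have [measurable]: "Measurable.pred (lborel_on {..<n} \<Otimes>\<^sub>M lborel) (\<lambda>p. simple_rooted n (deflate (snd p) (fst p)))"
      by (rule measurable_simple_rooted) (rule d)
    have [measurable]: "(\<lambda>p. top_slice n G (snd p) (roots n (deflate (snd p) (fst p))))
        \<in> borel_measurable (lborel_on {..<n} \<Otimes>\<^sub>M lborel)"
      by (rule measurable_top_slice[OF G _ measurable_roots_PiM[OF d]]) simp_all
    show ?thesis unfolding at_roots_def case_prod_beta' by measurable
  qed
  have "(\<integral>\<^sup>+c. at_roots (Suc n) G c \<partial>lborel_on {..<Suc n})
      = (\<integral>\<^sup>+c. \<integral>\<^sup>+y. at_roots (Suc n) G (c(n := y)) \<partial>lborel \<partial>lborel_on {..<n})"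
    by (rule nn_integral_lborel_Suc(1)[OF m_at])
  also have "\<dots> = (\<integral>\<^sup>+c. \<integral>\<^sup>+t. at_roots n (top_slice n G t) (deflate t c) \<partial>lborel \<partial>lborel_on {..<n})"
    by (rule nn_integral_cong) (rule nn_integral_at_roots_slice[OF G])
  also have "\<dots> = (\<integral>\<^sup>+t. \<integral>\<^sup>+c. at_roots n (top_slice n G t) (deflate t c) \<partial>lborel_on {..<n} \<partial>lborel)"
    by (rule Fubini_lborel_on[OF _ m_pair]) simp
  also have "\<dots> = (\<integral>\<^sup>+t. \<integral>\<^sup>+d. at_roots n (top_slice n G t) d \<partial>lborel_on {..<n} \<partial>lborel)"
  proof (rule nn_integral_cong)
    fix t :: real
    have "at_roots n (top_slice n G t) (restrict (deflate t c) {..<n})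
      = at_roots n (top_slice n G t) (deflate t c)" for c
      by (rule at_roots_cong) simp
    then show "(\<integral>\<^sup>+c. at_roots n (top_slice n G t) (deflate t c) \<partial>lborel_on {..<n})
      = (\<integral>\<^sup>+d. at_roots n (top_slice n G t) d \<partial>lborel_on {..<n})"
      using nn_integral_deflate[OF m_at', of t t] by simp
  qed
  also have "\<dots> = (\<integral>\<^sup>+t. \<integral>\<^sup>+z. vdm_weighted n (top_slice n G t) z \<partial>lborel_on {..<n} \<partial>lborel)"
    by (rule nn_integral_cong) (rule Suc.IH[OF m_slice])
  also have "\<dots> = (\<integral>\<^sup>+t. \<integral>\<^sup>+z. vdm_weighted (Suc n) G (z(n := t)) \<partial>lborel_on {..<n} \<partial>lborel)"
    unfolding vdm_weighted_top_slice by (rule refl)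
  also have "\<dots> = (\<integral>\<^sup>+z. vdm_weighted (Suc n) G z \<partial>lborel_on {..<Suc n})"
    by (rule nn_integral_lborel_Suc(2)[OF measurable_vdm_weighted[OF G], symmetric])
  finally show ?case .
qed

section \<open>Arrow polynomials and interlacing\<close>

text \<open>
  The polynomial of degree below \<open>n\<close> with the coefficients \<open>q 0, \<dots>, q (n - 1)\<close>, leading one first.
\<close>
primrec qp :: "nat \<Rightarrow> (nat \<Rightarrow> real) \<Rightarrow> real \<Rightarrow> real" where
  "qp 0 q x = 0"
| "qp (Suc n) q x = x * qp n q x + q n"

text \<open>
  The coefficients of \<open>x - t\<close> times the monic polynomial given by \<open>b\<close>, plus the polynomial given by \<open>q\<close>.
\<close>
definition mulc :: "nat \<Rightarrow> real \<Rightarrow> (nat \<Rightarrow> real) \<Rightarrow> (nat \<Rightarrow> real) \<Rightarrow> nat \<Rightarrow> real" where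
  "mulc n t b q k = (if k < n then b k else 0) - t * (case k of 0 \<Rightarrow> 1 | Suc j \<Rightarrow> b j) + q k"

lemma hp_mulc: "hp (Suc n) (mulc n t b q) x = (x - t) * hp n b x + qp (Suc n) q x"
proof -
  have *: "hp (Suc m) (mulc n t b q) x = hp (Suc m) b x - t * hp m b x + qp (Suc m) q x" if "m < n" for m
    using that
  proof (induction m)
    case (Suc m)
    have M: "mulc n t b q (Suc m) = b (Suc m) - t * b m + q (Suc m)"
      using Suc.prems by (simp add: mulc_def)
    have IH: "hp (Suc m) (mulc n t b q) x = hp (Suc m) b x - t * hp m b x + qp (Suc m) q x"
      using Suc by simp
    show ?case
      unfolding hp.simps(2)[of "Suc m"] qp.simps(2)[of "Suc m"] IH M
      by (simp add: algebra_simps)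
  qed (simp add: mulc_def)
  show ?thesis
  proof (cases n)
    case (Suc m)
    have "hp (Suc n) (mulc n t b q) x = x * hp n (mulc n t b q) x + mulc n t b q n" by simp
    also have "hp n (mulc n t b q) x = hp n b x - t * hp m b x + qp n q x"
      using *[of m] Suc by simp
    also have "mulc n t b q n = q n - t * b m" by (simp add: mulc_def Suc)
    finally show ?thesis by (simp add: Suc algebra_simps)
  qed (simp add: mulc_def)
qed

lemma mulc_cong: "(\<And>k. k < n \<Longrightarrow> b k = b' k) \<Longrightarrow> k \<le> n \<Longrightarrow> mulc n t b q k = mulc n t b' q k"
  unfolding mulc_def by (cases k) simp_all

lemma measurable_mulc:
  assumes "\<And>k. k < n \<Longrightarrow> (\<lambda>w. b w k) \<in> borel_measurable M" "(\<lambda>w. q w k) \<in> borel_measurable M" "k \<le> n"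
    and [measurable]: "t \<in> borel_measurable M"
  shows "(\<lambda>w. mulc n (t w) (b w) (q w) k) \<in> borel_measurable M"
proof -
  have [measurable]: "(\<lambda>w. q w k) \<in> borel_measurable M" by fact
  have [measurable]: "(\<lambda>w. if k < n then b w k else 0) \<in> borel_measurable M"
    using assms(1)[of k] by (cases "k < n") simp_all
  have [measurable]: "(\<lambda>w. case k of 0 \<Rightarrow> 1 | Suc j \<Rightarrow> b w j) \<in> borel_measurable M"
    using assms(1)[of "k - 1"] assms(3) by (cases k) simp_all
  show ?thesis unfolding mulc_def by measurable
qed

primrec prod_coeffs :: "nat \<Rightarrow> (nat \<Rightarrow> real) \<Rightarrow> nat \<Rightarrow> real" where
  "prod_coeffs 0 mu = (\<lambda>_. 0)"
| "prod_coeffs (Suc n) mu = mulc n (mu n) (prod_coeffs n mu) (\<lambda>_. 0)"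

lemma qp_zero: "qp n (\<lambda>_. 0) x = 0"
  by (induction n) simp_all

lemma hp_prod_coeffs: "hp n (prod_coeffs n mu) x = (\<Prod>k<n. x - mu k)"
proof (induction n)
  case (Suc n)
  show ?case unfolding prod_coeffs.simps hp_mulc Suc qp_zero by simp
qed simp

lemma measurable_prod_coeffs:
  assumes "\<And>k. k < n \<Longrightarrow> (\<lambda>w. mu w k) \<in> borel_measurable M" "k < n"
  shows "(\<lambda>w. prod_coeffs n (mu w) k) \<in> borel_measurable M"
  using assms
proof (induction n arbitrary: k)
  case (Suc n)
  show ?case unfolding prod_coeffs.simps
    by (rule measurable_mulc) (use Suc in simp_all)
qed simp

text \<open>
  The polynomial \<open>- s * (\<Prod>k<n. x - mu k)\<close>, padded with a leading zero to be
  added to a monic polynomial of degree \<open>n + 2\<close>.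
\<close>
definition pole_coeffs :: "nat \<Rightarrow> (nat \<Rightarrow> real) \<Rightarrow> real \<Rightarrow> nat \<Rightarrow> real" where
  "pole_coeffs n mu s k = (case k of 0 \<Rightarrow> 0 | Suc 0 \<Rightarrow> - s | Suc (Suc j) \<Rightarrow> - (s * prod_coeffs n mu j))"

lemma qp_pole_coeffs: "qp (Suc (Suc n)) (pole_coeffs n mu s) x = - (s * (\<Prod>k<n. x - mu k))"
proof -
  have "qp (Suc (Suc m)) (pole_coeffs n mu s) x = - (s * hp m (prod_coeffs n mu) x)" for m
    by (induction m) (simp_all add: pole_coeffs_def algebra_simps)
  from this[of n] show ?thesis unfolding hp_prod_coeffs .
qed

text \<open>
  Built by adding one pole after the other, so that the step from \<open>n\<close> to \<open>n + 1\<close> poles is multiplication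
  by \<open>x - mu n\<close> plus a multiple of \<open>\<Prod>k<n. x - mu k\<close>. The Jacobian is computed along this recursion.
\<close>
primrec arrow_coeffs :: "nat \<Rightarrow> (nat \<Rightarrow> real) \<Rightarrow> real \<Rightarrow> (nat \<Rightarrow> real) \<Rightarrow> nat \<Rightarrow> real" where
  "arrow_coeffs 0 mu a r = (\<lambda>_. - a)"
| "arrow_coeffs (Suc n) mu a r = mulc (Suc n) (mu n) (arrow_coeffs n mu a r) (pole_coeffs n mu (r n))"

text \<open>
  The characteristic polynomial of the matrix with the diagonal \<open>mu, a\<close> and a last column whose entries have squared
  moduli \<open>r\<close>, all other off-diagonal entries being 0.
\<close>
definition arrow_poly :: "nat \<Rightarrow> (nat \<Rightarrow> real) \<Rightarrow> real \<Rightarrow> (nat \<Rightarrow> real) \<Rightarrow> real \<Rightarrow> real" where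
  "arrow_poly n mu a r x = (x - a) * (\<Prod>j<n. x - mu j) - (\<Sum>j<n. r j * (\<Prod>k\<in>{..<n} - {j}. x - mu k))"

lemma hp_arrow_coeffs: "hp (Suc n) (arrow_coeffs n mu a r) x = arrow_poly n mu a r x"
proof (induction n)
  case 0
  show ?case by (simp add: arrow_poly_def)
next
  case (Suc n)
  have 1: "{..<Suc n} - {j} = insert n ({..<n} - {j})" if "j < n" for j using that by auto
  have 2: "{..<Suc n} - {n} = {..<n}" by auto
  have 3: "(\<Sum>j<n. r j * (\<Prod>k\<in>{..<Suc n} - {j}. x - mu k))
    = (\<Sum>j<n. (x - mu n) * (r j * (\<Prod>k\<in>{..<n} - {j}. x - mu k)))"
    by (intro sum.cong refl) (simp add: 1)
  have "arrow_poly (Suc n) mu a r x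
      = (x - a) * ((\<Prod>j<n. x - mu j) * (x - mu n)) - ((\<Sum>j<n. r j * (\<Prod>k\<in>{..<Suc n} - {j}. x - mu k))
        + r n * (\<Prod>k<n. x - mu k))"
    by (simp add: arrow_poly_def 2)
  also have "\<dots> = (x - mu n) * arrow_poly n mu a r x - r n * (\<Prod>k<n. x - mu k)"
    unfolding 3 arrow_poly_def sum_distrib_left[symmetric] by (simp add: algebra_simps)
  also have "\<dots> = hp (Suc (Suc n)) (arrow_coeffs (Suc n) mu a r) x"
    unfolding arrow_coeffs.simps hp_mulc qp_pole_coeffs Suc by simp
  finally show ?case by simp
qed

lemma arrow_coeffs_cong: "(\<And>j. j < n \<Longrightarrow> r j = r' j) \<Longrightarrow> arrow_coeffs n mu a r = arrow_coeffs n mu a r'"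
  by (induction n) simp_all

lemma measurable_arrow_coeffs:
  assumes "a \<in> borel_measurable M" "\<And>j. j < n \<Longrightarrow> (\<lambda>w. r w j) \<in> borel_measurable M" "k \<le> n"
    and "\<And>j. j < n \<Longrightarrow> (\<lambda>w. mu w j) \<in> borel_measurable M"
  shows "(\<lambda>w. arrow_coeffs n (mu w) (a w) (r w) k) \<in> borel_measurable M"
  using assms(2-4)
proof (induction n arbitrary: k)
  case 0
  then show ?case using assms(1) by simp
next
  case (Suc n)
  have [measurable]: "(\<lambda>w. r w n) \<in> borel_measurable M" using Suc.prems by simp
  have p: "(\<lambda>w. pole_coeffs n (mu w) (r w n) k) \<in> borel_measurable M" if k: "k \<le> Suc n" for k
  proof (cases "k \<le> 1")
    case True
    then show ?thesis by (cases k) (simp_all add: pole_coeffs_def)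
  next
    case False
    then obtain j where j: "k = Suc (Suc j)" by (metis One_nat_def le_SucI le_zero_eq not0_implies_Suc not_less_eq_eq order_refl)
    have [measurable]: "(\<lambda>w. prod_coeffs n (mu w) j) \<in> borel_measurable M"
      by (rule measurable_prod_coeffs) (use Suc.prems(3) j k in simp_all)
    show ?thesis unfolding pole_coeffs_def j by simp
  qed
  show ?case unfolding arrow_coeffs.simps
    by (rule measurable_mulc[where b = "\<lambda>w. arrow_coeffs n (mu w) (a w) (r w)"
          and q = "\<lambda>w. pole_coeffs n (mu w) (r w n)" and t = "\<lambda>w. mu w n"])
       (use Suc p[OF Suc.prems(2)] in simp_all)
qed

lemma arrow_poly_pole:
  assumes j: "j < n"
  shows "arrow_poly n mu a r (mu j) = - (r j * (\<Prod>k\<in>{..<n} - {j}. mu j - mu k))"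
proof -
  have "(\<Prod>k<n. mu j - mu k) = 0" using j by (intro prod_zero) auto
  moreover have "(\<Sum>i<n. r i * (\<Prod>k\<in>{..<n} - {i}. mu j - mu k))
    = (\<Sum>i<n. if i = j then r j * (\<Prod>k\<in>{..<n} - {j}. mu j - mu k) else 0)"
  proof (intro sum.cong refl)
    fix i assume "i \<in> {..<n}"
    show "r i * (\<Prod>k\<in>{..<n} - {i}. mu j - mu k)
      = (if i = j then r j * (\<Prod>k\<in>{..<n} - {j}. mu j - mu k) else 0)"
    proof (cases "i = j")
      case False
      then have "(\<Prod>k\<in>{..<n} - {i}. mu j - mu k) = 0" using j by (intro prod_zero) auto
      then show ?thesis using False by simp
    qed simp
  qed
  ultimately show ?thesis using j by (simp add: arrow_poly_def)
qed

text \<open>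
  The secular equation: away from the \<open>mu j\<close>, the roots are the zeros of a rational function with
  simple poles of residue \<open>- r j\<close>.
\<close>
lemma arrow_poly_off_poles:
  assumes "\<And>j. j < n \<Longrightarrow> x \<noteq> mu j"
  shows "arrow_poly n mu a r x = (\<Prod>j<n. x - mu j) * (x - a - (\<Sum>j<n. r j / (x - mu j)))"
proof -
  have "r j * (\<Prod>k\<in>{..<n} - {j}. x - mu k) = (\<Prod>j<n. x - mu j) * (r j / (x - mu j))" if "j < n" for j
  proof -
    have "(\<Prod>j<n. x - mu j) = (x - mu j) * (\<Prod>k\<in>{..<n} - {j}. x - mu k)"
      using that by (intro prod.remove) auto
    then show ?thesis using assms[OF that] by simp
  qed
  then show ?thesis
    by (simp add: arrow_poly_def sum_distrib_left algebra_simps)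
qed

definition interlaces :: "nat \<Rightarrow> (nat \<Rightarrow> real) \<Rightarrow> (nat \<Rightarrow> real) \<Rightarrow> bool" where
  "interlaces n mu z \<longleftrightarrow> (\<forall>j<n. z j < mu j \<and> mu j < z (Suc j))"

lemma hp_eq_prod:
  assumes "strict_incr n z" "\<And>k. k < n \<Longrightarrow> hp n c (z k) = 0"
  shows "hp n c x = (\<Prod>k<n. x - z k)"
  using assms
proof (induction n arbitrary: c x)
  case (Suc n)
  have d: "hp (Suc n) c x = (x - z n) * hp n (deflate (z n) c) x" for x
    using hp_deflate[of n c x "z n"] Suc.prems(2)[of n] by simp
  have "hp n (deflate (z n) c) x = (\<Prod>k<n. x - z k)"
  proof (rule Suc.IH)
    show "strict_incr n z" using Suc.prems(1) by (simp add: strict_incr_Suc)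
    fix k assume k: "k < n"
    have "z k < z n" using Suc.prems(1) k by (simp add: strict_incr_Suc)
    moreover have "(z k - z n) * hp n (deflate (z n) c) (z k) = 0"
      using d[of "z k"] Suc.prems(2)[of k] k by simp
    ultimately show "hp n (deflate (z n) c) (z k) = 0" by simp
  qed
  then show ?case unfolding d by (simp add: mult.commute)
qed simp

text \<open>
  Pairs the \<open>n + 1\<close> entries of an interlacing vector with the \<open>n - 1\<close> indices other than \<open>j\<close>, leaving out the two neighbours
  of \<open>mu j\<close>.
\<close>
lemma prod_skip:
  assumes j: "j < n"
  shows "(\<Prod>k<Suc n. f k :: real) = f j * f (Suc j) * (\<Prod>k\<in>{..<n} - {j}. f (if k < j then k else Suc k))"
proof -
  let ?s = "\<lambda>k. if k < j then k else Suc k"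
  have "{..<Suc n} = insert j (insert (Suc j) ({..<Suc n} - {j, Suc j}))" using j by auto
  then have "(\<Prod>k<Suc n. f k) = (\<Prod>k\<in>insert j (insert (Suc j) ({..<Suc n} - {j, Suc j})). f k)" by simp
  also have "\<dots> = f j * (f (Suc j) * (\<Prod>k\<in>{..<Suc n} - {j, Suc j}. f k))"
    by simp
  also have "(\<Prod>k\<in>{..<Suc n} - {j, Suc j}. f k) = (\<Prod>k\<in>{..<n} - {j}. f (?s k))"
  proof (rule prod.reindex_bij_betw[symmetric])
    show "bij_betw ?s ({..<n} - {j}) ({..<Suc n} - {j, Suc j})"
      by (rule bij_betwI[where g = "\<lambda>k. if k < j then k else k - 1"]) (use j in \<open>auto split: if_splits\<close>)
  qed
  finally show ?thesis by (simp add: mult.assoc)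
qed

text \<open>
  The value at \<open>mu j\<close> is \<open>- r j * (\<Prod>k\<noteq>j. mu j - mu k)\<close> and also \<open>\<Prod>k. mu j - z k\<close>. By interlacing
  the factors of these products agree in sign pairwise, except for the two with the neighbours of \<open>mu j\<close>, which
  contribute one minus sign.
\<close>
lemma interlaces_imp_pos:
  assumes mu: "strict_incr n mu" and sr: "simple_rooted (Suc n) (arrow_coeffs n mu a r)"
    and il: "interlaces n mu (roots (Suc n) (arrow_coeffs n mu a r))" and j: "j < n"
  shows "0 < r j"
proof -
  define z where "z = roots (Suc n) (arrow_coeffs n mu a r)"
  have z: "strict_incr (Suc n) z" "arrow_poly n mu a r x = (\<Prod>k<Suc n. x - z k)" for x
    using simple_rootedD[OF sr] unfolding z_def hp_arrow_coeffs by blast+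
  have il: "z j < mu j" "mu j < z (Suc j)" using il j unfolding z_def interlaces_def by blast+
  let ?Q = "\<Prod>k\<in>{..<n} - {j}. mu j - mu k"
  let ?s = "\<lambda>k. if k < j then k else Suc k"
  have Q: "?Q \<noteq> 0"
  proof -
    have "mu j - mu k \<noteq> 0" if "k \<in> {..<n} - {j}" for k
    proof (cases "k < j")
      case True
      then have "mu k < mu j" using mu j unfolding strict_incr_def by blast
      then show ?thesis by simp
    next
      case False
      then have "mu j < mu k" using mu that unfolding strict_incr_def by auto
      then show ?thesis by simp
    qed
    then show ?thesis by simp
  qed
  have "(\<Prod>k<Suc n. mu j - z k) * ?Q
    = (mu j - z j) * (mu j - z (Suc j)) * (\<Prod>k\<in>{..<n} - {j}. (mu j - z (?s k)) * (mu j - mu k))"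
    unfolding prod_skip[OF j] prod.distrib by (simp add: mult.assoc)
  moreover have "0 < (\<Prod>k\<in>{..<n} - {j}. (mu j - z (?s k)) * (mu j - mu k))"
  proof (rule prod_pos)
    fix k assume k: "k \<in> {..<n} - {j}"
    show "0 < (mu j - z (?s k)) * (mu j - mu k)"
    proof (cases "k < j")
      case True
      then have "mu k < mu j" using mu j unfolding strict_incr_def by blast
      moreover have "z k < z j" using z(1) True j unfolding strict_incr_def by auto
      ultimately show ?thesis using True il by simp
    next
      case False
      then have "mu j < mu k" using mu k unfolding strict_incr_def by auto
      moreover have "z (Suc j) \<le> z (Suc k)"
        using False k by (intro strict_incr_le[OF z(1)]) auto
      ultimately show ?thesis using False il by (intro mult_neg_neg) auto
    qed
  qed
  ultimately have "(\<Prod>k<Suc n. mu j - z k) * ?Q < 0"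
    using il by (simp add: mult_pos_neg mult_neg_pos)
  then have "- (r j * ?Q) * ?Q < 0"
    unfolding z(2)[symmetric] arrow_poly_pole[OF j] .
  then have "0 < r j * (?Q * ?Q)" by (simp add: mult.assoc)
  moreover have "0 < ?Q * ?Q" using Q by (metis not_real_square_gt_zero)
  ultimately show ?thesis by (simp add: zero_less_mult_iff)
qed

lemma arrow_sign_left:
  assumes mu: "strict_incr n mu" and r: "\<And>j. j < n \<Longrightarrow> 0 < r j" and n: "0 < n"
  shows "\<exists>x<mu 0. arrow_poly n mu a r x * arrow_poly n mu a r (mu 0) < 0"
proof -
  \<comment> \<open>At distance \<open>m\<close> to the left of \<open>mu 0\<close> each \<open>r j / (mu j - x)\<close> is at most \<open>r j\<close>, so
    the linear term \<open>x - a\<close> determines the sign.\<close>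
  define m where "m = 1 + \<bar>mu 0 - a\<bar> + (\<Sum>j<n. r j)"
  define x where "x = mu 0 - m"
  have S: "0 \<le> (\<Sum>j<n. r j)" by (rule sum_nonneg) (use r in \<open>auto intro: less_imp_le\<close>)
  then have m: "1 \<le> m" by (simp add: m_def)
  have le: "mu 0 \<le> mu j" if "j < n" for j using strict_incr_le[OF mu _ that] by simp
  have gap: "1 \<le> mu j - x" if "j < n" for j using le[OF that] m by (simp add: x_def)
  have "(\<Sum>j<n. r j / (mu j - x)) \<le> (\<Sum>j<n. r j)"
  proof (rule sum_mono)
    fix j assume "j \<in> {..<n}"
    then have j: "j < n" by simp
    have "r j / (mu j - x) \<le> r j / 1"
      using gap[OF j] r[OF j] by (intro divide_left_mono) auto
    then show "r j / (mu j - x) \<le> r j" by simp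
  qed
  moreover have "(\<Sum>j<n. r j / (x - mu j)) = - (\<Sum>j<n. r j / (mu j - x))"
    unfolding sum_negf[symmetric] by (intro sum.cong refl) (metis minus_diff_eq minus_divide_right)
  ultimately have G: "x - a - (\<Sum>j<n. r j / (x - mu j)) < 0"
    by (simp add: x_def m_def)
  have ne: "x \<noteq> mu j" if "j < n" for j using gap[OF that] by auto
  have sp: "(\<Prod>j<n. x - mu j) = (x - mu 0) * (\<Prod>k\<in>{..<n} - {0}. x - mu k)"
    using n by (intro prod.remove) auto
  let ?G = "x - a - (\<Sum>j<n. r j / (x - mu j))"
  have off: "arrow_poly n mu a r x = (\<Prod>j<n. x - mu j) * ?G"
    by (rule arrow_poly_off_poles) (rule ne)
  have "arrow_poly n mu a r x * arrow_poly n mu a r (mu 0)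
    = (x - mu 0) * (?G * (- r 0)) * (\<Prod>k\<in>{..<n} - {0}. (x - mu k) * (mu 0 - mu k))"
    unfolding off arrow_poly_pole[OF n] sp prod.distrib
    by (simp add: mult_ac)
  also have "\<dots> < 0"
  proof (intro mult_neg_pos)
    show "x - mu 0 < 0" using m by (simp add: x_def)
    show "0 < ?G * (- r 0)" using G r[OF n] by (intro mult_neg_neg) auto
    show "0 < (\<Prod>k\<in>{..<n} - {0}. (x - mu k) * (mu 0 - mu k))"
    proof (rule prod_pos)
      fix k assume k: "k \<in> {..<n} - {0}"
      then have "mu 0 < mu k" using mu unfolding strict_incr_def by auto
      then show "0 < (x - mu k) * (mu 0 - mu k)" using gap[of k] k by (intro mult_neg_neg) auto
    qed
  qed
  finally show ?thesis using m by (intro exI[of _ x]) (simp add: x_def)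
qed

lemma arrow_sign_right:
  assumes mu: "strict_incr (Suc n) mu" and r: "\<And>j. j < Suc n \<Longrightarrow> 0 < r j"
  shows "\<exists>x>mu n. arrow_poly (Suc n) mu a r (mu n) * arrow_poly (Suc n) mu a r x < 0"
proof -
  define m where "m = 1 + \<bar>mu n - a\<bar> + (\<Sum>j<Suc n. r j)"
  define x where "x = mu n + m"
  have S: "0 \<le> (\<Sum>j<Suc n. r j)" by (rule sum_nonneg) (use r in \<open>auto intro: less_imp_le\<close>)
  then have m: "1 \<le> m" by (simp add: m_def)
  have le: "mu j \<le> mu n" if "j < Suc n" for j using strict_incr_le[OF mu, of j n] that by simp
  have gap: "1 \<le> x - mu j" if "j < Suc n" for j using le[OF that] m by (simp add: x_def)
  have "(\<Sum>j<Suc n. r j / (x - mu j)) \<le> (\<Sum>j<Suc n. r j)"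
  proof (rule sum_mono)
    fix j assume "j \<in> {..<Suc n}"
    then have j: "j < Suc n" by simp
    have "r j / (x - mu j) \<le> r j / 1"
      using gap[OF j] r[OF j] by (intro divide_left_mono) auto
    then show "r j / (x - mu j) \<le> r j" by simp
  qed
  then have G: "0 < x - a - (\<Sum>j<Suc n. r j / (x - mu j))"
    unfolding x_def m_def by linarith
  have ne: "x \<noteq> mu j" if "j < Suc n" for j using gap[OF that] by auto
  have e: "{..<Suc n} - {n} = {..<n}" by auto
  have sp: "(\<Prod>j<Suc n. x - mu j) = (x - mu n) * (\<Prod>k<n. x - mu k)"
    by simp
  let ?G = "x - a - (\<Sum>j<Suc n. r j / (x - mu j))"
  have off: "arrow_poly (Suc n) mu a r x = (\<Prod>j<Suc n. x - mu j) * ?G"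
    by (rule arrow_poly_off_poles) (rule ne)
  have "arrow_poly (Suc n) mu a r (mu n) * arrow_poly (Suc n) mu a r x
    = (- r n) * (?G * (x - mu n)) * (\<Prod>k<n. (x - mu k) * (mu n - mu k))"
    unfolding off arrow_poly_pole[OF lessI] sp prod.distrib e
    by (simp add: mult_ac)
  also have "\<dots> < 0"
  proof (intro mult_neg_pos)
    show "- r n < 0" using r by simp
    show "0 < ?G * (x - mu n)" using G gap[of n] by (intro mult_pos_pos) auto
    show "0 < (\<Prod>k<n. (x - mu k) * (mu n - mu k))"
    proof (rule prod_pos)
      fix k assume k: "k \<in> {..<n}"
      then have "mu k < mu n" using mu unfolding strict_incr_def by auto
      then show "0 < (x - mu k) * (mu n - mu k)" using gap[of k] k by (intro mult_pos_pos) auto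
    qed
  qed
  finally show ?thesis using m by (intro exI[of _ x]) (simp add: x_def)
qed

text \<open>
  Passing from \<open>mu j\<close> to \<open>mu (Suc j)\<close> changes the sign of exactly one factor of \<open>\<Prod>k\<noteq>j. mu j - mu k\<close>.
\<close>
lemma arrow_sign_mid:
  assumes mu: "strict_incr n mu" and r: "\<And>j. j < n \<Longrightarrow> 0 < r j" and j: "Suc j < n"
  shows "arrow_poly n mu a r (mu j) * arrow_poly n mu a r (mu (Suc j)) < 0"
proof -
  have jn: "j < n" using j by simp
  have lt: "mu j < mu (Suc j)" using mu j unfolding strict_incr_def by blast
  let ?R = "{..<n} - {j, Suc j}"
  have s1: "(\<Prod>k\<in>{..<n} - {j}. mu j - mu k) = (mu j - mu (Suc j)) * (\<Prod>k\<in>?R. mu j - mu k)"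
  proof -
    have "{..<n} - {j} - {Suc j} = ?R" by auto
    then show ?thesis using prod.remove[of "{..<n} - {j}" "Suc j" "\<lambda>k. mu j - mu k"] j by simp
  qed
  have s2: "(\<Prod>k\<in>{..<n} - {Suc j}. mu (Suc j) - mu k) = (mu (Suc j) - mu j) * (\<Prod>k\<in>?R. mu (Suc j) - mu k)"
  proof -
    have "{..<n} - {Suc j} - {j} = ?R" by auto
    then show ?thesis using prod.remove[of "{..<n} - {Suc j}" j "\<lambda>k. mu (Suc j) - mu k"] j by simp
  qed
  have "arrow_poly n mu a r (mu j) * arrow_poly n mu a r (mu (Suc j))
    = (mu j - mu (Suc j)) * ((mu (Suc j) - mu j) * (r j * r (Suc j))) * (\<Prod>k\<in>?R. (mu j - mu k) * (mu (Suc j) - mu k))"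
    unfolding arrow_poly_pole[OF jn] arrow_poly_pole[OF j] s1 s2 prod.distrib by (simp add: mult_ac)
  also have "\<dots> < 0"
  proof (intro mult_neg_pos)
    show "mu j - mu (Suc j) < 0" using lt by simp
    show "0 < (mu (Suc j) - mu j) * (r j * r (Suc j))" using lt r[OF jn] r[OF j] by simp
    show "0 < (\<Prod>k\<in>?R. (mu j - mu k) * (mu (Suc j) - mu k))"
    proof (rule prod_pos)
      fix k assume k: "k \<in> ?R"
      show "0 < (mu j - mu k) * (mu (Suc j) - mu k)"
      proof (cases "k < j")
        case True
        then have "mu k < mu j" using mu jn unfolding strict_incr_def by blast
        then show ?thesis using lt by (intro mult_pos_pos) auto
      next
        case False
        then have "mu (Suc j) < mu k" using mu k unfolding strict_incr_def by auto
        then show ?thesis using lt by (intro mult_neg_neg) auto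
      qed
    qed
  qed
  finally show ?thesis .
qed

lemma IVT_sign_change:
  fixes f :: "real \<Rightarrow> real"
  assumes "x < y" "f x * f y < 0" "\<And>t. isCont f t"
  shows "\<exists>t. x < t \<and> t < y \<and> f t = 0"
proof -
  have c: "continuous_on {x..y} f" using assms(3) by (simp add: continuous_at_imp_continuous_on)
  have "\<exists>t\<ge>x. t \<le> y \<and> f t = 0"
  proof (cases "f x < 0")
    case True
    then have "0 < f y" using assms(2) by (simp add: mult_less_0_iff)
    then show ?thesis using IVT'[of f x 0 y] True c assms(1) by auto
  next
    case False
    then have "0 < f x" "f y < 0" using assms(2) by (auto simp: mult_less_0_iff)
    then show ?thesis using IVT2'[of f y 0 x] c assms(1) by auto
  qed
  then obtain t where t: "x \<le> t" "t \<le> y" "f t = 0" by blast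
  moreover have "t \<noteq> x" "t \<noteq> y" using t assms(2) by auto
  ultimately show ?thesis by (intro exI[of _ t]) auto
qed

text \<open>
  The polynomial changes sign between consecutive points \<open>mu j\<close>, and once more to the left and to the right of all of them.
  The \<open>n + 1\<close> zeros found in this way are all the roots.
\<close>
lemma pos_imp_interlaces:
  assumes mu: "strict_incr n mu" and r: "\<And>j. j < n \<Longrightarrow> 0 < r j"
  shows "simple_rooted (Suc n) (arrow_coeffs n mu a r)"
    and "interlaces n mu (roots (Suc n) (arrow_coeffs n mu a r))"
proof -
  let ?P = "arrow_poly n mu a r"
  have cont: "isCont ?P t" for t
  proof -
    have "?P = hp (Suc n) (arrow_coeffs n mu a r)" by (rule ext) (simp only: hp_arrow_coeffs)
    then show ?thesis by (simp only: isCont_hp)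
  qed
  have "\<exists>z. strict_incr (Suc n) z \<and> interlaces n mu z \<and> (\<forall>k<Suc n. ?P (z k) = 0)"
  proof (cases n)
    case 0
    then show ?thesis by (intro exI[of _ "\<lambda>_. a"]) (simp add: strict_incr_def interlaces_def arrow_poly_def)
  next
    case (Suc m)
    obtain xl where xl: "xl < mu 0" "?P xl * ?P (mu 0) < 0"
      using arrow_sign_left[of n mu r a, OF mu r] Suc by auto
    obtain xr where xr: "mu m < xr" "?P (mu m) * ?P xr < 0"
      using arrow_sign_right[of m mu r a] mu r Suc by auto
    \<comment> \<open>The points between which the sign changes: \<open>mu\<close> extended by one point on either side.\<close>
    define y where "y k = (if k = 0 then xl else if k = Suc n then xr else mu (k - 1))" for k
    have y: "y k < y (Suc k) \<and> ?P (y k) * ?P (y (Suc k)) < 0" if k: "k \<le> n" for k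
    proof (cases "k = 0 \<or> k = n")
      case True
      then show ?thesis using xl xr Suc by (auto simp: y_def)
    next
      case False
      then obtain j where j: "k = Suc j" "Suc j < n" using k by (cases k) auto
      have "mu j < mu (Suc j)" using mu j unfolding strict_incr_def by blast
      then show ?thesis using arrow_sign_mid[OF mu r j(2)] j by (simp add: y_def)
    qed
    have "\<forall>k\<in>{..n}. \<exists>t. y k < t \<and> t < y (Suc k) \<and> ?P t = 0"
      using y IVT_sign_change[OF _ _ cont] by auto
    then obtain z where z: "\<And>k. k \<le> n \<Longrightarrow> y k < z k \<and> z k < y (Suc k) \<and> ?P (z k) = 0"
      by (metis atMost_iff)
    have ymu: "y (Suc j) = mu j" if "j < n" for j using that by (simp add: y_def)
    have il: "interlaces n mu z"
      unfolding interlaces_def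
    proof (intro allI impI)
      fix j assume j: "j < n"
      show "z j < mu j \<and> mu j < z (Suc j)"
        using z[of j] z[of "Suc j"] ymu[OF j] j by simp
    qed
    have inc: "z i < z j" if "i < j" "j \<le> n" for i j
      using that
    proof (induction j)
      case (Suc j)
      have "z j < z (Suc j)"
        using il[unfolded interlaces_def, rule_format, of j] Suc.prems by linarith
      then show ?case using Suc by (cases "i = j") auto
    qed simp
    have "strict_incr (Suc n) z" unfolding strict_incr_def using inc by auto
    then show ?thesis using il z by (intro exI[of _ z]) auto
  qed
  then obtain z where z: "strict_incr (Suc n) z" "interlaces n mu z" "\<And>k. k < Suc n \<Longrightarrow> ?P (z k) = 0"
    by blast
  have hp: "hp (Suc n) (arrow_coeffs n mu a r) x = (\<Prod>k<Suc n. x - z k)" for x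
    by (rule hp_eq_prod[OF z(1)]) (simp only: hp_arrow_coeffs z(3))
  show "simple_rooted (Suc n) (arrow_coeffs n mu a r)"
    by (rule simple_rootedI(1)[OF z(1) hp])
  have "roots (Suc n) (arrow_coeffs n mu a r) k = z k" if "k < Suc n" for k
    by (rule simple_rootedI(2)[OF z(1) hp that])
  then show "interlaces n mu (roots (Suc n) (arrow_coeffs n mu a r))"
    using z(2) unfolding interlaces_def by (simp del: roots.simps arrow_coeffs.simps)
qed

section \<open>The Jacobian of the arrow parametrisation\<close>

lemma nn_integral_lborel_on_0: "(\<integral>\<^sup>+c. f c \<partial>lborel_on {..<0::nat}) = f (\<lambda>_. undefined)"
  by (simp add: lborel_prod.nn_integral_empty del: nn_integral_const)

lemma nn_integral_reflect_affine:
  fixes f :: "real \<Rightarrow> ennreal"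
  assumes "f \<in> borel_measurable borel" "0 < m"
  shows "(\<integral>\<^sup>+y. f y \<partial>lborel) = ennreal m * (\<integral>\<^sup>+x. f (t - m * x) \<partial>lborel)"
  using nn_integral_real_affine[OF assms(1), of "- m" t] assms(2) by simp

lemma measurable_restrict_PiM:
  assumes "\<And>k. k < n \<Longrightarrow> (\<lambda>w. c w k) \<in> borel_measurable M"
  shows "(\<lambda>w. restrict (c w) {..<n}) \<in> measurable M (lborel_on {..<n})"
  by (rule measurable_restrict) (use assms in simp)

text \<open>
  The top coefficients of the new polynomial are a unimodular triangular function of \<open>b\<close>, and
  its value at \<open>mu n\<close> is \<open>- s * (\<Prod>k<n. mu n - mu k)\<close>, independently of \<open>b\<close>. So, given the other coefficients, the last
  one is an affine function of \<open>s\<close> whose slope is minus that product.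
\<close>
lemma nn_integral_mulc_step:
  assumes F: "F \<in> borel_measurable (lborel_on {..<Suc (Suc n)})"
    and m: "0 < (\<Prod>k<n. mu n - mu k)"
  shows "(\<integral>\<^sup>+c. F c \<partial>lborel_on {..<Suc (Suc n)}) = ennreal (\<Prod>k<n. mu n - mu k) *
    (\<integral>\<^sup>+s. \<integral>\<^sup>+b. F (restrict (mulc (Suc n) (mu n) b (pole_coeffs n mu s)) {..<Suc (Suc n)})
      \<partial>lborel_on {..<Suc n} \<partial>lborel)"
proof -
  let ?N = "Suc n" and ?t = "mu n"
  define m where "m = (\<Prod>k<n. mu n - mu k)"
  \<comment> \<open>With this last coefficient the polynomial takes the value \<open>- m * s\<close> at \<open>mu n\<close>.\<close>
  define K where "K s c = F (c(?N := - (?t * hp ?N c ?t) - m * s))" for s and c :: "nat \<Rightarrow> real"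
  have m0: "0 < m" using m by (simp add: m_def)
  have Kpair: "(\<lambda>p. K (snd p) (fst p)) \<in> borel_measurable (lborel_on {..<?N} \<Otimes>\<^sub>M lborel)"
    unfolding K_def
  proof (rule measurable_compose[OF measurable_upd_Suc F])
    show "(\<lambda>p. - (?t * hp ?N (fst p) ?t) - m * snd p) \<in> borel_measurable (lborel_on {..<?N} \<Otimes>\<^sub>M lborel)"
      by (intro borel_measurable_diff borel_measurable_uminus borel_measurable_times borel_measurable_const
          measurable_hp measurable_compose[OF measurable_fst measurable_component_lborel]) auto
  qed simp
  have K: "K s \<in> borel_measurable (lborel_on {..<?N})" for s
    unfolding K_def
  proof (rule measurable_compose[OF measurable_upd_Suc F])
    show "(\<lambda>c. - (?t * hp ?N c ?t) - m * s) \<in> borel_measurable (lborel_on {..<?N})"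
      by (intro borel_measurable_diff borel_measurable_uminus borel_measurable_times borel_measurable_const
          measurable_hp measurable_component_lborel) auto
  qed simp
  have inner: "(\<integral>\<^sup>+y. F (c(?N := y)) \<partial>lborel) = ennreal m * (\<integral>\<^sup>+s. K s c \<partial>lborel)"
    if c: "c \<in> space (lborel_on {..<?N})" for c
  proof -
    have "(\<lambda>y. c(?N := y)) \<in> measurable borel (lborel_on {..<Suc ?N})"
      by (rule measurable_upd_Suc) (use c in auto)
    from measurable_compose[OF this F]
    have "(\<lambda>y. F (c(?N := y))) \<in> borel_measurable borel" .
    from nn_integral_reflect_affine[OF this m0, of "- (?t * hp ?N c ?t)"]
    show ?thesis unfolding K_def .
  qed
  define \<phi> where "\<phi> s k b = pole_coeffs n mu s k - ?t * (case k of 0 \<Rightarrow> 1 | Suc j \<Rightarrow> b j)" for s k and b :: "nat \<Rightarrow> real"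
  have K_mulc: "K s (\<lambda>k\<in>{..<?N}. b k + \<phi> s k b)
    = F (restrict (mulc ?N ?t b (pole_coeffs n mu s)) {..<Suc ?N})" for s b
  proof -
    let ?M = "mulc ?N ?t b (pole_coeffs n mu s)"
    have T: "(\<lambda>k\<in>{..<?N}. b k + \<phi> s k b) = restrict ?M {..<?N}"
      by (rule restrict_ext) (simp add: mulc_def \<phi>_def)
    have e1: "hp (Suc ?N) ?M ?t = - (m * s)"
      unfolding hp_mulc qp_pole_coeffs m_def by (simp add: mult.commute)
    have e2: "hp ?N (restrict ?M {..<?N}) ?t = hp ?N ?M ?t"
      by (rule hp_cong) simp
    have last: "- (?t * hp ?N (restrict ?M {..<?N}) ?t) - m * s = ?M ?N"
      using e1 unfolding e2 hp.simps(2)[of ?N] by linarith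
    have "(restrict ?M {..<?N})(?N := ?M ?N) = restrict ?M {..<Suc ?N}"
      by (rule ext) (simp add: restrict_def)
    then show ?thesis unfolding T K_def last by simp
  qed
  have tri: "(\<integral>\<^sup>+c. K s c \<partial>lborel_on {..<?N})
    = (\<integral>\<^sup>+b. F (restrict (mulc ?N ?t b (pole_coeffs n mu s)) {..<Suc ?N}) \<partial>lborel_on {..<?N})" for s
  proof -
    have "(\<integral>\<^sup>+b. K s (\<lambda>k\<in>{..<?N}. b k + \<phi> s k b) \<partial>lborel_on {..<?N}) = (\<integral>\<^sup>+c. K s c \<partial>lborel_on {..<?N})"
    proof (rule nn_integral_triangular[OF _ _ K])
      fix k and c d :: "nat \<Rightarrow> real" assume "\<And>j. j < k \<Longrightarrow> c j = d j"
      then show "\<phi> s k c = \<phi> s k d" unfolding \<phi>_def by (cases k) simp_all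
    next
      fix k l :: nat assume km: "k < l"
      show "\<phi> s k \<in> borel_measurable (lborel_on {..<l})"
      proof (cases k)
        case (Suc j)
        then have [measurable]: "(\<lambda>b. b j) \<in> borel_measurable (lborel_on {..<l})"
          using km by (intro measurable_component_lborel) simp
        show ?thesis unfolding \<phi>_def[abs_def] Suc by simp
      qed (simp add: \<phi>_def[abs_def])
    qed
    then show ?thesis unfolding K_mulc by (rule sym)
  qed
  have mK: "(\<lambda>c. \<integral>\<^sup>+s. K s c \<partial>lborel) \<in> borel_measurable (lborel_on {..<?N})"
    by (rule lborel.borel_measurable_nn_integral) (simp only: case_prod_beta' Kpair)
  have "(\<integral>\<^sup>+c. F c \<partial>lborel_on {..<Suc ?N}) = (\<integral>\<^sup>+c. \<integral>\<^sup>+y. F (c(?N := y)) \<partial>lborel \<partial>lborel_on {..<?N})"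
    by (rule nn_integral_lborel_Suc(1)[OF F])
  also have "\<dots> = (\<integral>\<^sup>+c. ennreal m * (\<integral>\<^sup>+s. K s c \<partial>lborel) \<partial>lborel_on {..<?N})"
    by (rule nn_integral_cong) (rule inner)
  also have "\<dots> = ennreal m * (\<integral>\<^sup>+c. \<integral>\<^sup>+s. K s c \<partial>lborel \<partial>lborel_on {..<?N})"
    by (rule nn_integral_cmult[OF mK])
  also have "(\<integral>\<^sup>+c. \<integral>\<^sup>+s. K s c \<partial>lborel \<partial>lborel_on {..<?N}) = (\<integral>\<^sup>+s. \<integral>\<^sup>+c. K s c \<partial>lborel_on {..<?N} \<partial>lborel)"
    by (rule Fubini_lborel_on) (simp_all only: finite_lessThan case_prod_beta' Kpair)
  finally show ?thesis unfolding tri m_def .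
qed

text \<open>
  The slopes from \<open>nn_integral_mulc_step\<close> multiply to the Vandermonde product.
\<close>
theorem nn_integral_arrow_coeffs:
  assumes "F \<in> borel_measurable (lborel_on {..<Suc n})" "strict_incr n mu"
  shows "(\<integral>\<^sup>+c. F c \<partial>lborel_on {..<Suc n}) = ennreal (vdm n mu) *
    (\<integral>\<^sup>+a. \<integral>\<^sup>+r. F (restrict (arrow_coeffs n mu a r) {..<Suc n}) \<partial>lborel_on {..<n} \<partial>lborel)"
  using assms
proof (induction n arbitrary: F)
  case 0
  have m: "(\<lambda>y. F ((\<lambda>_. undefined)(0 := y))) \<in> borel_measurable borel"
  proof -
    have "(\<lambda>y. (\<lambda>_. undefined)(0 := y)) \<in> measurable borel (lborel_on {..<Suc 0})"
      by (rule measurable_upd_Suc) (auto simp: space_PiM)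
    from measurable_compose[OF this 0(1)] show ?thesis .
  qed
  have "(\<integral>\<^sup>+c. F c \<partial>lborel_on {..<Suc 0}) = (\<integral>\<^sup>+y. F ((\<lambda>_. undefined)(0 := y)) \<partial>lborel)"
    unfolding nn_integral_lborel_Suc(2)[OF 0(1)] nn_integral_lborel_on_0 by (rule refl)
  also have "\<dots> = (\<integral>\<^sup>+a. F ((\<lambda>_. undefined)(0 := - a)) \<partial>lborel)"
    using nn_integral_reflect_affine[OF m, of 1 0] by simp
  finally have "(\<integral>\<^sup>+c. F c \<partial>lborel_on {..<Suc 0}) = (\<integral>\<^sup>+a. F ((\<lambda>_. undefined)(0 := - a)) \<partial>lborel)" .
  moreover have "(\<lambda>_. undefined)(0 := - a) = restrict (arrow_coeffs 0 mu a r) {..<Suc 0}" for a r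
    by (intro ext) (simp add: restrict_def)
  ultimately show ?case unfolding nn_integral_lborel_on_0 by (simp add: vdm_def del: arrow_coeffs.simps fun_upd_apply)
next
  case (Suc n)
  note F = Suc.prems(1)
  have mu: "strict_incr n mu" and lt: "\<forall>k<n. mu k < mu n"
    using Suc.prems(2) by (simp_all add: strict_incr_Suc)
  let ?N = "Suc n"
  let ?m = "\<Prod>k<n. mu n - mu k"
  have m: "0 < ?m" by (rule prod_pos) (use lt in simp)
  define Z where "Z a r = F (restrict (arrow_coeffs ?N mu a r) {..<Suc ?N})" for a r
  define Fs where "Fs s b = F (restrict (mulc ?N (mu n) b (pole_coeffs n mu s)) {..<Suc ?N})" for s b
  have Fs_meas: "Fs s \<in> borel_measurable (lborel_on {..<?N})" for s
    unfolding Fs_def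
    by (rule measurable_compose[OF measurable_restrict_PiM F], rule measurable_mulc)
       (simp_all add: measurable_component_lborel)
  have Z_meas: "(\<lambda>w. Z (a w) (r w)) \<in> borel_measurable M"
    if a: "a \<in> borel_measurable M" and r: "r \<in> measurable M (lborel_on {..<?N})" for a r and M :: "'b measure"
  proof -
    have rk: "(\<lambda>w. r w k) \<in> borel_measurable M" if "k < ?N" for k
      by (rule measurable_compose[OF r measurable_component_lborel[OF that]])
    show ?thesis unfolding Z_def
      by (rule measurable_compose[OF measurable_restrict_PiM F], rule measurable_arrow_coeffs[OF a rk]) simp_all
  qed
  have FsZ: "Fs s (restrict (arrow_coeffs n mu a r) {..<?N}) = Z a (r(n := s))" for s a r
  proof -
    have "arrow_coeffs n mu a (r(n := s)) = arrow_coeffs n mu a r"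
      by (rule arrow_coeffs_cong) simp
    then have "restrict (mulc ?N (mu n) (restrict (arrow_coeffs n mu a r) {..<?N}) (pole_coeffs n mu s)) {..<Suc ?N}
      = restrict (arrow_coeffs ?N mu a (r(n := s))) {..<Suc ?N}"
      by (intro restrict_ext) (simp, rule mulc_cong, simp_all)
    then show ?thesis unfolding Fs_def Z_def by (simp only:)
  qed
  have Zp: "(\<lambda>p. \<integral>\<^sup>+r. Z (fst p) (r(n := snd p)) \<partial>lborel_on {..<n}) \<in> borel_measurable (lborel \<Otimes>\<^sub>M lborel)"
  proof (rule measurable_nn_integral_lborel_on)
    show "case_prod (\<lambda>p r. Z (fst p) (r(n := snd p))) \<in> borel_measurable ((lborel \<Otimes>\<^sub>M lborel) \<Otimes>\<^sub>M lborel_on {..<n})"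
      unfolding case_prod_beta' by (rule Z_meas, simp, rule measurable_upd_Suc) simp_all
  qed simp
  have "(\<integral>\<^sup>+c. F c \<partial>lborel_on {..<Suc ?N}) = ennreal ?m * (\<integral>\<^sup>+s. \<integral>\<^sup>+b. Fs s b \<partial>lborel_on {..<?N} \<partial>lborel)"
    unfolding Fs_def by (rule nn_integral_mulc_step[OF F m])
  also have "(\<integral>\<^sup>+s. \<integral>\<^sup>+b. Fs s b \<partial>lborel_on {..<?N} \<partial>lborel) = (\<integral>\<^sup>+s. ennreal (vdm n mu) *
      (\<integral>\<^sup>+a. \<integral>\<^sup>+r. Z a (r(n := s)) \<partial>lborel_on {..<n} \<partial>lborel) \<partial>lborel)"
    unfolding Suc.IH[OF Fs_meas mu] FsZ by (rule refl)
  also have "\<dots> = ennreal (vdm n mu) *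
      (\<integral>\<^sup>+s. \<integral>\<^sup>+a. \<integral>\<^sup>+r. Z a (r(n := s)) \<partial>lborel_on {..<n} \<partial>lborel \<partial>lborel)"
  proof (rule nn_integral_cmult)
    have "(\<lambda>p. \<integral>\<^sup>+r. Z (snd p) (r(n := fst p)) \<partial>lborel_on {..<n}) \<in> borel_measurable (lborel \<Otimes>\<^sub>M lborel)"
      using measurable_compose[OF measurable_pair_swap' Zp] by (simp add: case_prod_beta')
    then show "(\<lambda>s. \<integral>\<^sup>+a. \<integral>\<^sup>+r. Z a (r(n := s)) \<partial>lborel_on {..<n} \<partial>lborel) \<in> borel_measurable lborel"
      by (intro lborel.borel_measurable_nn_integral) (simp only: case_prod_beta')
  qed
  also have "(\<integral>\<^sup>+s. \<integral>\<^sup>+a. \<integral>\<^sup>+r. Z a (r(n := s)) \<partial>lborel_on {..<n} \<partial>lborel \<partial>lborel)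
    = (\<integral>\<^sup>+a. \<integral>\<^sup>+s. \<integral>\<^sup>+r. Z a (r(n := s)) \<partial>lborel_on {..<n} \<partial>lborel \<partial>lborel)"
    by (rule lborel_pair.Fubini') (use Zp in \<open>simp only: case_prod_beta'\<close>)
  also have "\<dots> = (\<integral>\<^sup>+a. \<integral>\<^sup>+r. Z a r \<partial>lborel_on {..<?N} \<partial>lborel)"
  proof (rule nn_integral_cong)
    fix a :: real
    have "Z a \<in> borel_measurable (lborel_on {..<?N})"
      by (rule Z_meas[of "\<lambda>_. a" _ "\<lambda>r. r"]) simp_all
    from nn_integral_lborel_Suc(2)[OF this, symmetric]
    show "(\<integral>\<^sup>+s. \<integral>\<^sup>+r. Z a (r(n := s)) \<partial>lborel_on {..<n} \<partial>lborel) = (\<integral>\<^sup>+r. Z a r \<partial>lborel_on {..<?N})" .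
  qed
  finally have "(\<integral>\<^sup>+c. F c \<partial>lborel_on {..<Suc ?N}) = ennreal ?m * (ennreal (vdm n mu) *
    (\<integral>\<^sup>+a. \<integral>\<^sup>+r. Z a r \<partial>lborel_on {..<?N} \<partial>lborel))" .
  moreover have "ennreal (vdm ?N mu) = ennreal ?m * ennreal (vdm n mu)"
    unfolding vdm_Suc using m vdm_pos[OF mu] by (subst ennreal_mult[symmetric]) (simp_all add: mult.commute)
  ultimately show ?case unfolding Z_def by (simp only: mult.assoc)
qed

lemma measurable_interlaces:
  assumes "\<And>k. k < n \<Longrightarrow> (\<lambda>w. m w k) \<in> borel_measurable M"
    and "\<And>k. k \<le> n \<Longrightarrow> (\<lambda>w. z w k) \<in> borel_measurable M"
  shows "Measurable.pred M (\<lambda>w. interlaces n (m w) (z w))"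
proof -
  have "Measurable.pred M (\<lambda>w. j < n \<longrightarrow> z w j < m w j \<and> m w j < z w (Suc j))" for j
  proof (cases "j < n")
    case True
    then have [measurable]: "(\<lambda>w. m w j) \<in> borel_measurable M" "(\<lambda>w. z w j) \<in> borel_measurable M"
      "(\<lambda>w. z w (Suc j)) \<in> borel_measurable M"
      using assms by auto
    show ?thesis by measurable
  qed simp
  then show ?thesis unfolding interlaces_def by (rule pred_intros_countable)
qed

text \<open>
  Both parametrisations of the same polynomials, by arrow data and by roots, are compared with the coefficients. In terms of \<open>z\<close>
  the condition that all \<open>r j\<close> are positive is interlacing with \<open>mu\<close>.
\<close>
theorem nn_integral_arrow_roots:
  assumes F: "F \<in> borel_measurable (lborel_on {..<Suc n})" and mu: "strict_incr n mu"
  shows "ennreal (vdm n mu) * (\<integral>\<^sup>+a. \<integral>\<^sup>+r. (if \<forall>j<n. 0 < r j then F (roots (Suc n) (arrow_coeffs n mu a r)) else 0)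
      \<partial>lborel_on {..<n} \<partial>lborel)
    = (\<integral>\<^sup>+z. vdm_weighted (Suc n) (\<lambda>z. if interlaces n mu z then F z else 0) z \<partial>lborel_on {..<Suc n})"
proof -
  define G where "G z = (if interlaces n mu z then F z else 0)" for z
  have G: "G \<in> borel_measurable (lborel_on {..<Suc n})"
  proof -
    note F[measurable]
    have [measurable]: "Measurable.pred (lborel_on {..<Suc n}) (interlaces n mu)"
      by (rule measurable_interlaces) (simp_all add: measurable_component_lborel)
    show ?thesis unfolding G_def by measurable
  qed
  have eq: "(if \<forall>j<n. 0 < r j then F (roots (Suc n) (arrow_coeffs n mu a r)) else 0)
    = at_roots (Suc n) G (restrict (arrow_coeffs n mu a r) {..<Suc n})" for a r
  proof -
    let ?c = "arrow_coeffs n mu a r"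
    have "at_roots (Suc n) G (restrict ?c {..<Suc n}) = at_roots (Suc n) G ?c"
      by (rule at_roots_cong) simp
    also have "\<dots> = (if \<forall>j<n. 0 < r j then F (roots (Suc n) ?c) else 0)"
    proof (cases "\<forall>j<n. 0 < r j")
      case True
      then have r: "\<And>j. j < n \<Longrightarrow> 0 < r j" by blast
      have sr: "simple_rooted (Suc n) ?c" by (rule pos_imp_interlaces(1)[of n mu r a, OF mu r])
      have il: "interlaces n mu (roots (Suc n) ?c)" by (rule pos_imp_interlaces(2)[of n mu r a, OF mu r])
      show ?thesis
        unfolding at_roots_def G_def if_P[OF True] if_P[OF sr] if_P[OF il] by (rule refl)
    next
      case False
      have "\<not> (simple_rooted (Suc n) ?c \<and> interlaces n mu (roots (Suc n) ?c))"
        using interlaces_imp_pos[OF mu] False by blast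
      then have "at_roots (Suc n) G ?c = 0" unfolding at_roots_def G_def by (simp del: roots.simps)
      then show ?thesis unfolding if_not_P[OF False] .
    qed
    finally show ?thesis by (rule sym)
  qed
  have mG: "at_roots (Suc n) G \<in> borel_measurable (lborel_on {..<Suc n})"
    by (rule measurable_at_roots[OF G]) (rule measurable_component_lborel)
  show ?thesis
    unfolding eq nn_integral_arrow_coeffs[OF mG mu, symmetric] G_def[symmetric]
    by (rule nn_integral_at_roots[OF G])
qed

section \<open>The spectral theorem\<close>

unbundle no vec_syntax
hide_const (open) Determinants.det

lemma mat_mult_entry:
  assumes "A \<in> carrier_mat n m" "B \<in> carrier_mat m p" "i < n" "j < p"
  shows "(A * B) $$ (i, j) = (\<Sum>k<m. A $$ (i, k) * B $$ (k, j))"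
  using assms by (auto simp: scalar_prod_def atLeast0LessThan intro!: sum.cong)

definition adj :: "complex mat \<Rightarrow> complex mat" where
  "adj A = Matrix.mat (dim_col A) (dim_row A) (\<lambda>(i, j). cnj (A $$ (j, i)))"

lemma adj_carrier [simp]: "A \<in> carrier_mat n m \<Longrightarrow> adj A \<in> carrier_mat m n"
  by (auto simp: adj_def)

lemma adj_entry [simp]: "A \<in> carrier_mat n m \<Longrightarrow> i < m \<Longrightarrow> j < n \<Longrightarrow> adj A $$ (i, j) = cnj (A $$ (j, i))"
  by (auto simp: adj_def)

lemma adj_mult:
  assumes A: "A \<in> carrier_mat n m" and B: "B \<in> carrier_mat m p"
  shows "adj (A * B) = adj B * adj A"
proof (rule eq_matI)
  have AB: "A * B \<in> carrier_mat n p" using A B by simp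
  show "dim_row (adj (A * B)) = dim_row (adj B * adj A)" "dim_col (adj (A * B)) = dim_col (adj B * adj A)"
    using A B by (auto simp: adj_def)
  fix i j assume "i < dim_row (adj B * adj A)" "j < dim_col (adj B * adj A)"
  then have ij: "i < p" "j < n" using A B by (auto simp: adj_def)
  show "adj (A * B) $$ (i, j) = (adj B * adj A) $$ (i, j)"
    using mat_mult_entry[OF adj_carrier[OF B] adj_carrier[OF A] ij] mat_mult_entry[OF A B ij(2,1)]
      adj_entry[OF AB ij] adj_entry[OF A] adj_entry[OF B] ij
    by (simp add: mult.commute)
qed

lemma adj_four_block:
  assumes "A \<in> carrier_mat n n" "B \<in> carrier_mat n m" "C \<in> carrier_mat m n" "D \<in> carrier_mat m m"
  shows "adj (four_block_mat A B C D) = four_block_mat (adj A) (adj C) (adj B) (adj D)"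
  using assms by (intro eq_matI) (auto simp: adj_def)

lemma adj_one [simp]: "adj (1\<^sub>m n) = 1\<^sub>m n"
  by (rule eq_matI) (auto simp: adj_def)

lemma adj_zero [simp]: "adj (0\<^sub>m n m) = 0\<^sub>m m n"
  by (rule eq_matI) (auto simp: adj_def)

text \<open>
  The reflection that exchanges \<open>f\<close> with the first unit vector. It exists because the first entry of \<open>f\<close> is
  real, so that the inner product of the two vectors is real.
\<close>
lemma householder:
  fixes f :: "nat \<Rightarrow> complex"
  assumes f: "(\<Sum>i<N. (cmod (f i))\<^sup>2) = 1" "Im (f 0) = 0" and N: "0 < N"
  shows "\<exists>H\<in>carrier_mat N N. adj H = H \<and> H * H = 1\<^sub>m N \<and> (\<forall>i<N. H $$ (i, 0) = f i)"
proof -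
  define w where "w i = f i - (if i = 0 then 1 else 0)" for i
  define s where "s = (\<Sum>i<N. (cmod (w i))\<^sup>2)"
  have split: "(\<Sum>i<N. g i) = g 0 + (\<Sum>i\<in>{..<N} - {0}. g i)" for g :: "nat \<Rightarrow> real"
    using N by (intro sum.remove) auto
  have w0: "w 0 = of_real (Re (f 0) - 1)" using f(2) by (simp add: w_def complex_eq_iff)
  have s: "s = 2 - 2 * Re (f 0)"
  proof -
    have "(\<Sum>i\<in>{..<N} - {0}. (cmod (w i))\<^sup>2) = (\<Sum>i\<in>{..<N} - {0}. (cmod (f i))\<^sup>2)"
      by (intro sum.cong refl) (simp add: w_def)
    also have "\<dots> = 1 - (Re (f 0))\<^sup>2"
      using split[of "\<lambda>i. (cmod (f i))\<^sup>2"] f by (simp add: cmod_power2)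
    finally show ?thesis
      unfolding s_def split[of "\<lambda>i. (cmod (w i))\<^sup>2"] w0 norm_of_real
      by (simp add: power2_eq_square algebra_simps)
  qed
  show ?thesis
  proof (cases "s = 0")
    case True
    then have "w i = 0" if "i < N" for i
      using that unfolding s_def by (subst (asm) sum_nonneg_eq_0_iff) auto
    then show ?thesis
      by (intro bexI[of _ "1\<^sub>m N"]) (auto simp: w_def N split: if_splits)
  next
    case False
    \<comment> \<open>The reflection in the hyperplane orthogonal to \<open>w\<close>, the difference of \<open>f\<close> and the first unit vector.\<close>
    define H where "H = Matrix.mat N N (\<lambda>(i, j). (if i = j then 1 else 0) - 2 * w i * cnj (w j) / complex_of_real s)"
    have Hc: "H \<in> carrier_mat N N" by (simp add: H_def)
    have He: "H $$ (i, j) = (if i = j then 1 else 0) - 2 * w i * cnj (w j) / complex_of_real s"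
      if "i < N" "j < N" for i j using that by (simp add: H_def)
    have ws: "(\<Sum>k<N. cnj (w k) * w k) = complex_of_real s"
      unfolding s_def of_real_sum by (intro sum.cong refl) (simp add: complex_norm_square mult.commute del: of_real_power)
    have "adj H = H"
    proof (rule eq_matI)
      fix i j assume "i < dim_row H" "j < dim_col H"
      then have ij: "i < N" "j < N" using Hc by auto
      show "adj H $$ (i, j) = H $$ (i, j)"
        using ij by (simp add: adj_entry[OF Hc] He mult_ac)
    qed (use Hc in \<open>auto simp: adj_def\<close>)
    moreover have "H * H = 1\<^sub>m N"
    proof (rule eq_matI)
      fix i j assume "i < dim_row (1\<^sub>m N :: complex mat)" "j < dim_col (1\<^sub>m N :: complex mat)"
      then have ij: "i < N" "j < N" by auto
      define S where "S = complex_of_real s"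
      have S0: "S \<noteq> 0" using False by (simp add: S_def)
      have "(H * H) $$ (i, j) = (\<Sum>k<N. H $$ (i, k) * H $$ (k, j))"
        by (rule mat_mult_entry[OF Hc Hc ij])
      also have "\<dots> = (\<Sum>k<N. (if i = k then H $$ (k, j) else 0)
          - ((if k = j then 2 * w i * cnj (w k) / S else 0) - 4 * w i * cnj (w j) / S\<^sup>2 * (cnj (w k) * w k)))"
        using ij S0 by (intro sum.cong refl) (auto simp: He S_def[symmetric] field_simps power2_eq_square)
      also have "\<dots> = H $$ (i, j) - (2 * w i * cnj (w j) / S - 4 * w i * cnj (w j) / S\<^sup>2 * S)"
        using ij unfolding sum_subtractf sum_distrib_left[symmetric] ws S_def[symmetric] by simp
      also have "\<dots> = (if i = j then 1 else 0)"
        using ij S0 by (simp add: He S_def[symmetric] field_simps power2_eq_square)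
      finally show "(H * H) $$ (i, j) = 1\<^sub>m N $$ (i, j)" using ij by simp
    qed (use Hc in auto)
    moreover have "\<forall>i<N. H $$ (i, 0) = f i"
    proof (intro allI impI)
      fix i assume i: "i < N"
      have c: "cnj (w 0) = - (complex_of_real s / 2)" unfolding w0 s by (simp add: field_simps)
      have "2 * w i * cnj (w 0) / complex_of_real s = - w i"
        unfolding c using False by simp
      then have "H $$ (i, 0) = (if i = 0 then 1 else 0) - (- w i)" unfolding He[OF i N] by (simp only:)
      then show "H $$ (i, 0) = f i" by (simp add: w_def)
    qed
    ultimately show ?thesis using Hc by blast
  qed
qed

text \<open>
  An eigenvector exists over the complex numbers; dividing by its norm and by the phase of its first entry gives the
  normalisation that \<open>householder\<close> requires.
\<close>
lemma unit_eigenvector: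
  assumes A: "A \<in> carrier_mat N N" and N: "0 < N"
  shows "\<exists>e f. (\<Sum>i<N. (cmod (f i))\<^sup>2) = 1 \<and> Im (f 0) = 0 \<and> (\<forall>i<N. (\<Sum>k<N. A $$ (i, k) * f k) = e * f i)"
proof -
  obtain as where as: "char_poly A = (\<Prod>a\<leftarrow>as. [:- a, 1:])" "length as = N"
    using char_poly_factorized[OF A] by blast
  then obtain e as' where "as = e # as'" using N by (cases as) auto
  then have "poly (char_poly A) e = 0" using as by simp
  then obtain v where v: "eigenvector A v e"
    using eigenvalue_root_char_poly[OF A] unfolding eigenvalue_def by blast
  have vc: "v \<in> carrier_vec N" "v \<noteq> 0\<^sub>v N" "A *\<^sub>v v = e \<cdot>\<^sub>v v"
    using v A unfolding eigenvector_def by auto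
  define g where "g = vec_index v"
  have ev: "(\<Sum>k<N. A $$ (i, k) * g k) = e * g i" if i: "i < N" for i
  proof -
    have "vec_index (A *\<^sub>v v) i = (\<Sum>k<N. A $$ (i, k) * g k)"
      using A vc(1) i by (auto simp: scalar_prod_def g_def atLeast0LessThan intro!: sum.cong)
    then show ?thesis using vc(1) i unfolding vc(3) by (simp add: g_def)
  qed
  obtain k where k: "k < N" "g k \<noteq> 0"
  proof (rule ccontr)
    assume "\<not> thesis"
    then have "\<And>k. k < N \<Longrightarrow> g k = 0" using that by blast
    then have "v = 0\<^sub>v N" using vc(1) by (intro eq_vecI) (auto simp: g_def)
    then show False using vc(2) by simp
  qed
  define s where "s = (\<Sum>i<N. (cmod (g i))\<^sup>2)"
  have s: "0 < s"
    unfolding s_def by (rule sum_pos2[of _ k]) (use k in auto)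
  define c where "c = (if g 0 = 0 then 1 else cnj (g 0) / of_real (cmod (g 0))) / of_real (sqrt s)"
  have c: "(cmod c)\<^sup>2 = 1 / s"
    using s by (simp add: c_def norm_divide power_divide)
  define f where "f i = c * g i" for i
  have "(\<Sum>i<N. (cmod (f i))\<^sup>2) = (cmod c)\<^sup>2 * s"
    unfolding f_def s_def norm_mult power_mult_distrib sum_distrib_left ..
  then have 1: "(\<Sum>i<N. (cmod (f i))\<^sup>2) = 1" using c s by simp
  have 2: "Im (f 0) = 0"
  proof (cases "g 0 = 0")
    case False
    have "f 0 = (g 0 * cnj (g 0)) / of_real (cmod (g 0)) / of_real (sqrt s)"
      using False by (simp add: f_def c_def mult_ac)
    also have "\<dots> = of_real ((cmod (g 0))\<^sup>2 / cmod (g 0) / sqrt s)"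
      by (simp add: complex_norm_square[symmetric])
    finally show ?thesis by (simp only: Im_complex_of_real)
  qed (simp add: f_def)
  have 3: "(\<Sum>k<N. A $$ (i, k) * f k) = e * f i" if "i < N" for i
  proof -
    have "(\<Sum>k<N. A $$ (i, k) * f k) = c * (\<Sum>k<N. A $$ (i, k) * g k)"
      unfolding f_def sum_distrib_left by (intro sum.cong refl) (simp add: mult_ac)
    then show ?thesis using ev[OF that] by (simp add: f_def mult_ac)
  qed
  show ?thesis using 1 2 3 by blast
qed

lemma hermitian_split_first:
  assumes B: "B \<in> carrier_mat (Suc n) (Suc n)" and herm: "adj B = B"
    and col: "\<And>i. i < Suc n \<Longrightarrow> i \<noteq> 0 \<Longrightarrow> B $$ (i, 0) = 0"
  shows "\<exists>A'\<in>carrier_mat n n. adj A' = A' \<and>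
    B = four_block_mat (Matrix.mat 1 1 (\<lambda>_. of_real (Re (B $$ (0, 0))))) (0\<^sub>m 1 n) (0\<^sub>m n 1) A'"
proof -
  have h: "B $$ (i, j) = cnj (B $$ (j, i))" if "i < Suc n" "j < Suc n" for i j
    using adj_entry[OF B that] unfolding herm .
  define A' where "A' = Matrix.mat n n (\<lambda>(i, j). B $$ (Suc i, Suc j))"
  have A': "A' \<in> carrier_mat n n" by (simp add: A'_def)
  have "adj A' = A'"
  proof (rule eq_matI)
    fix i j assume "i < dim_row A'" "j < dim_col A'"
    then have ij: "i < n" "j < n" using A' by auto
    then show "adj A' $$ (i, j) = A' $$ (i, j)"
      using h[of "Suc i" "Suc j"] unfolding adj_entry[OF A' ij] by (simp add: A'_def)
  qed (use A' in \<open>auto simp: adj_def\<close>)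
  moreover have "B = four_block_mat (Matrix.mat 1 1 (\<lambda>_. of_real (Re (B $$ (0, 0))))) (0\<^sub>m 1 n) (0\<^sub>m n 1) A'"
    (is "_ = ?R")
  proof (rule eq_matI)
    fix i j assume "i < dim_row ?R" "j < dim_col ?R"
    then have ij: "i < Suc n" "j < Suc n" using A' by auto
    have "Im (B $$ (0, 0)) = 0" using h[of 0 0] by (simp add: complex_eq_iff)
    then have "B $$ (0, 0) = of_real (Re (B $$ (0, 0)))" by (simp add: complex_eq_iff)
    moreover have "B $$ (0, j) = 0" if "j \<noteq> 0" using h[of 0 j] col[OF ij(2) that] ij by simp
    ultimately show "B $$ (i, j) = ?R $$ (i, j)"
      using ij A' col by (cases "i = 0"; cases "j = 0") (auto simp: A'_def)
  qed (use A' B in auto)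
  ultimately show ?thesis using A' by blast
qed

lemma block_diag_mult:
  assumes E: "E \<in> carrier_mat 1 1" "E' \<in> carrier_mat 1 1"
    and X: "X \<in> carrier_mat n n" "Y \<in> carrier_mat n n"
  shows "four_block_mat E (0\<^sub>m 1 n) (0\<^sub>m n 1) X * four_block_mat E' (0\<^sub>m 1 n) (0\<^sub>m n 1) Y
    = four_block_mat (E * E') (0\<^sub>m 1 n) (0\<^sub>m n 1) (X * Y)"
proof -
  have EE: "E * E' \<in> carrier_mat 1 1" and XY: "X * Y \<in> carrier_mat n n" using assms by auto
  show ?thesis
    unfolding mult_four_block_mat[OF E(1) zero_carrier_mat zero_carrier_mat X(1) E(2) zero_carrier_mat zero_carrier_mat X(2)]
    using assms EE XY by (intro cong_four_block_mat) simp_all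
qed

text \<open>
  Conjugation with a reflection whose first column is an eigenvector makes the first column, and by symmetry
  the first row, vanish off the diagonal. The complementary block is again Hermitian and smaller.
\<close>
theorem spectral_theorem:
  assumes "A \<in> carrier_mat n n" "adj A = A"
  shows "\<exists>U\<in>carrier_mat n n. \<exists>d. adj U * U = 1\<^sub>m n \<and> adj U * A * U = mat_diag n (\<lambda>i. complex_of_real (d i))"
  using assms
proof (induction n arbitrary: A)
  case 0
  then show ?case
    by (intro bexI[of _ "1\<^sub>m 0"] exI[of _ "\<lambda>_. 0"]) (auto intro!: eq_matI simp: mat_diag_def)
next
  case (Suc n)
  let ?N = "Suc n"
  note A = Suc.prems(1)
  obtain e f where f: "(\<Sum>i<?N. (cmod (f i))\<^sup>2) = 1" "Im (f 0) = 0"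
      "\<And>i. i < ?N \<Longrightarrow> (\<Sum>k<?N. A $$ (i, k) * f k) = e * f i"
    using unit_eigenvector[OF A] by blast
  obtain H where H: "H \<in> carrier_mat ?N ?N" "adj H = H" "H * H = 1\<^sub>m ?N" "\<And>i. i < ?N \<Longrightarrow> H $$ (i, 0) = f i"
    using householder[OF f(1,2)] by blast
  define B where "B = H * (A * H)"
  have AH: "A * H \<in> carrier_mat ?N ?N" using A H by simp
  have B: "B \<in> carrier_mat ?N ?N" using AH H by (simp add: B_def)
  have hB: "adj B = B"
  proof -
    have "adj B = (adj H * adj A) * adj H" unfolding B_def adj_mult[OF H(1) AH] adj_mult[OF A H(1)] ..
    then show ?thesis unfolding H(2) Suc.prems(2) B_def using A H by simp
  qed
  have colB: "B $$ (i, 0) = 0" if i: "i < ?N" "i \<noteq> 0" for i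
  proof -
    have "B $$ (i, 0) = (\<Sum>k<?N. H $$ (i, k) * (A * H) $$ (k, 0))"
      unfolding B_def by (rule mat_mult_entry[OF H(1) AH]) (use i in auto)
    also have "\<dots> = (\<Sum>k<?N. e * (H $$ (i, k) * H $$ (k, 0)))"
    proof (rule sum.cong)
      fix k assume k: "k \<in> {..<?N}"
      have "(A * H) $$ (k, 0) = (\<Sum>l<?N. A $$ (k, l) * H $$ (l, 0))"
        by (rule mat_mult_entry[OF A H(1)]) (use k in auto)
      also have "\<dots> = e * f k" using f(3)[of k] k H(4) by simp
      finally show "H $$ (i, k) * (A * H) $$ (k, 0) = e * (H $$ (i, k) * H $$ (k, 0))"
        using H(4)[of k] k by simp
    qed simp
    also have "\<dots> = e * (H * H) $$ (i, 0)"
      unfolding sum_distrib_left[symmetric] using mat_mult_entry[OF H(1) H(1), of i 0] i by simp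
    finally show ?thesis unfolding H(3) using i by simp
  qed
  obtain A' where A': "A' \<in> carrier_mat n n" "adj A' = A'"
      "B = four_block_mat (Matrix.mat 1 1 (\<lambda>_. of_real (Re (B $$ (0, 0))))) (0\<^sub>m 1 n) (0\<^sub>m n 1) A'"
    using hermitian_split_first[OF B hB colB] by blast
  obtain U' d' where U': "U' \<in> carrier_mat n n" "adj U' * U' = 1\<^sub>m n"
      "adj U' * A' * U' = mat_diag n (\<lambda>i. complex_of_real (d' i))"
    using Suc.IH[OF A'(1,2)] by blast
  define V where "V = four_block_mat (1\<^sub>m 1) (0\<^sub>m 1 n) (0\<^sub>m n 1) U'"
  have V: "V \<in> carrier_mat ?N ?N" using four_block_carrier_mat[of "1\<^sub>m 1" 1 1 U' n n] U' by (simp add: V_def)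
  have adjV: "adj V = four_block_mat (1\<^sub>m 1) (0\<^sub>m 1 n) (0\<^sub>m n 1) (adj U')"
    unfolding V_def using U' by (subst adj_four_block[of _ 1 _ n]) auto
  have "adj V * V = four_block_mat (1\<^sub>m 1 * 1\<^sub>m 1) (0\<^sub>m 1 n) (0\<^sub>m n 1) (adj U' * U')"
    unfolding adjV unfolding V_def by (rule block_diag_mult) (use U' in auto)
  also have "\<dots> = 1\<^sub>m ?N" unfolding U'(2) by (rule eq_matI) auto
  finally have VV: "adj V * V = 1\<^sub>m ?N" .
  define x where "x = Re (B $$ (0, 0))"
  let ?E = "Matrix.mat 1 1 (\<lambda>_. complex_of_real x)"
  define d where "d i = (case i of 0 \<Rightarrow> x | Suc j \<Rightarrow> d' j)" for i
  have Bx: "B = four_block_mat ?E (0\<^sub>m 1 n) (0\<^sub>m n 1) A'" unfolding x_def by (rule A'(3))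
  have "adj V * B = four_block_mat (1\<^sub>m 1 * ?E) (0\<^sub>m 1 n) (0\<^sub>m n 1) (adj U' * A')"
    unfolding adjV Bx by (rule block_diag_mult) (use U' A'(1) in auto)
  then have "adj V * B * V = four_block_mat (1\<^sub>m 1 * ?E) (0\<^sub>m 1 n) (0\<^sub>m n 1) (adj U' * A')
      * four_block_mat (1\<^sub>m 1) (0\<^sub>m 1 n) (0\<^sub>m n 1) U'"
    unfolding V_def by (simp only:)
  also have "\<dots> = four_block_mat (1\<^sub>m 1 * ?E * 1\<^sub>m 1) (0\<^sub>m 1 n) (0\<^sub>m n 1) (adj U' * A' * U')"
    by (rule block_diag_mult) (use U' A'(1) mult_carrier_mat[OF adj_carrier[OF U'(1)] A'(1)] in auto)
  also have "\<dots> = mat_diag ?N (\<lambda>i. complex_of_real (d i))"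
    unfolding U'(3)
    by (rule eq_matI) (auto simp: mat_diag_def d_def split: nat.split)
  finally have VBV: "adj V * B * V = mat_diag ?N (\<lambda>i. complex_of_real (d i))" .
  define U where "U = H * V"
  have U: "U \<in> carrier_mat ?N ?N" using H V by (simp add: U_def)
  have adjU: "adj U = adj V * H" unfolding U_def adj_mult[OF H(1) V] H(2) ..
  have c: "adj V \<in> carrier_mat ?N ?N" using V by simp
  have HHV: "H * (H * V) = V"
    using assoc_mult_mat[OF H(1) H(1) V, symmetric] V unfolding H(3) by simp
  have HV: "H * V \<in> carrier_mat ?N ?N" using H V by simp
  have "adj U * U = adj V * (H * (H * V))"
    unfolding adjU unfolding U_def by (rule assoc_mult_mat[OF c H(1) HV])
  then have UU: "adj U * U = 1\<^sub>m ?N" using VV HHV by simp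
  have AHV: "A * (H * V) \<in> carrier_mat ?N ?N" and HAH: "H * (A * H) \<in> carrier_mat ?N ?N"
    and cH: "adj V * H \<in> carrier_mat ?N ?N" using A HV H AH c by auto
  have "adj U * A * U = adj V * H * A * (H * V)" unfolding adjU unfolding U_def ..
  also have "\<dots> = adj V * (H * (A * (H * V)))"
    unfolding assoc_mult_mat[OF cH A HV] by (rule assoc_mult_mat[OF c H(1) AHV])
  also have "\<dots> = adj V * B * V"
    unfolding B_def assoc_mult_mat[OF c HAH V] assoc_mult_mat[OF H(1) AH V] assoc_mult_mat[OF A H(1) V] ..
  finally have "adj U * A * U = adj V * B * V" .
  then show ?case using U UU VBV by auto
qed

lemma sorting_permutation:
  fixes d :: "nat \<Rightarrow> real"
  shows "\<exists>p. bij_betw p {..<n} {..<n} \<and> (\<forall>i j. i \<le> j \<longrightarrow> j < n \<longrightarrow> d (p i) \<le> d (p j))"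
proof -
  define xs where "xs = sort_key d [0..<n]"
  have xs: "length xs = n" "distinct xs" "set xs = {..<n}" "sorted (map d xs)"
    by (auto simp: xs_def)
  have "bij_betw ((!) xs) {..<n} {..<n}"
    by (rule bij_betw_nth[OF xs(2)]) (simp_all only: xs)
  moreover have "d (xs ! i) \<le> d (xs ! j)" if "i \<le> j" "j < n" for i j
    using sorted_nth_mono[OF xs(4) that(1)] that xs(1) by simp
  ultimately show ?thesis by blast
qed

theorem spectral_theorem_sorted:
  assumes A: "A \<in> carrier_mat n n" "adj A = A"
  shows "\<exists>U\<in>carrier_mat n n. \<exists>d. adj U * U = 1\<^sub>m n \<and> adj U * A * U = mat_diag n (\<lambda>i. complex_of_real (d i))
    \<and> (\<forall>i j. i \<le> j \<longrightarrow> j < n \<longrightarrow> d i \<le> d j)"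
proof -
  obtain U d where U: "U \<in> carrier_mat n n" "adj U * U = 1\<^sub>m n"
      "adj U * A * U = mat_diag n (\<lambda>i. complex_of_real (d i))"
    using spectral_theorem[OF A] by blast
  obtain p where p: "bij_betw p {..<n} {..<n}" "\<And>i j. i \<le> j \<Longrightarrow> j < n \<Longrightarrow> d (p i) \<le> d (p j)"
    using sorting_permutation[of n d] by blast
  have pn: "p i < n" if "i < n" for i using bij_betwE[OF p(1)] that by blast
  have pinj: "p i = p j \<longleftrightarrow> i = j" if "i < n" "j < n" for i j
    using inj_on_eq_iff[OF bij_betw_imp_inj_on[OF p(1)]] that by simp
  define W where "W = Matrix.mat n n (\<lambda>(i, j). U $$ (i, p j))"
  have W: "W \<in> carrier_mat n n" by (simp add: W_def)
  have We: "W $$ (i, j) = U $$ (i, p j)" if "i < n" "j < n" for i j using that by (simp add: W_def)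
  have aWe: "adj W $$ (i, j) = adj U $$ (p i, j)" if "i < n" "j < n" for i j
    using that pn[OF that(1)] by (simp add: adj_entry[OF W] adj_entry[OF U(1)] We)
  have perm: "(adj W * B * W) $$ (i, j) = (adj U * B * U) $$ (p i, p j)"
    if B: "B \<in> carrier_mat n n" and ij: "i < n" "j < n" for B i j
  proof -
    have c: "adj W * B \<in> carrier_mat n n" "adj U * B \<in> carrier_mat n n" using B W U(1) by (meson adj_carrier mult_carrier_mat)+
    have "(adj W * B) $$ (i, k) = (adj U * B) $$ (p i, k)" if "k < n" for k
      unfolding mat_mult_entry[OF adj_carrier[OF W] B ij(1) that]
        mat_mult_entry[OF adj_carrier[OF U(1)] B pn[OF ij(1)] that]
      using aWe ij by (intro sum.cong) auto
    then show ?thesis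
      unfolding mat_mult_entry[OF c(1) W ij] mat_mult_entry[OF c(2) U(1) pn[OF ij(1)] pn[OF ij(2)]]
      using We ij by (intro sum.cong) auto
  qed
  have one: "adj X * 1\<^sub>m n * X = adj X * X" if "X \<in> carrier_mat n n" for X
    using right_mult_one_mat[OF adj_carrier[OF that]] by simp
  have "adj W * W = 1\<^sub>m n"
  proof (rule eq_matI)
    fix i j assume "i < dim_row (1\<^sub>m n :: complex mat)" "j < dim_col (1\<^sub>m n :: complex mat)"
    then have ij: "i < n" "j < n" by auto
    show "(adj W * W) $$ (i, j) = 1\<^sub>m n $$ (i, j)"
      using perm[OF one_carrier_mat ij] unfolding one[OF W] one[OF U(1)] U(2)
      using ij pn pinj[OF ij] by simp
  qed (use W in \<open>auto simp: adj_def\<close>)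
  moreover have "adj W * A * W = mat_diag n (\<lambda>i. complex_of_real (d (p i)))"
  proof (rule eq_matI)
    fix i j assume "i < dim_row (mat_diag n (\<lambda>i. complex_of_real (d (p i))))"
      "j < dim_col (mat_diag n (\<lambda>i. complex_of_real (d (p i))))"
    then have ij: "i < n" "j < n" by (auto simp: mat_diag_def)
    show "(adj W * A * W) $$ (i, j) = mat_diag n (\<lambda>i. complex_of_real (d (p i))) $$ (i, j)"
      unfolding perm[OF A(1) ij] U(3) using ij pn pinj[OF ij] by (simp add: mat_diag_def)
  qed (use W in \<open>auto simp: adj_def mat_diag_def\<close>)
  ultimately show ?thesis using W p(2) by (intro bexI[of _ W] exI[of _ "\<lambda>i. d (p i)"]) auto
qed

section \<open>Characteristic polynomials of bordered matrices\<close>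

text \<open>
  Coefficients of the characteristic polynomial in the order of \<open>hp\<close>; they are real for Hermitian
  matrices, and the real part only changes the type.
\<close>
definition hcoeffs :: "nat \<Rightarrow> complex mat \<Rightarrow> nat \<Rightarrow> real" where
  "hcoeffs n A k = Re (coeff (char_poly A) (n - Suc k))"

lemma hp_expand: "hp n c x = x ^ n + (\<Sum>k<n. c k * x ^ (n - Suc k))"
proof (induction n)
  case (Suc n)
  have "(\<Sum>k<n. c k * x ^ (Suc n - Suc k)) = x * (\<Sum>k<n. c k * x ^ (n - Suc k))"
    unfolding sum_distrib_left
    by (intro sum.cong refl) (simp add: Suc_diff_Suc[symmetric] power_Suc[symmetric] del: power_Suc)
  then show ?case by (simp add: Suc algebra_simps)
qed simp

lemma hp_hcoeffs:
  assumes "A \<in> carrier_mat n n"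
  shows "hp n (hcoeffs n A) x = Re (poly (char_poly A) (complex_of_real x))"
proof -
  have d: "degree (char_poly A) = n" "coeff (char_poly A) n = 1"
    using degree_monic_char_poly[OF assms] by auto
  have "Re (poly (char_poly A) (complex_of_real x))
    = (\<Sum>i\<le>n. Re (coeff (char_poly A) i) * x ^ i)"
    unfolding poly_altdef d Re_sum by (intro sum.cong refl) (simp flip: of_real_power)
  also have "\<dots> = (\<Sum>i<n. Re (coeff (char_poly A) i) * x ^ i) + x ^ n"
    using d(2) by (simp add: lessThan_Suc_atMost[symmetric])
  also have "(\<Sum>i<n. Re (coeff (char_poly A) i) * x ^ i)
    = (\<Sum>k<n. Re (coeff (char_poly A) (n - Suc k)) * x ^ (n - Suc k))"
    by (rule sum.nat_diff_reindex[symmetric])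
  finally show ?thesis unfolding hp_expand hcoeffs_def by simp
qed

lemma char_poly_mat_diag:
  "char_poly (mat_diag n f) = (\<Prod>i<n. [:- f i, 1:])"
proof -
  have "char_poly (mat_diag n f) = (\<Prod>a\<leftarrow>diag_mat (mat_diag n f). [:- a, 1:])"
    by (rule char_poly_upper_triangular[of _ n]) (auto simp: mat_diag_def)
  also have "diag_mat (mat_diag n f) = map f [0..<n]"
    by (simp add: diag_mat_def mat_diag_def)
  also have "(\<Prod>a\<leftarrow>map f [0..<n]. [:- a, 1:]) = (\<Prod>i<n. [:- f i, 1:])"
    by (induction n) simp_all
  finally show ?thesis .
qed

lemma char_poly_unitary:
  assumes A: "A \<in> carrier_mat n n" and U: "U \<in> carrier_mat n n" "adj U * U = 1\<^sub>m n"
  shows "char_poly (adj U * A * U) = char_poly A"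
proof -
  have "U * adj U = 1\<^sub>m n" by (rule mat_mult_left_right_inverse[OF adj_carrier[OF U(1)] U(1) U(2)])
  then have "similar_mat_wit (adj U * A * U) A (adj U) U"
    by (intro similar_mat_witI[OF U(2) _ refl])
       (use assms mult_carrier_mat[OF mult_carrier_mat[OF adj_carrier[OF U(1)] A] U(1)] in auto)
  then show ?thesis by (intro char_poly_similar) (auto simp: similar_mat_def)
qed

text \<open>
  By the spectral theorem the characteristic polynomial splits over the reals, so \<open>roots\<close> is the ordered list of
  eigenvalues with multiplicity, and in particular a measurable function of the matrix.
\<close>
lemma char_poly_hermitian:
  assumes A: "A \<in> carrier_mat n n" "adj A = A"
  shows "char_poly A = (\<Prod>i<n. [:- complex_of_real (roots n (hcoeffs n A) i), 1:])"
    and "\<And>i j. i \<le> j \<Longrightarrow> j < n \<Longrightarrow> roots n (hcoeffs n A) i \<le> roots n (hcoeffs n A) j"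
    and "hp n (hcoeffs n A) x = (\<Prod>i<n. x - roots n (hcoeffs n A) i)"
proof -
  obtain U d where U: "U \<in> carrier_mat n n" "adj U * U = 1\<^sub>m n"
      "adj U * A * U = mat_diag n (\<lambda>i. complex_of_real (d i))"
      "\<And>i j. i \<le> j \<Longrightarrow> j < n \<Longrightarrow> d i \<le> d j"
    using spectral_theorem_sorted[OF A] by blast
  have cp: "char_poly A = (\<Prod>i<n. [:- complex_of_real (d i), 1:])"
    using char_poly_unitary[OF A(1) U(1,2)] unfolding U(3) char_poly_mat_diag by simp
  have hp: "hp n (hcoeffs n A) x = (\<Prod>i<n. x - d i)" for x
  proof -
    have "poly (char_poly A) (complex_of_real x) = complex_of_real (\<Prod>i<n. x - d i)"
      unfolding cp poly_prod of_real_prod by (intro prod.cong refl) simp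
    then show ?thesis unfolding hp_hcoeffs[OF A(1)] by (simp only: Re_complex_of_real)
  qed
  have r: "roots n (hcoeffs n A) i = d i" if "i < n" for i
    by (rule roots_unique[OF hp U(4) that])
  show "char_poly A = (\<Prod>i<n. [:- complex_of_real (roots n (hcoeffs n A) i), 1:])"
    unfolding cp by (intro prod.cong refl) (simp add: r)
  show "roots n (hcoeffs n A) i \<le> roots n (hcoeffs n A) j" if "i \<le> j" "j < n" for i j
    using U(4)[OF that] r that by simp
  show "hp n (hcoeffs n A) x = (\<Prod>i<n. x - roots n (hcoeffs n A) i)"
    unfolding hp by (intro prod.cong refl) (simp add: r)
qed

lemma spectral_roots:
  assumes A: "A \<in> carrier_mat n n" "adj A = A"
  shows "\<exists>U\<in>carrier_mat n n. adj U * U = 1\<^sub>m n \<and>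
    adj U * A * U = mat_diag n (\<lambda>i. complex_of_real (roots n (hcoeffs n A) i))"
proof -
  obtain U d where U: "U \<in> carrier_mat n n" "adj U * U = 1\<^sub>m n"
      "adj U * A * U = mat_diag n (\<lambda>i. complex_of_real (d i))"
      "\<And>i j. i \<le> j \<Longrightarrow> j < n \<Longrightarrow> d i \<le> d j"
    using spectral_theorem_sorted[OF A] by blast
  have cp: "char_poly A = (\<Prod>i<n. [:- complex_of_real (d i), 1:])"
    using char_poly_unitary[OF A(1) U(1,2)] unfolding U(3) char_poly_mat_diag by simp
  have hp: "hp n (hcoeffs n A) x = (\<Prod>i<n. x - d i)" for x
  proof -
    have "poly (char_poly A) (complex_of_real x) = complex_of_real (\<Prod>i<n. x - d i)"
      unfolding cp poly_prod of_real_prod by (intro prod.cong refl) simp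
    then show ?thesis unfolding hp_hcoeffs[OF A(1)] by (simp only: Re_complex_of_real)
  qed
  have "roots n (hcoeffs n A) i = d i" if "i < n" for i
    by (rule roots_unique[OF hp U(4) that])
  then have "mat_diag n (\<lambda>i. complex_of_real (d i)) = mat_diag n (\<lambda>i. complex_of_real (roots n (hcoeffs n A) i))"
    by (intro eq_matI) (auto simp: mat_diag_def)
  then show ?thesis using U by auto
qed

definition col_mat :: "nat \<Rightarrow> (nat \<Rightarrow> complex) \<Rightarrow> complex mat" where
  "col_mat n v = Matrix.mat n 1 (\<lambda>(i, _). v i)"

definition bordered :: "nat \<Rightarrow> complex mat \<Rightarrow> (nat \<Rightarrow> complex) \<Rightarrow> real \<Rightarrow> complex mat" where
  "bordered n A v a = four_block_mat A (col_mat n v) (adj (col_mat n v)) (Matrix.mat 1 1 (\<lambda>_. complex_of_real a))"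

lemma col_mat_carrier [simp]: "col_mat n v \<in> carrier_mat n 1"
  by (simp add: col_mat_def)

lemma bordered_carrier: "A \<in> carrier_mat n n \<Longrightarrow> bordered n A v a \<in> carrier_mat (Suc n) (Suc n)"
  unfolding bordered_def using four_block_carrier_mat[of A n n "Matrix.mat 1 1 (\<lambda>_. complex_of_real a)" 1 1] by simp

lemma adj_adj: "adj (adj A) = A"
  by (rule eq_matI) (auto simp: adj_def)

lemma adj_bordered:
  assumes A: "A \<in> carrier_mat n n" "adj A = A"
  shows "adj (bordered n A v a) = bordered n A v a"
proof -
  have c: "adj (Matrix.mat 1 1 (\<lambda>_. complex_of_real a)) = Matrix.mat 1 1 (\<lambda>_. complex_of_real a)"
    by (rule eq_matI) (auto simp: adj_def)
  show ?thesis
    unfolding bordered_def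
    by (subst adj_four_block[OF A(1) col_mat_carrier adj_carrier[OF col_mat_carrier]])
       (simp_all add: A(2) adj_adj c[simplified])
qed

lemma four_block_mult_left:
  fixes P :: "complex mat"
  assumes P: "P \<in> carrier_mat n n" and A: "A \<in> carrier_mat n n" and c: "c \<in> carrier_mat n 1"
    and r: "r \<in> carrier_mat 1 n" and a: "a \<in> carrier_mat 1 1"
  shows "four_block_mat P (0\<^sub>m n 1) (0\<^sub>m 1 n) (1\<^sub>m 1) * four_block_mat A c r a = four_block_mat (P * A) (P * c) r a"
proof -
  have PA: "P * A \<in> carrier_mat n n" "P * c \<in> carrier_mat n 1" using P A c by auto
  show ?thesis
    unfolding mult_four_block_mat[OF P zero_carrier_mat zero_carrier_mat one_carrier_mat A c r a]
    using assms PA by (intro cong_four_block_mat) simp_all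
qed

lemma four_block_mult_right:
  fixes P :: "complex mat"
  assumes P: "P \<in> carrier_mat n n" and A: "A \<in> carrier_mat n n" and c: "c \<in> carrier_mat n 1"
    and r: "r \<in> carrier_mat 1 n" and a: "a \<in> carrier_mat 1 1"
  shows "four_block_mat A c r a * four_block_mat P (0\<^sub>m n 1) (0\<^sub>m 1 n) (1\<^sub>m 1) = four_block_mat (A * P) c (r * P) a"
proof -
  have PA: "A * P \<in> carrier_mat n n" "r * P \<in> carrier_mat 1 n" using P A r by auto
  show ?thesis
    unfolding mult_four_block_mat[OF A c r a P zero_carrier_mat zero_carrier_mat one_carrier_mat]
    using assms PA by (intro cong_four_block_mat) simp_all
qed

text \<open>
  Conjugation with \<open>U\<close>, extended by 1 in the corner.
\<close>
lemma bordered_unitary: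
  assumes A: "A \<in> carrier_mat n n" and U: "U \<in> carrier_mat n n" "adj U * U = 1\<^sub>m n"
  shows "char_poly (bordered n A v a)
    = char_poly (bordered n (adj U * A * U) (\<lambda>i. \<Sum>j<n. cnj (U $$ (j, i)) * v j) a)"
proof -
  let ?a = "Matrix.mat 1 1 (\<lambda>_. complex_of_real a)"
  let ?c = "col_mat n v"
  define W where "W = four_block_mat U (0\<^sub>m n 1) (0\<^sub>m 1 n) (1\<^sub>m 1)"
  have a: "?a \<in> carrier_mat 1 1" by simp
  have c: "?c \<in> carrier_mat n 1" "adj ?c \<in> carrier_mat 1 n" by (rule col_mat_carrier, rule adj_carrier[OF col_mat_carrier])
  have aU: "adj U \<in> carrier_mat n n" using U by simp
  have W: "W \<in> carrier_mat (Suc n) (Suc n)"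
    unfolding W_def using four_block_carrier_mat[OF U(1) one_carrier_mat[of 1]] by simp
  have adjW: "adj W = four_block_mat (adj U) (0\<^sub>m n 1) (0\<^sub>m 1 n) (1\<^sub>m 1)"
    unfolding W_def using adj_four_block[OF U(1) zero_carrier_mat zero_carrier_mat one_carrier_mat] by simp
  have "adj W * W = four_block_mat (adj U * U) (adj U * 0\<^sub>m n 1) (0\<^sub>m 1 n) (1\<^sub>m 1)"
    unfolding adjW unfolding W_def
    by (rule four_block_mult_left[OF aU U(1) zero_carrier_mat zero_carrier_mat one_carrier_mat])
  also have "\<dots> = 1\<^sub>m (Suc n)"
    unfolding U(2) right_mult_zero_mat[OF aU] by (intro eq_matI) auto
  finally have WW: "adj W * W = 1\<^sub>m (Suc n)" .
  have AU: "adj U * A \<in> carrier_mat n n" "adj U * ?c \<in> carrier_mat n 1" using aU A c by (meson mult_carrier_mat)+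
  have AUU: "adj U * A * U \<in> carrier_mat n n" using AU U(1) by (meson mult_carrier_mat)
  have cU: "adj ?c * U \<in> carrier_mat 1 n" using c U(1) by (meson mult_carrier_mat)
  have 1: "adj W * bordered n A v a = four_block_mat (adj U * A) (adj U * ?c) (adj ?c) ?a"
    unfolding adjW bordered_def by (rule four_block_mult_left[OF aU A c a])
  have "adj W * bordered n A v a * W = four_block_mat (adj U * A * U) (adj U * ?c) (adj ?c * U) ?a"
    unfolding 1 unfolding W_def by (rule four_block_mult_right[OF U(1) AU c(2) a])
  also have "adj U * ?c = col_mat n (\<lambda>i. \<Sum>j<n. cnj (U $$ (j, i)) * v j)" (is "_ = ?w")
  proof (rule eq_matI)
    fix i j assume "i < dim_row ?w" "j < dim_col ?w"
    then have ij: "i < n" "j < 1" by (auto simp: col_mat_def)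
    show "(adj U * ?c) $$ (i, j) = ?w $$ (i, j)"
      unfolding mat_mult_entry[OF aU c(1) ij] using ij
      by (simp add: col_mat_def adj_entry[OF U(1)])
  qed (use aU in \<open>auto simp: col_mat_def\<close>)
  also have "adj ?c * U = adj ?w"
  proof -
    have "adj (adj U * ?c) = adj ?c * adj (adj U)" by (rule adj_mult[OF aU c(1)])
    then show ?thesis unfolding \<open>adj U * ?c = ?w\<close> adj_adj by simp
  qed
  finally have eq: "adj W * bordered n A v a * W = bordered n (adj U * A * U) (\<lambda>i. \<Sum>j<n. cnj (U $$ (j, i)) * v j) a"
    unfolding bordered_def .
  from char_poly_unitary[OF bordered_carrier[OF A] W WW, of v a] show ?thesis
    unfolding eq by (rule sym)
qed

text \<open>
  Subtracting the Schur complement: if \<open>x\<close> is no diagonal entry, a column operation clears the border,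
  leaving a triangular matrix whose corner is \<open>x - a - (\<Sum>j. |v j|\<^sup>2 / (x - mu j))\<close>.
\<close>
lemma char_poly_arrow_off:
  assumes x: "\<And>j. j < n \<Longrightarrow> x \<noteq> mu j"
  shows "poly (char_poly (bordered n (mat_diag n (\<lambda>i. complex_of_real (mu i))) v a)) (complex_of_real x)
    = complex_of_real (arrow_poly n mu a (\<lambda>j. (cmod (v j))\<^sup>2) x)"
proof -
  let ?X = "complex_of_real x" and ?M = "\<lambda>i. complex_of_real (mu i)"
  let ?B = "bordered n (mat_diag n ?M) v a"
  define D where "D = mat_diag n (\<lambda>i. ?X - ?M i)"
  define c where "c = col_mat n (\<lambda>i. - v i)"
  define w where "w = col_mat n (\<lambda>i. v i / (?X - ?M i))"
  define z where "z = Matrix.mat 1 1 (\<lambda>_. ?X - complex_of_real a)"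
  define L where "L = (\<Sum>j<n. cnj (v j) * v j / (?X - ?M j))"
  have ne: "?X - ?M i \<noteq> 0" if "i < n" for i using x[OF that] by simp
  have car: "D \<in> carrier_mat n n" "c \<in> carrier_mat n 1" "adj c \<in> carrier_mat 1 n" "w \<in> carrier_mat n 1" "z \<in> carrier_mat 1 1"
    unfolding D_def c_def w_def z_def
    by (rule mat_diag_dim, rule col_mat_carrier, rule adj_carrier[OF col_mat_carrier], rule col_mat_carrier, rule mat_carrier)
  have B: "?B \<in> carrier_mat (Suc n) (Suc n)" by (rule bordered_carrier) simp
  have X: "- (char_matrix ?B ?X) = four_block_mat D c (adj c) z" (is "_ = ?R")
  proof (rule eq_matI)
    have Rc: "?R \<in> carrier_mat (Suc n) (Suc n)" using four_block_carrier_mat[OF car(1,5)] by simp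
    show "dim_row (- (char_matrix ?B ?X)) = dim_row ?R" "dim_col (- (char_matrix ?B ?X)) = dim_col ?R"
      using B Rc by (auto simp: char_matrix_def)
    fix i j assume "i < dim_row ?R" "j < dim_col ?R"
    then have ij: "i < Suc n" "j < Suc n" using Rc by auto
    show "(- (char_matrix ?B ?X)) $$ (i, j) = ?R $$ (i, j)"
      using ij B car
      by (auto simp: char_matrix_def bordered_def D_def c_def z_def mat_diag_def col_mat_def adj_def)
  qed
  \<comment> \<open>Multiplication by \<open>T\<close> from the right adds the combination \<open>w\<close> of the first columns to the last one and clears it above
    the corner.\<close>
  define T where "T = four_block_mat (1\<^sub>m n) w (0\<^sub>m 1 n) (1\<^sub>m 1)"
  have Dw: "D * w + c * 1\<^sub>m 1 = 0\<^sub>m n 1"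
  proof (rule eq_matI)
    fix i j assume "i < dim_row (0\<^sub>m n 1 :: complex mat)" "j < dim_col (0\<^sub>m n 1 :: complex mat)"
    then have ij: "i < n" "j < 1" by auto
    have "(D * w) $$ (i, j) = (\<Sum>k<n. D $$ (i, k) * w $$ (k, j))" by (rule mat_mult_entry[OF car(1,4) ij])
    also have "\<dots> = (\<Sum>k<n. if k = i then v i else 0)"
      using ij ne by (intro sum.cong refl) (auto simp: D_def w_def mat_diag_def col_mat_def)
    also have "\<dots> = v i" using ij by simp
    finally show "(D * w + c * 1\<^sub>m 1) $$ (i, j) = 0\<^sub>m n 1 $$ (i, j)"
      using ij car by (simp add: c_def col_mat_def)
  qed (use car in auto)
  have cw: "adj c * w + z * 1\<^sub>m 1 = Matrix.mat 1 1 (\<lambda>_. ?X - complex_of_real a - L)"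
  proof (rule eq_matI)
    fix i j assume "i < dim_row (Matrix.mat 1 1 (\<lambda>_. ?X - complex_of_real a - L))"
      "j < dim_col (Matrix.mat 1 1 (\<lambda>_. ?X - complex_of_real a - L))"
    then have ij: "i < 1" "j < 1" by auto
    have "(adj c * w) $$ (i, j) = (\<Sum>k<n. adj c $$ (i, k) * w $$ (k, j))" by (rule mat_mult_entry[OF car(3,4) ij])
    also have "\<dots> = - L"
      unfolding L_def sum_negf[symmetric] using ij
      by (intro sum.cong refl) (auto simp: c_def w_def col_mat_def adj_def)
    finally have "(adj c * w) $$ (i, j) = - L" .
    moreover have "(adj c * w + z * 1\<^sub>m 1) $$ (i, j) = (adj c * w) $$ (i, j) + z $$ (i, j)"
      unfolding right_mult_one_mat[OF car(5)] by (rule index_add_mat(1)) (use ij car in auto)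
    moreover have "z $$ (i, j) = ?X - complex_of_real a" using ij by (simp add: z_def)
    ultimately show "(adj c * w + z * 1\<^sub>m 1) $$ (i, j) = Matrix.mat 1 1 (\<lambda>_. ?X - complex_of_real a - L) $$ (i, j)"
      using ij by simp
  qed (use car in auto)
  have "four_block_mat D c (adj c) z * T
    = four_block_mat (D * 1\<^sub>m n + c * 0\<^sub>m 1 n) (D * w + c * 1\<^sub>m 1) (adj c * 1\<^sub>m n + z * 0\<^sub>m 1 n) (adj c * w + z * 1\<^sub>m 1)"
    unfolding T_def
    by (rule mult_four_block_mat[OF car(1) car(2) car(3) car(5) one_carrier_mat car(4) zero_carrier_mat one_carrier_mat])
  also have "\<dots> = four_block_mat D (0\<^sub>m n 1) (adj c) (Matrix.mat 1 1 (\<lambda>_. ?X - complex_of_real a - L))"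
    unfolding Dw cw using car(1) car(2) car(5) right_mult_one_mat[OF car(3)] right_add_zero_mat[OF car(3)]
    by (intro cong_four_block_mat) simp_all
  finally have prod: "four_block_mat D c (adj c) z * T
    = four_block_mat D (0\<^sub>m n 1) (adj c) (Matrix.mat 1 1 (\<lambda>_. ?X - complex_of_real a - L))" .
  have detT: "Determinant.det T = 1"
    unfolding T_def using det_four_block_mat_lower_left_zero[OF one_carrier_mat car(4) refl one_carrier_mat] by simp
  have Rc: "four_block_mat D c (adj c) z \<in> carrier_mat (Suc n) (Suc n)" using four_block_carrier_mat[OF car(1,5)] by simp
  have Tc: "T \<in> carrier_mat (Suc n) (Suc n)"
    unfolding T_def using four_block_carrier_mat[OF one_carrier_mat[of n] one_carrier_mat[of 1]] by simp
  have "Determinant.det (four_block_mat D c (adj c) z) = Determinant.det (four_block_mat D c (adj c) z * T)"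
    unfolding det_mult[OF Rc Tc] detT by simp
  also have "\<dots> = Determinant.det D * Determinant.det (Matrix.mat 1 1 (\<lambda>_. ?X - complex_of_real a - L))"
    unfolding prod by (rule det_four_block_mat_upper_right_zero[OF car(1) refl car(3)]) simp
  also have "Determinant.det D = (\<Prod>i<n. ?X - ?M i)"
  proof -
    have "Determinant.det D = prod_list (diag_mat D)"
      by (rule det_upper_triangular[OF _ car(1)]) (auto simp: D_def mat_diag_def)
    also have "diag_mat D = map (\<lambda>i. ?X - ?M i) [0..<n]" by (simp add: diag_mat_def D_def mat_diag_def)
    also have "prod_list \<dots> = (\<Prod>i<n. ?X - ?M i)" by (induction n) simp_all
    finally show ?thesis .
  qed
  also have "Determinant.det (Matrix.mat 1 1 (\<lambda>_. ?X - complex_of_real a - L)) = ?X - complex_of_real a - L"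
    by (subst det_single) simp_all
  finally have "poly (char_poly ?B) ?X = (\<Prod>i<n. ?X - ?M i) * (?X - complex_of_real a - L)"
    unfolding char_poly_matrix[OF B] X .
  moreover have "L = complex_of_real (\<Sum>j<n. (cmod (v j))\<^sup>2 / (x - mu j))"
    unfolding L_def of_real_sum
    by (intro sum.cong refl) (simp add: complex_norm_square mult.commute del: of_real_power)
  moreover have off: "arrow_poly n mu a (\<lambda>j. (cmod (v j))\<^sup>2) x
    = (\<Prod>j<n. x - mu j) * (x - a - (\<Sum>j<n. (cmod (v j))\<^sup>2 / (x - mu j)))"
    by (rule arrow_poly_off_poles) (rule x)
  ultimately show ?thesis
    unfolding off by simp
qed

lemma isCont_eq_off_finite:
  fixes f g :: "real \<Rightarrow> real"
  assumes c: "\<And>x. isCont f x" "\<And>x. isCont g x" and S: "finite S" and eq: "\<And>x. x \<notin> S \<Longrightarrow> f x = g x"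
  shows "f x = g x"
proof -
  have "open (- (S - {x}))" using S by (intro open_Compl finite_imp_closed) simp
  then have ev: "\<forall>\<^sub>F y in at x. y \<notin> S"
    unfolding eventually_at_topological by (intro exI[of _ "- (S - {x})"]) auto
  have "(f \<longlongrightarrow> f x) (at x)" using c(1) by (simp add: isCont_def)
  moreover have "(f \<longlongrightarrow> g x) (at x)"
  proof (rule Lim_transform_eventually)
    show "(g \<longlongrightarrow> g x) (at x)" using c(2) by (simp add: isCont_def)
    show "\<forall>\<^sub>F y in at x. g y = f y" using ev by eventually_elim (simp add: eq)
  qed
  ultimately show ?thesis by (intro tendsto_unique[of "at x"]) auto
qed

text \<open>
  The spectrum of a bordered matrix depends on the old spectrum, on the corner, and on the squared moduli of the border
  in an eigenbasis of the old matrix. The two polynomials agree off the finitely many \<open>mu j\<close>, hence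
  everywhere by continuity, so multiple eigenvalues are covered as well.
\<close>
theorem roots_bordered:
  assumes A: "A \<in> carrier_mat n n" "adj A = A" and U: "U \<in> carrier_mat n n" "adj U * U = 1\<^sub>m n"
    and diag: "adj U * A * U = mat_diag n (\<lambda>i. complex_of_real (mu i))"
  shows "roots (Suc n) (hcoeffs (Suc n) (bordered n A v a))
    = roots (Suc n) (arrow_coeffs n mu a (\<lambda>i. (cmod (\<Sum>j<n. cnj (U $$ (j, i)) * v j))\<^sup>2))"
proof -
  let ?B = "bordered n A v a"
  define v' where "v' i = (\<Sum>j<n. cnj (U $$ (j, i)) * v j)" for i
  let ?c = "arrow_coeffs n mu a (\<lambda>i. (cmod (v' i))\<^sup>2)"
  have B: "?B \<in> carrier_mat (Suc n) (Suc n)" "adj ?B = ?B"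
    by (rule bordered_carrier[OF A(1)], rule adj_bordered[OF A])
  note H = char_poly_hermitian[OF B]
  let ?r = "roots (Suc n) (hcoeffs (Suc n) ?B)"
  have cp: "char_poly ?B = char_poly (bordered n (mat_diag n (\<lambda>i. complex_of_real (mu i))) v' a)"
    using bordered_unitary[OF A(1) U, of v a] unfolding diag v'_def .
  have hp: "hp (Suc n) (hcoeffs (Suc n) ?B) x = hp (Suc n) ?c x" for x
  proof (rule isCont_eq_off_finite[where f = "hp (Suc n) (hcoeffs (Suc n) ?B)" and g = "hp (Suc n) ?c" and S = "mu ` {..<n}"])
    fix x assume "x \<notin> mu ` {..<n}"
    then have ne: "\<And>j. j < n \<Longrightarrow> x \<noteq> mu j" by auto
    have "poly (char_poly (bordered n (mat_diag n (\<lambda>i. complex_of_real (mu i))) v' a)) (complex_of_real x)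
      = complex_of_real (arrow_poly n mu a (\<lambda>j. (cmod (v' j))\<^sup>2) x)"
      by (rule char_poly_arrow_off) (rule ne)
    then show "hp (Suc n) (hcoeffs (Suc n) ?B) x = hp (Suc n) ?c x"
      unfolding hp_hcoeffs[OF B(1)] hp_arrow_coeffs cp
      by (simp only: Re_complex_of_real)
  qed (rule isCont_hp isCont_hp finite_imageI finite_lessThan)+
  have "roots (Suc n) ?c k = ?r k" if "k < Suc n" for k
  proof (rule roots_unique[OF _ H(2) that])
    fix x show "hp (Suc n) ?c x = (\<Prod>k<Suc n. x - ?r k)"
      unfolding hp[symmetric] by (rule H(3))
  qed
  then have "?r = roots (Suc n) ?c"
    by (intro extensionalityI[OF roots_extensional roots_extensional]) (simp del: roots.simps arrow_coeffs.simps)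
  then show ?thesis unfolding v'_def .
qed

section \<open>Isometries and polar coordinates\<close>

lemma emeasure_lborel_isometry:
  fixes A :: "real set"
  assumes [measurable]: "A \<in> sets borel" and c: "\<bar>c\<bar> = 1"
  shows "emeasure lborel {x. t + c * x \<in> A} = emeasure lborel A"
proof -
  have "c \<noteq> 0" using c by auto
  have [measurable]: "{x. t + c * x \<in> A} \<in> sets borel"
    using measurable_sets[of "\<lambda>x. t + c * x" borel borel A] by (simp add: vimage_def)
  have "emeasure lborel A = (\<integral>\<^sup>+y. indicator A y \<partial>lborel)" by simp
  also have "\<dots> = ennreal \<bar>c\<bar> * (\<integral>\<^sup>+x. indicator A (t + c * x) \<partial>lborel)"
    by (rule nn_integral_real_affine) (use \<open>c \<noteq> 0\<close> in auto)
  also have "(\<lambda>x. indicator A (t + c * x)) = (indicator {x. t + c * x \<in> A} :: real \<Rightarrow> ennreal)"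
    by (auto simp: indicator_def)
  finally show ?thesis using c by simp
qed

text \<open>
  The only affine maps used are translations, and point reflections in the translates.
\<close>
lemma nn_integral_lborel_on_affine:
  fixes t :: "'i \<Rightarrow> real"
  assumes I: "finite I" and c: "\<bar>c\<bar> = 1" and g: "g \<in> borel_measurable (lborel_on I)"
  shows "(\<integral>\<^sup>+y. g (\<lambda>i\<in>I. t i + c * y i) \<partial>lborel_on I) = (\<integral>\<^sup>+y. g y \<partial>lborel_on I)"
proof -
  let ?f = "\<lambda>y. \<lambda>i\<in>I. t i + c * y i"
  have f: "?f \<in> measurable (lborel_on I) (lborel_on I)"
  proof (rule measurable_restrict)
    fix i assume "i \<in> I"
    then have [measurable]: "(\<lambda>y. y i) \<in> borel_measurable (lborel_on I)"
      using measurable_component_singleton[of i I "\<lambda>_. lborel"] by simp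
    show "(\<lambda>y. t i + c * y i) \<in> measurable (lborel_on I) lborel" by simp
  qed
  have "distr (lborel_on I) (lborel_on I) ?f = lborel_on I"
  proof (rule lborel_prod.PiM_eqI[OF I])
    fix A :: "'i \<Rightarrow> real set" assume A: "\<And>i. i \<in> I \<Longrightarrow> A i \<in> sets lborel"
    have B: "{x. t i + c * x \<in> A i} \<in> sets lborel" if "i \<in> I" for i
      using measurable_sets[of "\<lambda>x. t i + c * x" borel borel "A i"] A[OF that] by (simp add: vimage_def)
    have "emeasure (distr (lborel_on I) (lborel_on I) ?f) (Pi\<^sub>E I A)
      = emeasure (lborel_on I) (?f -` Pi\<^sub>E I A \<inter> space (lborel_on I))"
      by (rule emeasure_distr[OF f]) (use A I in \<open>auto intro: sets_PiM_I_finite\<close>)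
    also have "?f -` Pi\<^sub>E I A \<inter> space (lborel_on I) = Pi\<^sub>E I (\<lambda>i. {x. t i + c * x \<in> A i})"
      by (auto simp: space_PiM PiE_def Pi_def)
    also have "emeasure (lborel_on I) \<dots> = (\<Prod>i\<in>I. emeasure lborel {x. t i + c * x \<in> A i})"
      by (rule lborel_prod.emeasure_PiM[OF I B])
    also have "\<dots> = (\<Prod>i\<in>I. emeasure lborel (A i))"
      by (intro prod.cong refl emeasure_lborel_isometry c) (use A in auto)
    finally show "emeasure (distr (lborel_on I) (lborel_on I) ?f) (Pi\<^sub>E I A) = (\<Prod>i\<in>I. emeasure lborel (A i))" .
  qed simp
  then have "(\<integral>\<^sup>+y. g y \<partial>lborel_on I) = (\<integral>\<^sup>+y. g y \<partial>distr (lborel_on I) (lborel_on I) ?f)" by simp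
  also have "\<dots> = (\<integral>\<^sup>+y. g (?f y) \<partial>lborel_on I)"
    by (rule nn_integral_distr[OF f]) (use g in simp)
  finally show ?thesis by (rule sym)
qed

lemma measurable_lborel_on_component:
  "i \<in> I \<Longrightarrow> (\<lambda>y. y i) \<in> borel_measurable (lborel_on I)"
  using measurable_component_singleton[of i I "\<lambda>_. lborel"] by simp

text \<open>
  A radial weight whose integral is positive and finite, so that it can be cancelled from an equation.
\<close>
definition unit_ball_ind :: "'i set \<Rightarrow> ('i \<Rightarrow> real) \<Rightarrow> ennreal" where
  "unit_ball_ind I x = indicator {x. (\<Sum>i\<in>I. (x i)\<^sup>2) \<le> 1} x"

lemma measurable_unit_ball_ind:
  assumes "\<And>i. i \<in> I \<Longrightarrow> (\<lambda>w. x w i) \<in> borel_measurable M"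
  shows "(\<lambda>w. unit_ball_ind I (x w)) \<in> borel_measurable M"
proof -
  have [measurable]: "(\<lambda>w. \<Sum>i\<in>I. (x w i)\<^sup>2) \<in> borel_measurable M"
    using assms by (intro borel_measurable_sum borel_measurable_power)
  have "(\<lambda>w. unit_ball_ind I (x w)) = (\<lambda>w. if (\<Sum>i\<in>I. (x w i)\<^sup>2) \<le> 1 then 1 else 0)"
    by (simp add: unit_ball_ind_def indicator_def fun_eq_iff)
  then show ?thesis by simp
qed

lemma nn_integral_unit_ball:
  assumes I: "finite I"
  shows "(\<integral>\<^sup>+x. unit_ball_ind I x \<partial>lborel_on I) \<noteq> 0" "(\<integral>\<^sup>+x. unit_ball_ind I x \<partial>lborel_on I) \<noteq> \<infinity>"
proof -
  define d where "d = 1 / (1 + real (card I))"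
  have d: "0 < d" "d \<le> 1" "real (card I) * d \<le> 1" by (auto simp: d_def field_simps)
  let ?lo = "Pi\<^sub>E I (\<lambda>_. {-d..d})" and ?hi = "Pi\<^sub>E I (\<lambda>_. {-1..1::real})"
  have [measurable]: "?lo \<in> sets (lborel_on I)" "?hi \<in> sets (lborel_on I)"
    using I by (auto intro: sets_PiM_I_finite)
  have "emeasure (lborel_on I) ?lo = (\<Prod>i\<in>I. emeasure lborel {-d..d})"
    by (rule lborel_prod.emeasure_PiM[OF I]) simp
  also have "\<dots> = ennreal (2 * d) ^ card I" using d by simp
  finally have lo: "emeasure (lborel_on I) ?lo \<noteq> 0" using d by simp
  have "emeasure (lborel_on I) ?hi = (\<Prod>i\<in>I. emeasure lborel {-1..1::real})"
    by (rule lborel_prod.emeasure_PiM[OF I]) simp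
  also have "\<dots> = 2 ^ card I" by simp
  also have "\<dots> < \<infinity>" by (simp add: power_less_top_ennreal)
  finally have hi: "emeasure (lborel_on I) ?hi \<noteq> \<infinity>" by simp
  have "emeasure (lborel_on I) ?lo \<le> (\<integral>\<^sup>+x. unit_ball_ind I x \<partial>lborel_on I)"
  proof -
    have "indicator ?lo x \<le> unit_ball_ind I x" for x :: "'a \<Rightarrow> real"
    proof (cases "x \<in> ?lo")
      case True
      have "(\<Sum>i\<in>I. (x i)\<^sup>2) \<le> (\<Sum>i\<in>I. d)"
      proof (rule sum_mono)
        fix i assume "i \<in> I"
        then have "\<bar>x i\<bar> \<le> d" using True by (auto simp: PiE_def Pi_def abs_le_iff)
        then have "(x i)\<^sup>2 \<le> d\<^sup>2" using d by (simp add: abs_le_square_iff[symmetric])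
        also have "\<dots> \<le> d" using d by (simp add: power2_eq_square mult_left_le)
        finally show "(x i)\<^sup>2 \<le> d" .
      qed
      then show ?thesis using d True by (simp add: unit_ball_ind_def)
    qed simp
    then have "(\<integral>\<^sup>+x. indicator ?lo x \<partial>lborel_on I) \<le> (\<integral>\<^sup>+x. unit_ball_ind I x \<partial>lborel_on I)"
      by (intro nn_integral_mono) auto
    then show ?thesis by simp
  qed
  then show "(\<integral>\<^sup>+x. unit_ball_ind I x \<partial>lborel_on I) \<noteq> 0" using lo by auto
  have "(\<integral>\<^sup>+x. unit_ball_ind I x \<partial>lborel_on I) \<le> (\<integral>\<^sup>+x. indicator ?hi x \<partial>lborel_on I)"
  proof (rule nn_integral_mono)
    fix x :: "'a \<Rightarrow> real" assume x: "x \<in> space (lborel_on I)"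
    show "unit_ball_ind I x \<le> indicator ?hi x"
    proof (cases "(\<Sum>i\<in>I. (x i)\<^sup>2) \<le> 1")
      case True
      have "\<bar>x i\<bar> \<le> 1" if i: "i \<in> I" for i
      proof -
        have "(x i)\<^sup>2 \<le> (\<Sum>i\<in>I. (x i)\<^sup>2)" using i I by (intro member_le_sum) auto
        then have "(x i)\<^sup>2 \<le> 1" using True by linarith
        then show ?thesis by (simp only: abs_square_le_1)
      qed
      then have "x \<in> ?hi" using x by (auto simp: space_PiM PiE_def abs_le_iff)
      then show ?thesis by (simp add: unit_ball_ind_def indicator_def)
    qed (simp add: unit_ball_ind_def)
  qed
  also have "\<dots> = emeasure (lborel_on I) ?hi" by simp
  finally show "(\<integral>\<^sup>+x. unit_ball_ind I x \<partial>lborel_on I) \<noteq> \<infinity>" using hi by (auto simp: top_unique)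
qed

text \<open>
  The proof avoids determinants. For a radial weight \<open>w\<close> with integral \<open>Z\<close>, translation invariance gives
  \<open>Z * \<integral> g (T y) = \<integral>\<integral> w x * g (T y + x) = \<integral>\<integral> w (x - T y) * g x\<close>, and \<open>w (x - T y) = w (S x - y)\<close>
  since \<open>T\<close> is an isometry with right inverse \<open>S\<close>. The integral over \<open>y\<close> is then \<open>Z\<close>, whatever \<open>x\<close> is.
\<close>
theorem nn_integral_isometry:
  fixes T S :: "('i \<Rightarrow> real) \<Rightarrow> 'i \<Rightarrow> real"
  assumes I: "finite I"
    and T: "T \<in> measurable (lborel_on I) (lborel_on I)"
    and add: "\<And>x y. x \<in> extensional I \<Longrightarrow> y \<in> extensional I \<Longrightarrow>
      T (\<lambda>i\<in>I. x i + y i) = (\<lambda>i\<in>I. T x i + T y i)"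
    and iso: "\<And>x. x \<in> extensional I \<Longrightarrow> (\<Sum>i\<in>I. (T x i)\<^sup>2) = (\<Sum>i\<in>I. (x i)\<^sup>2)"
    and S: "\<And>x. x \<in> extensional I \<Longrightarrow> S x \<in> extensional I" "\<And>x. x \<in> extensional I \<Longrightarrow> T (S x) = x"
    and g: "g \<in> borel_measurable (lborel_on I)"
  shows "(\<integral>\<^sup>+y. g (T y) \<partial>lborel_on I) = (\<integral>\<^sup>+y. g y \<partial>lborel_on I)"
proof -
  interpret sf: sigma_finite_measure "lborel_on I" by (rule sigma_finite_lborel_on[OF I])
  interpret pf: pair_sigma_finite "lborel_on I" "lborel_on I" ..
  let ?w = "unit_ball_ind I"
  let ?Z = "\<integral>\<^sup>+x. ?w x \<partial>lborel_on I"
  have ext: "x \<in> extensional I" if "x \<in> space (lborel_on I)" for x :: "'i \<Rightarrow> real"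
    using that by (simp add: space_PiM PiE_def)
  have sp: "x \<in> space (lborel_on I)" if "x \<in> extensional I" for x :: "'i \<Rightarrow> real"
    using that by (simp add: space_PiM PiE_def)
  have comp: "(\<lambda>y. y i) \<in> borel_measurable (lborel_on I)" if "i \<in> I" for i
    using that by (rule measurable_lborel_on_component)
  have Tcomp: "(\<lambda>y. T y i) \<in> borel_measurable (lborel_on I)" if "i \<in> I" for i
    by (rule measurable_compose[OF T comp[OF that]])
  have Text: "T y \<in> extensional I" if "y \<in> extensional I" for y
    using ext[OF measurable_space[OF T sp[OF that]]] .
  have wm: "?w \<in> borel_measurable (lborel_on I)" by (rule measurable_unit_ball_ind) (rule comp)
  have gT: "(\<lambda>y. g (T y)) \<in> borel_measurable (lborel_on I)" by (rule measurable_compose[OF T g])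
  have restr: "(\<lambda>w. \<lambda>i\<in>I. f w i) \<in> measurable M (lborel_on I)"
    if "\<And>i. i \<in> I \<Longrightarrow> (\<lambda>w. f w i) \<in> borel_measurable M" for f :: "'b \<Rightarrow> 'i \<Rightarrow> real" and M
    by (rule measurable_restrict) (use that in simp)
  have p1: "(\<lambda>p. g (\<lambda>i\<in>I. T (snd p) i + fst p i)) \<in> borel_measurable (lborel_on I \<Otimes>\<^sub>M lborel_on I)"
    by (intro measurable_compose[OF restr g] borel_measurable_add
        measurable_compose[OF measurable_snd Tcomp] measurable_compose[OF measurable_fst comp])
  have pw1: "(\<lambda>p. ?w (fst p)) \<in> borel_measurable (lborel_on I \<Otimes>\<^sub>M lborel_on I)"
    by (rule measurable_compose[OF measurable_fst wm])
  have p2: "(\<lambda>p. ?w (\<lambda>i\<in>I. fst p i - T (snd p) i)) \<in> borel_measurable (lborel_on I \<Otimes>\<^sub>M lborel_on I)"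
    by (intro measurable_compose[OF restr wm] borel_measurable_diff
        measurable_compose[OF measurable_snd Tcomp] measurable_compose[OF measurable_fst comp])
  have pg: "(\<lambda>p. g (fst p)) \<in> borel_measurable (lborel_on I \<Otimes>\<^sub>M lborel_on I)"
    by (rule measurable_compose[OF measurable_fst g])
  have "?Z * (\<integral>\<^sup>+y. g (T y) \<partial>lborel_on I) = (\<integral>\<^sup>+x. ?w x * (\<integral>\<^sup>+y. g (T y) \<partial>lborel_on I) \<partial>lborel_on I)"
    by (rule nn_integral_multc[OF wm, symmetric])
  also have "\<dots> = (\<integral>\<^sup>+x. \<integral>\<^sup>+y. ?w x * g (\<lambda>i\<in>I. T y i + x i) \<partial>lborel_on I \<partial>lborel_on I)"
  proof (rule nn_integral_cong)
    fix x assume "x \<in> space (lborel_on I)"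
    then have x: "x \<in> extensional I" by (rule ext)
    have "(\<integral>\<^sup>+y. g (T y) \<partial>lborel_on I) = (\<integral>\<^sup>+y. g (T (\<lambda>i\<in>I. S x i + 1 * y i)) \<partial>lborel_on I)"
      by (rule nn_integral_lborel_on_affine[OF I _ gT, symmetric]) simp
    also have "\<dots> = (\<integral>\<^sup>+y. g (\<lambda>i\<in>I. T y i + x i) \<partial>lborel_on I)"
    proof (rule nn_integral_cong)
      fix y assume "y \<in> space (lborel_on I)"
      then have y: "y \<in> extensional I" by (rule ext)
      have "T (\<lambda>i\<in>I. S x i + y i) = (\<lambda>i\<in>I. T (S x) i + T y i)" by (rule add[OF S(1)[OF x] y])
      then show "g (T (\<lambda>i\<in>I. S x i + 1 * y i)) = g (\<lambda>i\<in>I. T y i + x i)"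
        unfolding S(2)[OF x] by (simp add: add.commute)
    qed
    finally have "(\<integral>\<^sup>+y. g (T y) \<partial>lborel_on I) = (\<integral>\<^sup>+y. g (\<lambda>i\<in>I. T y i + x i) \<partial>lborel_on I)" .
    moreover have "(\<integral>\<^sup>+y. ?w x * g (\<lambda>i\<in>I. T y i + x i) \<partial>lborel_on I) = ?w x * (\<integral>\<^sup>+y. g (\<lambda>i\<in>I. T y i + x i) \<partial>lborel_on I)"
    proof (rule nn_integral_cmult)
      show "(\<lambda>y. g (\<lambda>i\<in>I. T y i + x i)) \<in> borel_measurable (lborel_on I)"
        by (intro measurable_compose[OF restr g] borel_measurable_add Tcomp borel_measurable_const)
    qed
    ultimately show "?w x * (\<integral>\<^sup>+y. g (T y) \<partial>lborel_on I) = (\<integral>\<^sup>+y. ?w x * g (\<lambda>i\<in>I. T y i + x i) \<partial>lborel_on I)"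
      by simp
  qed
  also have "\<dots> = (\<integral>\<^sup>+y. \<integral>\<^sup>+x. ?w x * g (\<lambda>i\<in>I. T y i + x i) \<partial>lborel_on I \<partial>lborel_on I)"
    by (rule pf.Fubini'[symmetric]) (use borel_measurable_times_ennreal[OF pw1 p1] in \<open>simp only: case_prod_beta'\<close>)
  also have "\<dots> = (\<integral>\<^sup>+y. \<integral>\<^sup>+x. ?w (\<lambda>i\<in>I. x i - T y i) * g x \<partial>lborel_on I \<partial>lborel_on I)"
  proof (rule nn_integral_cong)
    fix y assume "y \<in> space (lborel_on I)"
    have m: "(\<lambda>x. ?w (\<lambda>i\<in>I. x i - T y i) * g x) \<in> borel_measurable (lborel_on I)"
      by (intro borel_measurable_times_ennreal g measurable_compose[OF restr wm] borel_measurable_diff comp borel_measurable_const)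
    have "(\<integral>\<^sup>+x. ?w (\<lambda>i\<in>I. x i - T y i) * g x \<partial>lborel_on I)
      = (\<integral>\<^sup>+x. ?w (\<lambda>i\<in>I. (\<lambda>i\<in>I. T y i + 1 * x i) i - T y i) * g (\<lambda>i\<in>I. T y i + 1 * x i) \<partial>lborel_on I)"
      by (rule nn_integral_lborel_on_affine[OF I _ m, symmetric]) simp
    also have "\<dots> = (\<integral>\<^sup>+x. ?w x * g (\<lambda>i\<in>I. T y i + x i) \<partial>lborel_on I)"
    proof (rule nn_integral_cong)
      fix x assume "x \<in> space (lborel_on I)"
      then have x: "x \<in> extensional I" by (rule ext)
      have "(\<lambda>i\<in>I. (\<lambda>i\<in>I. T y i + 1 * x i) i - T y i) = x"
      proof
        fix i show "(\<lambda>i\<in>I. (\<lambda>i\<in>I. T y i + 1 * x i) i - T y i) i = x i"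
          using extensional_arb[OF x, of i] by (cases "i \<in> I") simp_all
      qed
      then show "?w (\<lambda>i\<in>I. (\<lambda>i\<in>I. T y i + 1 * x i) i - T y i) * g (\<lambda>i\<in>I. T y i + 1 * x i) = ?w x * g (\<lambda>i\<in>I. T y i + x i)"
        by simp
    qed
    finally show "(\<integral>\<^sup>+x. ?w x * g (\<lambda>i\<in>I. T y i + x i) \<partial>lborel_on I) = (\<integral>\<^sup>+x. ?w (\<lambda>i\<in>I. x i - T y i) * g x \<partial>lborel_on I)"
      by (rule sym)
  qed
  also have "\<dots> = (\<integral>\<^sup>+x. \<integral>\<^sup>+y. ?w (\<lambda>i\<in>I. x i - T y i) * g x \<partial>lborel_on I \<partial>lborel_on I)"
    by (rule pf.Fubini') (use borel_measurable_times_ennreal[OF p2 pg] in \<open>simp only: case_prod_beta'\<close>)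
  also have "\<dots> = (\<integral>\<^sup>+x. ?Z * g x \<partial>lborel_on I)"
  proof (rule nn_integral_cong)
    fix x assume "x \<in> space (lborel_on I)"
    then have x: "x \<in> extensional I" by (rule ext)
    have "(\<integral>\<^sup>+y. ?w (\<lambda>i\<in>I. x i - T y i) * g x \<partial>lborel_on I) = (\<integral>\<^sup>+y. ?w (\<lambda>i\<in>I. x i - T y i) \<partial>lborel_on I) * g x"
      by (intro nn_integral_multc measurable_compose[OF restr wm] borel_measurable_diff Tcomp borel_measurable_const)
    also have "(\<integral>\<^sup>+y. ?w (\<lambda>i\<in>I. x i - T y i) \<partial>lborel_on I) = (\<integral>\<^sup>+y. ?w (\<lambda>i\<in>I. S x i + (- 1) * y i) \<partial>lborel_on I)"
    proof (rule nn_integral_cong)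
      fix y assume "y \<in> space (lborel_on I)"
      then have y: "y \<in> extensional I" by (rule ext)
      define z where "z = (\<lambda>i\<in>I. S x i - y i)"
      have z: "z \<in> extensional I" by (simp add: z_def)
      have "(\<lambda>i\<in>I. z i + y i) = S x"
        using S(1)[OF x] by (auto simp: z_def fun_eq_iff extensional_def)
      then have "x = (\<lambda>i\<in>I. T z i + T y i)" using add[OF z y] S(2)[OF x] by simp
      then have "(\<lambda>i\<in>I. x i - T y i) = T z"
        using Text[OF z] by (auto simp: fun_eq_iff extensional_def)
      then have "?w (\<lambda>i\<in>I. x i - T y i) = ?w z"
        using iso[OF z] by (simp add: unit_ball_ind_def indicator_def)
      then show "?w (\<lambda>i\<in>I. x i - T y i) = ?w (\<lambda>i\<in>I. S x i + (- 1) * y i)" by (simp add: z_def)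
    qed
    also have "\<dots> = ?Z"
      by (rule nn_integral_lborel_on_affine[OF I _ wm]) simp
    finally show "(\<integral>\<^sup>+y. ?w (\<lambda>i\<in>I. x i - T y i) * g x \<partial>lborel_on I) = ?Z * g x" .
  qed
  also have "\<dots> = ?Z * (\<integral>\<^sup>+x. g x \<partial>lborel_on I)"
    by (rule nn_integral_cmult[OF g])
  finally have "?Z * (\<integral>\<^sup>+y. g (T y) \<partial>lborel_on I) = ?Z * (\<integral>\<^sup>+x. g x \<partial>lborel_on I)" .
  then show ?thesis
    using nn_integral_unit_ball[OF I] by (simp add: ennreal_mult_cancel_left)
qed

text \<open>
  Half the squared norm of a point of the plane has the constant density \<open>2 * pi\<close> on the half line, because
  the disc where it is at most \<open>t\<close> has area \<open>2 * pi * t\<close>.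
\<close>
lemma nn_integral_polar:
  fixes u :: "real \<Rightarrow> ennreal"
  assumes u: "u \<in> borel_measurable borel"
  shows "(\<integral>\<^sup>+p. \<integral>\<^sup>+q. u ((p\<^sup>2 + q\<^sup>2) / 2) \<partial>lborel \<partial>lborel)
    = ennreal (2 * pi) * (\<integral>\<^sup>+s. (if 0 < s then u s else 0) \<partial>lborel)"
proof -
  let ?f = "\<lambda>x :: real \<times> real. ((fst x)\<^sup>2 + (snd x)\<^sup>2) / 2"
  let ?d = "density lborel (\<lambda>s. ennreal (2 * pi) * indicator {0<..} s) :: real measure"
  have "continuous_on UNIV ?f" by (intro continuous_intros) simp
  then have f[measurable]: "?f \<in> borel_measurable lborel"
    using borel_measurable_continuous_onI by simp
  have em: "emeasure (distr lborel borel ?f) {..t} = ennreal (2 * pi * max t 0)" for t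
  proof -
    have "emeasure (distr lborel borel ?f) {..t} = emeasure lborel (?f -` {..t} \<inter> space lborel)"
      by (rule emeasure_distr) simp_all
    also have "\<dots> = ennreal (2 * pi * max t 0)"
    proof (cases "0 \<le> t")
      case True
      have "?f -` {..t} \<inter> space lborel = cball 0 (sqrt (2 * t))"
        by (auto simp: norm_prod_def field_simps)
      then show ?thesis
        using True emeasure_cball[of "sqrt (2 * t)" "0 :: real \<times> real"]
        by (simp add: unit_ball_vol_2 mult_ac)
    next
      case False
      have "x \<notin> ?f -` {..t}" for x
      proof
        assume "x \<in> ?f -` {..t}"
        then have "?f x \<le> t" by simp
        moreover have "0 \<le> ?f x" by simp
        ultimately show False using False by linarith
      qed
      then have "?f -` {..t} = {}" by blast
      then show ?thesis using False by simp
    qed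
    finally show ?thesis .
  qed
  have em2: "emeasure ?d {..t} = ennreal (2 * pi * max t 0)" for t
  proof -
    have "emeasure ?d {..t} = (\<integral>\<^sup>+s. ennreal (2 * pi) * indicator {0<..t} s \<partial>lborel)"
      by (subst emeasure_density) (auto intro!: nn_integral_cong split: split_indicator)
    also have "\<dots> = ennreal (2 * pi) * emeasure lborel {0<..t}"
      by (rule nn_integral_cmult_indicator) simp
    also have "\<dots> = ennreal (2 * pi * max t 0)"
      by (cases "0 \<le> t") (simp_all add: ennreal_mult[symmetric])
    finally show ?thesis .
  qed
  have eq: "distr lborel borel ?f = ?d"
  proof (rule measure_eqI_generator_eq[where E = "range atMost" and \<Omega> = UNIV and A = "\<lambda>n::nat. {..real n}"])
    show "Int_stable (range atMost :: real set set)"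
      by (auto simp: Int_stable_def)
    show "sets (distr lborel borel ?f) = sigma_sets UNIV (range atMost)" "sets ?d = sigma_sets UNIV (range atMost)"
      by (simp_all add: borel_eq_atMost)
    show "(\<Union>n::nat. {..real n}) = UNIV" using real_arch_simple by auto
    show "emeasure (distr lborel borel ?f) {..real n} \<noteq> \<infinity>" for n :: nat unfolding em by simp
    show "emeasure (distr lborel borel ?f) X = emeasure ?d X" if "X \<in> range atMost" for X
      using that em em2 by auto
  qed auto
  have "(\<integral>\<^sup>+p. \<integral>\<^sup>+q. u ((p\<^sup>2 + q\<^sup>2) / 2) \<partial>lborel \<partial>lborel) = (\<integral>\<^sup>+x. u (?f x) \<partial>(lborel \<Otimes>\<^sub>M lborel))"
    using u by (subst lborel.nn_integral_fst[symmetric]) auto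
  also have "\<dots> = (\<integral>\<^sup>+x. u (?f x) \<partial>lborel)" by (simp add: lborel_prod)
  also have "\<dots> = (\<integral>\<^sup>+s. u s \<partial>distr lborel borel ?f)" using u by (subst nn_integral_distr) auto
  also have "\<dots> = (\<integral>\<^sup>+s. ennreal (2 * pi) * indicator {0<..} s * u s \<partial>lborel)"
    unfolding eq using u by (subst nn_integral_density) auto
  also have "\<dots> = (\<integral>\<^sup>+s. ennreal (2 * pi) * (if 0 < s then u s else 0) \<partial>lborel)"
    by (intro nn_integral_cong) (simp split: split_indicator)
  also have "\<dots> = ennreal (2 * pi) * (\<integral>\<^sup>+s. (if 0 < s then u s else 0) \<partial>lborel)"
  proof (rule nn_integral_cmult)
    note u[measurable]
    show "(\<lambda>s. if 0 < s then u s else 0) \<in> borel_measurable lborel" by measurable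
  qed
  finally show ?thesis .
qed

section \<open>Rotating the border of a Hermitian matrix\<close>

text \<open>
  The real coordinates of \<open>herm_of\<close>, with natural numbers as indices.
\<close>
definition hmat :: "nat \<Rightarrow> (nat \<times> nat \<Rightarrow> real) \<Rightarrow> complex mat" where
  "hmat n Y = Matrix.mat n n (\<lambda>(i, j). Complex ((Y (i, j) + Y (j, i)) / 2) ((Y (i, j) - Y (j, i)) / 2))"

text \<open>
  The positions in row and column \<open>n\<close> whose other index is below \<open>k\<close>. The border of a matrix of size \<open>n + 1\<close> without
  its corner is \<open>edges n n\<close>; smaller \<open>k\<close> serve for inductions.
\<close>
definition edges :: "nat \<Rightarrow> nat \<Rightarrow> (nat \<times> nat) set" where
  "edges k n = (\<lambda>j. (j, n)) ` {..<k} \<union> (\<lambda>j. (n, j)) ` {..<k}"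

text \<open>
  The last column of the Hermitian matrix, in terms of the real coordinates on the border; \<open>vec_edge\<close> is the
  inverse map. Up to the factor \<open>sqrt 2\<close> both are isometries.
\<close>
definition edge_vec :: "nat \<Rightarrow> (nat \<times> nat \<Rightarrow> real) \<Rightarrow> nat \<Rightarrow> complex" where
  "edge_vec n y j = Complex ((y (j, n) + y (n, j)) / 2) ((y (j, n) - y (n, j)) / 2)"

definition vec_edge :: "nat \<Rightarrow> (nat \<Rightarrow> complex) \<Rightarrow> nat \<times> nat \<Rightarrow> real" where
  "vec_edge n w = (\<lambda>p\<in>edges n n. if snd p = n then Re (w (fst p)) + Im (w (fst p))
     else Re (w (snd p)) - Im (w (snd p)))"

lemma hmat_carrier [simp]: "hmat n Y \<in> carrier_mat n n"
  by (simp add: hmat_def)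

lemma adj_hmat: "adj (hmat n Y) = hmat n Y"
  by (rule eq_matI) (auto simp: adj_def hmat_def complex_eq_iff field_simps)

lemma finite_edges [simp]: "finite (edges k n)"
  by (simp add: edges_def)

lemma mem_edges: "p \<in> edges n n \<longleftrightarrow> (fst p < n \<and> snd p = n) \<or> (fst p = n \<and> snd p < n)"
  by (cases p) (auto simp: edges_def)

lemma edges_Suc: "edges (Suc k) n = insert (k, n) (insert (n, k) (edges k n))"
  by (auto simp: edges_def lessThan_Suc)

lemma edges_notin: "k \<le> n \<Longrightarrow> (k, n) \<notin> edges k n" "k < n \<Longrightarrow> (n, k) \<notin> edges k n" "(n, n) \<notin> edges n n"
  by (auto simp: edges_def)

lemma sum_edges: "k \<le> n \<Longrightarrow> (\<Sum>p\<in>edges k n. f p :: real) = (\<Sum>j<k. f (j, n) + f (n, j))"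
proof (induction k)
  case 0
  then show ?case by (simp add: edges_def)
next
  case (Suc k)
  have "(k, n) \<notin> insert (n, k) (edges k n)" "(n, k) \<notin> edges k n"
    using Suc.prems edges_notin(1)[of k n] edges_notin(2)[of k n] by auto
  then show ?case using Suc by (simp add: edges_Suc)
qed

lemma edge_vec_vec_edge: "j < n \<Longrightarrow> edge_vec n (vec_edge n w) j = w j"
  by (simp add: edge_vec_def vec_edge_def mem_edges complex_eq_iff)

lemma vec_edge_edge_vec:
  assumes "y \<in> extensional (edges n n)"
  shows "vec_edge n (edge_vec n y) = y"
proof
  fix p show "vec_edge n (edge_vec n y) p = y p"
  proof (cases "p \<in> edges n n")
    case True
    then show ?thesis
      by (cases p) (auto simp: vec_edge_def mem_edges edge_vec_def field_simps)
  next
    case False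
    then show ?thesis using extensional_arb[OF assms False] by (simp add: vec_edge_def)
  qed
qed

lemma norm_edge_vec: "(cmod (edge_vec n y j))\<^sup>2 = ((y (j, n))\<^sup>2 + (y (n, j))\<^sup>2) / 2"
  by (simp add: edge_vec_def cmod_power2) (simp add: power2_eq_square field_simps)

lemma sum_edges_square: "(\<Sum>p\<in>edges n n. (y p)\<^sup>2) = 2 * (\<Sum>j<n. (cmod (edge_vec n y j))\<^sup>2)"
  unfolding norm_edge_vec sum_distrib_left by (subst sum_edges) (auto intro!: sum.cong)

lemma vec_edge_cong: "(\<And>j. j < n \<Longrightarrow> w j = w' j) \<Longrightarrow> vec_edge n w = vec_edge n w'"
  unfolding vec_edge_def by (rule restrict_ext) (auto simp: mem_edges)

text \<open>
  The action of a matrix \<open>W\<close> on the column \<open>edge_vec\<close>, transported to the real coordinates.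
\<close>
definition rotate_edge :: "nat \<Rightarrow> complex mat \<Rightarrow> (nat \<times> nat \<Rightarrow> real) \<Rightarrow> nat \<times> nat \<Rightarrow> real" where
  "rotate_edge n W y = vec_edge n (\<lambda>i. \<Sum>j<n. W $$ (i, j) * edge_vec n y j)"

lemma rotate_edge_extensional: "rotate_edge n W y \<in> extensional (edges n n)"
  by (simp add: rotate_edge_def vec_edge_def)

lemma edge_vec_rotate: "i < n \<Longrightarrow> edge_vec n (rotate_edge n W y) i = (\<Sum>j<n. W $$ (i, j) * edge_vec n y j)"
  unfolding rotate_edge_def by (rule edge_vec_vec_edge)

lemma rotate_edge_comp:
  assumes W: "W \<in> carrier_mat n n" "V \<in> carrier_mat n n" "W * V = 1\<^sub>m n" and y: "y \<in> extensional (edges n n)"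
  shows "rotate_edge n W (rotate_edge n V y) = y"
proof -
  have "(\<Sum>j<n. W $$ (i, j) * edge_vec n (rotate_edge n V y) j) = edge_vec n y i" if i: "i < n" for i
  proof -
    have "(\<Sum>j<n. W $$ (i, j) * edge_vec n (rotate_edge n V y) j)
      = (\<Sum>j<n. \<Sum>k<n. W $$ (i, j) * V $$ (j, k) * edge_vec n y k)"
      by (intro sum.cong refl) (simp add: edge_vec_rotate sum_distrib_left mult.assoc)
    also have "\<dots> = (\<Sum>k<n. \<Sum>j<n. W $$ (i, j) * V $$ (j, k) * edge_vec n y k)"
      by (rule sum.swap)
    also have "\<dots> = (\<Sum>k<n. (W * V) $$ (i, k) * edge_vec n y k)"
      unfolding sum_distrib_right[symmetric]
      using mat_mult_entry[OF W(1,2) i] by (intro sum.cong refl) simp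
    also have "\<dots> = (\<Sum>k<n. if k = i then edge_vec n y k else 0)"
      unfolding W(3) using i by (intro sum.cong refl) auto
    also have "\<dots> = edge_vec n y i" using i by simp
    finally show ?thesis .
  qed
  then have "rotate_edge n W (rotate_edge n V y) = vec_edge n (edge_vec n y)"
    unfolding rotate_edge_def[of n W] by (rule vec_edge_cong)
  then show ?thesis using vec_edge_edge_vec[OF y] by simp
qed

lemma norm_rotate_edge:
  assumes W: "W \<in> carrier_mat n n" "adj W * W = 1\<^sub>m n"
  shows "(\<Sum>i<n. (cmod (edge_vec n (rotate_edge n W y) i))\<^sup>2) = (\<Sum>i<n. (cmod (edge_vec n y i))\<^sup>2)"
proof -
  let ?v = "edge_vec n y"
  have "complex_of_real (\<Sum>i<n. (cmod (edge_vec n (rotate_edge n W y) i))\<^sup>2)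
    = (\<Sum>i<n. (\<Sum>j<n. W $$ (i, j) * ?v j) * cnj (\<Sum>k<n. W $$ (i, k) * ?v k))"
    unfolding of_real_sum by (intro sum.cong refl) (simp only: complex_norm_square edge_vec_rotate lessThan_iff)
  also have "\<dots> = (\<Sum>i<n. \<Sum>j<n. \<Sum>k<n. (cnj (W $$ (i, k)) * W $$ (i, j)) * (?v j * cnj (?v k)))"
    unfolding cnj_sum sum_product by (intro sum.cong refl) (simp add: mult_ac)
  also have "\<dots> = (\<Sum>j<n. \<Sum>i<n. \<Sum>k<n. (cnj (W $$ (i, k)) * W $$ (i, j)) * (?v j * cnj (?v k)))"
    by (rule sum.swap)
  also have "\<dots> = (\<Sum>j<n. \<Sum>k<n. \<Sum>i<n. (cnj (W $$ (i, k)) * W $$ (i, j)) * (?v j * cnj (?v k)))"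
    by (intro sum.cong refl sum.swap)
  also have "\<dots> = (\<Sum>j<n. \<Sum>k<n. (if k = j then ?v j * cnj (?v j) else 0))"
  proof (intro sum.cong refl)
    fix j k assume jk: "j \<in> {..<n}" "k \<in> {..<n}"
    have "(\<Sum>i<n. cnj (W $$ (i, k)) * W $$ (i, j)) = (adj W * W) $$ (k, j)"
      using mat_mult_entry[OF adj_carrier[OF W(1)] W(1), of k j] jk
      by (simp add: adj_entry[OF W(1)])
    also have "\<dots> = (if k = j then 1 else 0)" unfolding W(2) using jk by simp
    finally show "(\<Sum>i<n. (cnj (W $$ (i, k)) * W $$ (i, j)) * (?v j * cnj (?v k))) = (if k = j then ?v j * cnj (?v j) else 0)"
      unfolding sum_distrib_right[symmetric] by simp
  qed
  also have "\<dots> = complex_of_real (\<Sum>i<n. (cmod (?v i))\<^sup>2)"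
    unfolding of_real_sum by (intro sum.cong refl) (simp add: complex_norm_square del: of_real_power)
  finally show ?thesis by (simp only: of_real_eq_iff)
qed

lemma borel_measurable_complexI:
  assumes "(\<lambda>w. Re (f w)) \<in> borel_measurable M" "(\<lambda>w. Im (f w)) \<in> borel_measurable M"
  shows "f \<in> borel_measurable M"
proof -
  have "(\<lambda>w. complex_of_real (Re (f w)) + \<i> * complex_of_real (Im (f w))) \<in> borel_measurable M"
    using assms by measurable
  then show ?thesis by (simp add: complex_eq[symmetric])
qed

lemma measurable_edge_vec:
  "j < n \<Longrightarrow> (\<lambda>y. edge_vec n y j) \<in> borel_measurable (lborel_on (edges n n))"
proof (rule borel_measurable_complexI)
  assume j: "j < n"
  have [measurable]: "(\<lambda>y. y (j, n)) \<in> borel_measurable (lborel_on (edges n n))"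
    "(\<lambda>y. y (n, j)) \<in> borel_measurable (lborel_on (edges n n))"
    by (rule measurable_lborel_on_component, use j in \<open>simp add: mem_edges\<close>)+
  show "(\<lambda>y. Re (edge_vec n y j)) \<in> borel_measurable (lborel_on (edges n n))"
    "(\<lambda>y. Im (edge_vec n y j)) \<in> borel_measurable (lborel_on (edges n n))"
    unfolding edge_vec_def complex.sel by measurable
qed

lemma nn_integral_rotate_edge:
  assumes W: "W \<in> carrier_mat n n" "adj W * W = 1\<^sub>m n" and g: "g \<in> borel_measurable (lborel_on (edges n n))"
  shows "(\<integral>\<^sup>+y. g (rotate_edge n W y) \<partial>lborel_on (edges n n)) = (\<integral>\<^sup>+y. g y \<partial>lborel_on (edges n n))"
proof (rule nn_integral_isometry[where S = "rotate_edge n (adj W)"])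
  have WW: "W * adj W = 1\<^sub>m n" by (rule mat_mult_left_right_inverse[OF adj_carrier[OF W(1)] W])
  show "rotate_edge n (adj W) x \<in> extensional (edges n n)" for x by (rule rotate_edge_extensional)
  show "rotate_edge n W (rotate_edge n (adj W) x) = x" if "x \<in> extensional (edges n n)" for x
    by (rule rotate_edge_comp[OF W(1) adj_carrier[OF W(1)] WW that])
  show "(\<Sum>p\<in>edges n n. (rotate_edge n W x p)\<^sup>2) = (\<Sum>p\<in>edges n n. (x p)\<^sup>2)" for x
    unfolding sum_edges_square norm_rotate_edge[OF W] ..
  show "rotate_edge n W \<in> measurable (lborel_on (edges n n)) (lborel_on (edges n n))"
    unfolding rotate_edge_def vec_edge_def
  proof (rule measurable_restrict)
    fix p assume p: "p \<in> edges n n"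
    let ?M = "lborel_on (edges n n)" and ?s = "\<lambda>i y. \<Sum>j<n. W $$ (i, j) * edge_vec n y j"
    have S: "?s i \<in> borel_measurable ?M" for i
      by (intro borel_measurable_sum borel_measurable_times borel_measurable_const measurable_edge_vec) simp
    have R: "(\<lambda>y. Re (?s i y)) \<in> borel_measurable ?M" for i
      by (rule measurable_compose[OF S]) simp
    have I: "(\<lambda>y. Im (?s i y)) \<in> borel_measurable ?M" for i
      by (rule measurable_compose[OF S]) simp
    show "(\<lambda>y. if snd p = n then Re (?s (fst p) y) + Im (?s (fst p) y) else Re (?s (snd p) y) - Im (?s (snd p) y))
      \<in> measurable ?M lborel"
    proof (cases "snd p = n")
      case True
      show ?thesis unfolding measurable_lborel1 if_P[OF True] by (intro borel_measurable_add R I)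
    next
      case False
      show ?thesis unfolding measurable_lborel1 if_not_P[OF False] by (intro borel_measurable_diff R I)
    qed
  qed
  fix x y :: "nat \<times> nat \<Rightarrow> real"
  have ev: "edge_vec n (\<lambda>p\<in>edges n n. x p + y p) j = edge_vec n x j + edge_vec n y j" if "j < n" for j
    using that by (simp add: edge_vec_def mem_edges complex_eq_iff field_simps)
  have sum: "(\<Sum>j<n. W $$ (i, j) * edge_vec n (\<lambda>p\<in>edges n n. x p + y p) j)
      = (\<Sum>j<n. W $$ (i, j) * edge_vec n x j) + (\<Sum>j<n. W $$ (i, j) * edge_vec n y j)" for i
    unfolding sum.distrib[symmetric] by (intro sum.cong refl) (simp add: ev algebra_simps)
  show "rotate_edge n W (\<lambda>p\<in>edges n n. x p + y p) = (\<lambda>p\<in>edges n n. rotate_edge n W x p + rotate_edge n W y p)"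
    unfolding rotate_edge_def vec_edge_def sum by (rule restrict_ext) simp
qed (use g in simp_all)

text \<open>
  Each entry of the border has two real coordinates, and \<open>nn_integral_polar\<close> applies to each pair.
\<close>
lemma nn_integral_edges_polar:
  assumes "g \<in> borel_measurable (lborel_on {..<k})" "k \<le> n"
  shows "(\<integral>\<^sup>+y. g (\<lambda>j\<in>{..<k}. ((y (j, n))\<^sup>2 + (y (n, j))\<^sup>2) / 2) \<partial>lborel_on (edges k n))
    = ennreal ((2 * pi) ^ k) * (\<integral>\<^sup>+r. (if \<forall>j<k. 0 < r j then g r else 0) \<partial>lborel_on {..<k})"
  using assms
proof (induction k arbitrary: g)
  case 0
  have "edges 0 n = {}" by (simp add: edges_def)
  then show ?case by (simp add: lborel_prod.nn_integral_empty restrict_def del: nn_integral_const)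
next
  case (Suc k)
  note g = Suc.prems(1)
  have kn: "k < n" using Suc.prems by simp
  define Q where "Q k y = (\<lambda>j\<in>{..<k}. ((y (j, n))\<^sup>2 + (y (n, j))\<^sup>2) / 2)" for k and y :: "nat \<times> nat \<Rightarrow> real"
  have n1: "(n, k) \<notin> edges k n" "(k, n) \<notin> insert (n, k) (edges k n)"
    using edges_notin(1)[of k n] edges_notin(2)[of k n] kn by auto
  have gs: "(\<lambda>r. g (r(k := s))) \<in> borel_measurable (lborel_on {..<k})" for s
    by (rule measurable_compose[OF measurable_upd_Suc g]) simp_all
  have Qm: "(\<lambda>y. g (Q (Suc k) y)) \<in> borel_measurable (lborel_on (edges (Suc k) n))"
  proof (rule measurable_compose[OF _ g])
    show "Q (Suc k) \<in> measurable (lborel_on (edges (Suc k) n)) (lborel_on {..<Suc k})"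
      unfolding Q_def[abs_def]
    proof (rule measurable_restrict)
      fix j assume "j \<in> {..<Suc k}"
      then have [measurable]: "(\<lambda>y. y (j, n)) \<in> borel_measurable (lborel_on (edges (Suc k) n))"
        "(\<lambda>y. y (n, j)) \<in> borel_measurable (lborel_on (edges (Suc k) n))"
        by (auto intro!: measurable_lborel_on_component simp: edges_def)
      show "(\<lambda>y. ((y (j, n))\<^sup>2 + (y (n, j))\<^sup>2) / 2) \<in> measurable (lborel_on (edges (Suc k) n)) lborel"
        by simp
    qed
  qed
  define u where "u s = ennreal ((2 * pi) ^ k) * (\<integral>\<^sup>+r. (if \<forall>j<k. 0 < r j then g (r(k := s)) else 0) \<partial>lborel_on {..<k})" for s
  have Qupd: "Q (Suc k) (y((n, k) := q, (k, n) := p)) = (Q k y)(k := (p\<^sup>2 + q\<^sup>2) / 2)" for y p q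
    using kn by (intro ext) (auto simp: Q_def restrict_def)
  have pos: "Measurable.pred M (\<lambda>r. \<forall>j<k. 0 < f r j)" if "\<And>j. j < k \<Longrightarrow> (\<lambda>r. f r j) \<in> borel_measurable M" for f :: "'b \<Rightarrow> nat \<Rightarrow> real" and M k
    using measurable_pred_less_all[of k "\<lambda>w j. - f w j" M "\<lambda>_. 0"] that by (simp add: borel_measurable_uminus)
  have um: "u \<in> borel_measurable borel"
  proof -
    have [measurable]: "(\<lambda>p. g ((snd p)(k := fst p))) \<in> borel_measurable (borel \<Otimes>\<^sub>M lborel_on {..<k})"
      by (rule measurable_compose[OF measurable_upd_Suc g]) simp_all
    have [measurable]: "Measurable.pred (borel \<Otimes>\<^sub>M lborel_on {..<k}) (\<lambda>p. \<forall>j<k. 0 < (snd p) j)"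
      by (rule pos) (rule measurable_compose[OF measurable_snd measurable_component_lborel])
    have "(\<lambda>s. \<integral>\<^sup>+r. (if \<forall>j<k. 0 < r j then g (r(k := s)) else 0) \<partial>lborel_on {..<k}) \<in> borel_measurable borel"
      by (rule measurable_nn_integral_lborel_on) (simp, simp only: case_prod_beta', measurable)
    then show ?thesis unfolding u_def by measurable
  qed
  have inner: "(\<integral>\<^sup>+y. g ((Q k y)(k := s)) \<partial>lborel_on (edges k n)) = u s" for s
    unfolding u_def Q_def by (rule Suc.IH[OF gs]) (use kn in simp)
  have "(\<integral>\<^sup>+y. g (Q (Suc k) y) \<partial>lborel_on (edges (Suc k) n))
    = (\<integral>\<^sup>+p. \<integral>\<^sup>+y. g (Q (Suc k) (y((k, n) := p))) \<partial>lborel_on (insert (n, k) (edges k n)) \<partial>lborel)"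
    using Qm unfolding edges_Suc by (intro lborel_prod.product_nn_integral_insert_rev n1) simp_all
  also have "\<dots> = (\<integral>\<^sup>+p. \<integral>\<^sup>+q. \<integral>\<^sup>+y. g (Q (Suc k) (y((n, k) := q, (k, n) := p))) \<partial>lborel_on (edges k n) \<partial>lborel \<partial>lborel)"
  proof (rule nn_integral_cong)
    fix p :: real
    have "(\<lambda>y. y((k, n) := p)) \<in> measurable (lborel_on (insert (n, k) (edges k n))) (lborel_on (edges (Suc k) n))"
      unfolding edges_Suc by (rule measurable_fun_upd[where J = "insert (n, k) (edges k n)"]) auto
    from measurable_compose[OF this Qm]
    show "(\<integral>\<^sup>+y. g (Q (Suc k) (y((k, n) := p))) \<partial>lborel_on (insert (n, k) (edges k n)))
      = (\<integral>\<^sup>+q. \<integral>\<^sup>+y. g (Q (Suc k) (y((n, k) := q, (k, n) := p))) \<partial>lborel_on (edges k n) \<partial>lborel)"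
      by (rule lborel_prod.product_nn_integral_insert_rev[OF finite_edges n1(1)])
  qed
  also have "\<dots> = (\<integral>\<^sup>+p. \<integral>\<^sup>+q. u ((p\<^sup>2 + q\<^sup>2) / 2) \<partial>lborel \<partial>lborel)"
    unfolding Qupd inner ..
  also have "\<dots> = ennreal (2 * pi) * (\<integral>\<^sup>+s. (if 0 < s then u s else 0) \<partial>lborel)"
    by (rule nn_integral_polar[OF um])
  also have "(\<integral>\<^sup>+s. (if 0 < s then u s else 0) \<partial>lborel) = (\<integral>\<^sup>+s. ennreal ((2 * pi) ^ k) *
      (\<integral>\<^sup>+r. (if \<forall>j<Suc k. 0 < (r(k := s)) j then g (r(k := s)) else 0) \<partial>lborel_on {..<k}) \<partial>lborel)"
  proof (rule nn_integral_cong)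
    fix s :: real
    have iff: "(\<forall>j<Suc k. 0 < (r(k := s)) j) \<longleftrightarrow> 0 < s \<and> (\<forall>j<k. 0 < r j)" for r
      by (auto simp: less_Suc_eq)
    show "(if 0 < s then u s else 0) = ennreal ((2 * pi) ^ k) *
      (\<integral>\<^sup>+r. (if \<forall>j<Suc k. 0 < (r(k := s)) j then g (r(k := s)) else 0) \<partial>lborel_on {..<k})"
      unfolding iff u_def by (cases "0 < s") (simp_all del: fun_upd_apply)
  qed
  also have "\<dots> = ennreal ((2 * pi) ^ k) * (\<integral>\<^sup>+s. \<integral>\<^sup>+r. (if \<forall>j<Suc k. 0 < (r(k := s)) j then g (r(k := s)) else 0) \<partial>lborel_on {..<k} \<partial>lborel)"
  proof (rule nn_integral_cmult)
    have 1: "(\<lambda>p. (snd p)(k := fst p)) \<in> measurable (lborel \<Otimes>\<^sub>M lborel_on {..<k}) (lborel_on {..<Suc k})"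
      by (rule measurable_upd_Suc) simp_all
    have 2: "(\<lambda>p. if \<forall>j<Suc k. 0 < ((snd p)(k := fst p)) j then g ((snd p)(k := fst p)) else 0)
      \<in> borel_measurable (lborel \<Otimes>\<^sub>M lborel_on {..<k})"
    proof (rule measurable_If)
      show "(\<lambda>p. g ((snd p)(k := fst p))) \<in> borel_measurable (lborel \<Otimes>\<^sub>M lborel_on {..<k})"
        by (rule measurable_compose[OF 1 g])
      have "Measurable.pred (lborel \<Otimes>\<^sub>M lborel_on {..<k}) (\<lambda>p. \<forall>j<Suc k. 0 < ((snd p)(k := fst p)) j)"
        by (rule pos) (rule measurable_compose[OF 1 measurable_component_lborel])
      then show "{p \<in> space (lborel \<Otimes>\<^sub>M lborel_on {..<k}). \<forall>j<Suc k. 0 < ((snd p)(k := fst p)) j}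
        \<in> sets (lborel \<Otimes>\<^sub>M lborel_on {..<k})"
        unfolding pred_def .
    qed simp
    show "(\<lambda>s. \<integral>\<^sup>+r. (if \<forall>j<Suc k. 0 < (r(k := s)) j then g (r(k := s)) else 0) \<partial>lborel_on {..<k}) \<in> borel_measurable lborel"
      by (rule measurable_nn_integral_lborel_on[OF finite_lessThan]) (simp only: case_prod_beta' 2)
  qed
  also have "(\<integral>\<^sup>+s. \<integral>\<^sup>+r. (if \<forall>j<Suc k. 0 < (r(k := s)) j then g (r(k := s)) else 0) \<partial>lborel_on {..<k} \<partial>lborel)
    = (\<integral>\<^sup>+r. (if \<forall>j<Suc k. 0 < r j then g r else 0) \<partial>lborel_on {..<Suc k})"
  proof -
    have [measurable]: "Measurable.pred (lborel_on {..<Suc k}) (\<lambda>r. \<forall>j<Suc k. 0 < r j)"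
      by (rule pos) (rule measurable_component_lborel)
    note g[measurable]
    have "(\<lambda>r. if \<forall>j<Suc k. 0 < r j then g r else 0) \<in> borel_measurable (lborel_on {..<Suc k})" by measurable
    from nn_integral_lborel_Suc(2)[OF this] show ?thesis by (rule sym)
  qed
  finally have "(\<integral>\<^sup>+y. g (Q (Suc k) y) \<partial>lborel_on (edges (Suc k) n)) = ennreal (2 * pi) * (ennreal ((2 * pi) ^ k) *
    (\<integral>\<^sup>+r. (if \<forall>j<Suc k. 0 < r j then g r else 0) \<partial>lborel_on {..<Suc k}))" .
  moreover have "ennreal ((2 * pi) ^ Suc k) = ennreal (2 * pi) * ennreal ((2 * pi) ^ k)"
    unfolding power_Suc by (rule ennreal_mult) simp_all
  ultimately show ?case unfolding Q_def by (simp only: mult.assoc)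
qed

section \<open>The joint law of the eigenvalues\<close>

lemma measurable_coeff_prod:
  fixes f :: "'i \<Rightarrow> 'w \<Rightarrow> complex poly"
  assumes "finite I" "\<And>i k. i \<in> I \<Longrightarrow> (\<lambda>w. coeff (f i w) k) \<in> borel_measurable M"
  shows "(\<lambda>w. coeff (\<Prod>i\<in>I. f i w) k) \<in> borel_measurable M"
  using assms
proof (induction I arbitrary: k rule: finite_induct)
  case empty
  then show ?case by simp
next
  case (insert i I)
  have "(\<lambda>w. \<Sum>j\<le>k. coeff (f i w) j * coeff (\<Prod>i\<in>I. f i w) (k - j)) \<in> borel_measurable M"
    by (intro borel_measurable_sum borel_measurable_times insert.IH insert.prems) (use insert in auto)
  then show ?case unfolding prod.insert[OF insert.hyps] coeff_mult .
qed

lemma measurable_coeff_char_poly: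
  fixes A :: "'w \<Rightarrow> complex mat"
  assumes A: "\<And>w. A w \<in> carrier_mat n n"
    and m: "\<And>i j. i < n \<Longrightarrow> j < n \<Longrightarrow> (\<lambda>w. A w $$ (i, j)) \<in> borel_measurable M"
  shows "(\<lambda>w. coeff (char_poly (A w)) k) \<in> borel_measurable M"
proof -
  have entry: "(\<lambda>w. coeff (char_poly_matrix (A w) $$ (i, j)) k) \<in> borel_measurable M" if ij: "i < n" "j < n" for i j k
  proof -
    have dim: "dim_row (A w) = n" "dim_col (A w) = n" for w using A[of w] by auto
    have "coeff (char_poly_matrix (A w) $$ (i, j)) k
      = coeff ([:0, 1:] * (if i = j then 1 else 0)) k + (if k = 0 then - (A w $$ (i, j)) else 0)" for w
      unfolding char_poly_matrix_def using ij dim[of w] by (cases k) (simp_all split: if_splits)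
    moreover have "(\<lambda>w. coeff ([:0, 1:] * (if i = j then 1 else 0)) k + (if k = 0 then - (A w $$ (i, j)) else 0)) \<in> borel_measurable M"
      using borel_measurable_uminus[OF m[OF ij]] by (cases "k = 0") simp_all
    ultimately show ?thesis by simp
  qed
  have "coeff (char_poly (A w)) k
    = (\<Sum>p\<in>{p. p permutes {0..<n}}. signof p * coeff (\<Prod>i = 0..<n. char_poly_matrix (A w) $$ (i, p i)) k)" for w
  proof -
    have "coeff (signof p * q) k = signof p * coeff q k" for p :: "nat \<Rightarrow> nat" and q :: "complex poly"
      by (cases p rule: sign_cases) simp_all
    then show ?thesis
      unfolding char_poly_def det_def'[OF char_poly_matrix_closed[OF A]] coeff_sum by simp
  qed
  moreover have "(\<lambda>w. \<Sum>p\<in>{p. p permutes {0..<n}}. signof p * coeff (\<Prod>i = 0..<n. char_poly_matrix (A w) $$ (i, p i)) k) \<in> borel_measurable M"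
  proof (intro borel_measurable_sum borel_measurable_times borel_measurable_const measurable_coeff_prod)
    fix p i k assume "p \<in> {p. p permutes {0..<n}}" "i \<in> {0..<n}"
    then have "i < n" "p i < n" using permutes_in_image[of p "{0..<n}" i] by auto
    then show "(\<lambda>w. coeff (char_poly_matrix (A w) $$ (i, p i)) k) \<in> borel_measurable M" by (rule entry)
  qed simp
  ultimately show ?thesis by simp
qed

definition eigs :: "nat \<Rightarrow> (nat \<times> nat \<Rightarrow> real) \<Rightarrow> nat \<Rightarrow> real" where
  "eigs n Y = roots n (hcoeffs n (hmat n Y))"

abbreviation square :: "nat \<Rightarrow> (nat \<times> nat) set" where
  "square n \<equiv> {..<n} \<times> {..<n}"

lemma measurable_eigs_compose:
  assumes "\<And>i j. i < n \<Longrightarrow> j < n \<Longrightarrow> (\<lambda>w. Y w (i, j)) \<in> borel_measurable M"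
  shows "(\<lambda>w. eigs n (Y w)) \<in> measurable M (lborel_on {..<n})"
  unfolding eigs_def
proof (rule measurable_roots_PiM)
  fix k
  have "(\<lambda>w. coeff (char_poly (hmat n (Y w))) (n - Suc k)) \<in> borel_measurable M"
  proof (rule measurable_coeff_char_poly[of _ n])
    fix i j assume ij: "i < n" "j < n"
    note assms[OF ij, measurable] assms[OF ij(2,1), measurable]
    show "(\<lambda>w. hmat n (Y w) $$ (i, j)) \<in> borel_measurable M"
      by (rule borel_measurable_complexI) (use ij in \<open>simp_all add: hmat_def\<close>)
  qed simp
  from measurable_compose[OF this borel_measurable_Re]
  show "(\<lambda>w. hcoeffs n (hmat n (Y w)) k) \<in> borel_measurable M"
    unfolding hcoeffs_def by simp
qed

lemma measurable_eigs: "eigs n \<in> measurable (lborel_on (square n)) (lborel_on {..<n})"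
  by (rule measurable_eigs_compose[of n "\<lambda>Y. Y"]) (rule measurable_lborel_on_component, simp)

lemma hmat_bordered:
  assumes "\<And>i j. i < n \<Longrightarrow> j < n \<Longrightarrow> Y (i, j) = A (i, j)" "\<And>p. p \<in> edges n n \<Longrightarrow> Y p = y p" "Y (n, n) = a"
  shows "hmat (Suc n) Y = bordered n (hmat n A) (edge_vec n y) a"
proof (rule eq_matI)
  have B: "bordered n (hmat n A) (edge_vec n y) a \<in> carrier_mat (Suc n) (Suc n)" by (rule bordered_carrier) simp
  then show "dim_row (hmat (Suc n) Y) = dim_row (bordered n (hmat n A) (edge_vec n y) a)"
    "dim_col (hmat (Suc n) Y) = dim_col (bordered n (hmat n A) (edge_vec n y) a)" by (auto simp: hmat_def)
  fix i j assume "i < dim_row (bordered n (hmat n A) (edge_vec n y) a)" "j < dim_col (bordered n (hmat n A) (edge_vec n y) a)"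
  then have ij: "i < Suc n" "j < Suc n" using B by auto
  have e: "Y (k, n) = y (k, n)" "Y (n, k) = y (n, k)" if "k < n" for k
    using that by (simp_all add: assms(2) mem_edges)
  have l: "hmat (Suc n) Y $$ (i, j) = Complex ((Y (i, j) + Y (j, i)) / 2) ((Y (i, j) - Y (j, i)) / 2)"
    using ij by (simp add: hmat_def)
  consider "i < n" "j < n" | "i < n" "j = n" | "i = n" "j < n" | "i = n" "j = n" using ij by linarith
  then show "hmat (Suc n) Y $$ (i, j) = bordered n (hmat n A) (edge_vec n y) a $$ (i, j)"
  proof cases
    case 1
    then show ?thesis unfolding l by (simp add: bordered_def hmat_def assms(1))
  next
    case 2
    then show ?thesis unfolding l by (simp add: bordered_def hmat_def col_mat_def edge_vec_def e)
  next
    case 3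
    then show ?thesis unfolding l
      by (simp add: bordered_def hmat_def col_mat_def edge_vec_def e adj_def complex_eq_iff field_simps)
  next
    case 4
    then show ?thesis unfolding l
      by (simp add: bordered_def hmat_def col_mat_def assms(3) complex_eq_iff)
  qed
qed

text \<open>
  The volume of the polytope of Gelfand-Tsetlin patterns with top row \<open>z\<close>, that is, of the triangular arrays of
  rows of lengths \<open>n - 1, \<dots>, 1\<close> below \<open>z\<close> in which consecutive rows interlace.
\<close>
primrec gt_volume :: "nat \<Rightarrow> (nat \<Rightarrow> real) \<Rightarrow> ennreal" where
  "gt_volume 0 z = 1"
| "gt_volume (Suc n) z = (\<integral>\<^sup>+mu. (if strict_incr n mu \<and> interlaces n mu z then gt_volume n mu else 0) \<partial>lborel_on {..<n})"

lemma measurable_gt_volume: "gt_volume n \<in> borel_measurable (lborel_on {..<n})"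
proof (induction n)
  case 0
  have "gt_volume 0 = (\<lambda>_. 1)" by (rule ext) simp
  then show ?case by simp
next
  case (Suc n)
  let ?P = "lborel_on {..<Suc n} \<Otimes>\<^sub>M lborel_on {..<n}"
  have s: "(\<lambda>p. snd p k) \<in> borel_measurable ?P" if "k < n" for k
    by (rule measurable_compose[OF measurable_snd measurable_component_lborel[OF that]])
  have f: "(\<lambda>p. fst p k) \<in> borel_measurable ?P" if "k \<le> n" for k
    by (rule measurable_compose[OF measurable_fst measurable_component_lborel]) (use that in simp)
  have [measurable]: "Measurable.pred ?P (\<lambda>p. strict_incr n (snd p))" by (rule measurable_strict_incr) (rule s)
  have [measurable]: "Measurable.pred ?P (\<lambda>p. interlaces n (snd p) (fst p))"
    by (rule measurable_interlaces) (rule s f, assumption)+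
  have [measurable]: "(\<lambda>p. gt_volume n (snd p)) \<in> borel_measurable ?P"
    by (rule measurable_compose[OF measurable_snd Suc])
  have m: "(\<lambda>p. if strict_incr n (snd p) \<and> interlaces n (snd p) (fst p) then gt_volume n (snd p) else 0) \<in> borel_measurable ?P"
    by measurable
  have "(\<lambda>z. \<integral>\<^sup>+mu. (if strict_incr n mu \<and> interlaces n mu z then gt_volume n mu else 0) \<partial>lborel_on {..<n})
    \<in> borel_measurable (lborel_on {..<Suc n})"
    by (rule measurable_nn_integral_lborel_on[OF finite_lessThan]) (simp only: case_prod_beta' m)
  then show ?case by simp
qed

lemma square_Suc: "square (Suc n) = square n \<union> insert (n, n) (edges n n)"
  by (auto simp: edges_def)

lemma square_disjoint: "square n \<inter> insert (n, n) (edges n n) = {}"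
  by (auto simp: edges_def)

text \<open>
  The effect of bordering on functions of the spectrum, up to the constant \<open>(2 * pi)\<^sup>n\<close>.
\<close>
definition border_kernel :: "nat \<Rightarrow> ((nat \<Rightarrow> real) \<Rightarrow> ennreal) \<Rightarrow> (nat \<Rightarrow> real) \<Rightarrow> ennreal" where
  "border_kernel n F mu = (\<integral>\<^sup>+a. \<integral>\<^sup>+r. (if \<forall>j<n. 0 < r j then F (roots (Suc n) (arrow_coeffs n mu a r)) else 0)
     \<partial>lborel_on {..<n} \<partial>lborel)"

lemma measurable_arrow_roots:
  assumes F: "F \<in> borel_measurable (lborel_on {..<Suc n})"
    and "a \<in> borel_measurable M" "\<And>j. j < n \<Longrightarrow> (\<lambda>w. r w j) \<in> borel_measurable M"
      "\<And>j. j < n \<Longrightarrow> (\<lambda>w. mu w j) \<in> borel_measurable M"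
  shows "(\<lambda>w. F (roots (Suc n) (arrow_coeffs n (mu w) (a w) (r w)))) \<in> borel_measurable M"
  by (rule measurable_compose[OF measurable_roots_PiM F], rule measurable_arrow_coeffs) (use assms in simp_all)

lemma measurable_pred_all_pos:
  fixes r :: "'w \<Rightarrow> nat \<Rightarrow> real"
  assumes "\<And>j. j < n \<Longrightarrow> (\<lambda>w. r w j) \<in> borel_measurable M"
  shows "Measurable.pred M (\<lambda>w. \<forall>j<n. 0 < r w j)"
  using measurable_pred_less_all[of n "\<lambda>w j. - r w j" M "\<lambda>_. 0"] assms by (simp add: borel_measurable_uminus)

lemma measurable_border_kernel:
  assumes F: "F \<in> borel_measurable (lborel_on {..<Suc n})"
  shows "border_kernel n F \<in> borel_measurable (lborel_on {..<n})"
proof -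
  let ?P = "(lborel_on {..<n} \<Otimes>\<^sub>M lborel) \<Otimes>\<^sub>M lborel_on {..<n}"
  have r: "(\<lambda>p. snd p k) \<in> borel_measurable ?P" if "k < n" for k
    by (rule measurable_compose[OF measurable_snd measurable_component_lborel[OF that]])
  have mu: "(\<lambda>p. fst (fst p) k) \<in> borel_measurable ?P" if "k < n" for k
    by (rule measurable_compose[OF _ measurable_component_lborel[OF that]]) simp
  have a: "(\<lambda>p. snd (fst p)) \<in> borel_measurable ?P" by simp
  have [measurable]: "(\<lambda>p. F (roots (Suc n) (arrow_coeffs n (fst (fst p)) (snd (fst p)) (snd p)))) \<in> borel_measurable ?P"
    by (rule measurable_arrow_roots[OF F a r mu])
  have [measurable]: "Measurable.pred ?P (\<lambda>p. \<forall>j<n. 0 < snd p j)" by (rule measurable_pred_all_pos[OF r])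
  have m: "(\<lambda>p. if \<forall>j<n. 0 < snd p j then F (roots (Suc n) (arrow_coeffs n (fst (fst p)) (snd (fst p)) (snd p))) else 0) \<in> borel_measurable ?P"
    by measurable
  have "(\<lambda>q. \<integral>\<^sup>+r. (if \<forall>j<n. 0 < r j then F (roots (Suc n) (arrow_coeffs n (fst q) (snd q) r)) else 0) \<partial>lborel_on {..<n})
    \<in> borel_measurable (lborel_on {..<n} \<Otimes>\<^sub>M lborel)"
    by (rule measurable_nn_integral_lborel_on[OF finite_lessThan]) (simp only: case_prod_beta' m)
  then have "(\<lambda>mu. \<integral>\<^sup>+a. \<integral>\<^sup>+r. (if \<forall>j<n. 0 < r j then F (roots (Suc n) (arrow_coeffs n mu a r)) else 0) \<partial>lborel_on {..<n} \<partial>lborel)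
    \<in> borel_measurable (lborel_on {..<n})"
    by (intro lborel.borel_measurable_nn_integral) (simp only: case_prod_beta')
  then show ?thesis unfolding border_kernel_def[abs_def] .
qed

text \<open>
  An eigenbasis of the inner matrix turns the bordered matrix into an arrow matrix. The change of basis rotates
  the border, which preserves Lebesgue measure, so the basis disappears from the result, which is
  measurable in \<open>A\<close> although \<open>U\<close> is chosen separately for each \<open>A\<close>.
\<close>
lemma nn_integral_border:
  assumes F: "F \<in> borel_measurable (lborel_on {..<Suc n})"
  shows "(\<integral>\<^sup>+y. F (roots (Suc n) (hcoeffs (Suc n) (bordered n (hmat n A) (edge_vec n y) a))) \<partial>lborel_on (edges n n))
    = ennreal ((2 * pi) ^ n) * (\<integral>\<^sup>+r. (if \<forall>j<n. 0 < r j then F (roots (Suc n) (arrow_coeffs n (eigs n A) a r)) else 0)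
        \<partial>lborel_on {..<n})"
proof -
  let ?mu = "eigs n A"
  obtain U where U: "U \<in> carrier_mat n n" "adj U * U = 1\<^sub>m n"
      "adj U * hmat n A * U = mat_diag n (\<lambda>i. complex_of_real (?mu i))"
    using spectral_roots[OF hmat_carrier adj_hmat] unfolding eigs_def by blast
  define q where "q y = (\<lambda>j\<in>{..<n}. ((y (j, n))\<^sup>2 + (y (n, j))\<^sup>2) / 2)" for y :: "nat \<times> nat \<Rightarrow> real"
  define g where "g r = F (roots (Suc n) (arrow_coeffs n ?mu a r))" for r
  have aU: "adj U \<in> carrier_mat n n" "adj (adj U) * adj U = 1\<^sub>m n"
    using U(1) mat_mult_left_right_inverse[OF adj_carrier[OF U(1)] U(1,2)] by (simp_all add: adj_adj)
  have gm: "g \<in> borel_measurable (lborel_on {..<n})"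
    unfolding g_def by (rule measurable_arrow_roots[OF F]) (simp_all add: measurable_component_lborel)
  have qm: "q \<in> measurable (lborel_on (edges n n)) (lborel_on {..<n})"
    unfolding q_def[abs_def]
  proof (rule measurable_restrict)
    fix j assume "j \<in> {..<n}"
    then have [measurable]: "(\<lambda>y. y (j, n)) \<in> borel_measurable (lborel_on (edges n n))"
      "(\<lambda>y. y (n, j)) \<in> borel_measurable (lborel_on (edges n n))"
      by (auto intro!: measurable_lborel_on_component simp: edges_def)
    show "(\<lambda>y. ((y (j, n))\<^sup>2 + (y (n, j))\<^sup>2) / 2) \<in> measurable (lborel_on (edges n n)) lborel" by simp
  qed
  have eq: "F (roots (Suc n) (hcoeffs (Suc n) (bordered n (hmat n A) (edge_vec n y) a))) = g (q (rotate_edge n (adj U) y))" for y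
  proof -
    have "arrow_coeffs n ?mu a (\<lambda>i. (cmod (\<Sum>j<n. cnj (U $$ (j, i)) * edge_vec n y j))\<^sup>2) = arrow_coeffs n ?mu a (q (rotate_edge n (adj U) y))"
    proof (rule arrow_coeffs_cong)
      fix i assume i: "i < n"
      have "(\<Sum>j<n. cnj (U $$ (j, i)) * edge_vec n y j) = edge_vec n (rotate_edge n (adj U) y) i"
        unfolding edge_vec_rotate[OF i] by (intro sum.cong refl) (simp add: adj_entry[OF U(1) i])
      then show "(cmod (\<Sum>j<n. cnj (U $$ (j, i)) * edge_vec n y j))\<^sup>2 = q (rotate_edge n (adj U) y) i"
        using i by (simp add: norm_edge_vec q_def)
    qed
    then show ?thesis unfolding roots_bordered[OF hmat_carrier adj_hmat U] g_def by (simp only:)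
  qed
  have "(\<integral>\<^sup>+y. g (q (rotate_edge n (adj U) y)) \<partial>lborel_on (edges n n)) = (\<integral>\<^sup>+y. g (q y) \<partial>lborel_on (edges n n))"
    by (rule nn_integral_rotate_edge[OF aU measurable_compose[OF qm gm]])
  also have "\<dots> = ennreal ((2 * pi) ^ n) * (\<integral>\<^sup>+r. (if \<forall>j<n. 0 < r j then g r else 0) \<partial>lborel_on {..<n})"
    unfolding q_def by (rule nn_integral_edges_polar[OF gm order_refl])
  finally show ?thesis unfolding eq g_def .
qed

lemma nn_integral_eigs_Suc:
  assumes F: "F \<in> borel_measurable (lborel_on {..<Suc n})"
  shows "(\<integral>\<^sup>+Y. F (eigs (Suc n) Y) \<partial>lborel_on (square (Suc n)))
    = ennreal ((2 * pi) ^ n) * (\<integral>\<^sup>+A. border_kernel n F (eigs n A) \<partial>lborel_on (square n))"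
proof -
  let ?J = "insert (n, n) (edges n n)"
  have Fm: "(\<lambda>Y. F (eigs (Suc n) Y)) \<in> borel_measurable (lborel_on (square n \<union> ?J))"
    using measurable_compose[OF measurable_eigs F] unfolding square_Suc .
  have e: "eigs (Suc n) (merge (square n) ?J (A, y((n, n) := a)))
    = roots (Suc n) (hcoeffs (Suc n) (bordered n (hmat n A) (edge_vec n y) a))" for A y a
  proof -
    have "hmat (Suc n) (merge (square n) ?J (A, y((n, n) := a))) = bordered n (hmat n A) (edge_vec n y) a"
      by (rule hmat_bordered) (auto simp: merge_def mem_edges)
    then show ?thesis unfolding eigs_def by (simp only:)
  qed
  have inner: "(\<integral>\<^sup>+y. F (eigs (Suc n) (merge (square n) ?J (A, y))) \<partial>lborel_on ?J)
    = ennreal ((2 * pi) ^ n) * border_kernel n F (eigs n A)" if A: "A \<in> space (lborel_on (square n))" for A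
  proof -
    have Am: "(\<lambda>y. F (eigs (Suc n) (merge (square n) ?J (A, y)))) \<in> borel_measurable (lborel_on ?J)"
    proof (rule measurable_compose[OF _ Fm])
      show "(\<lambda>y. merge (square n) ?J (A, y)) \<in> measurable (lborel_on ?J) (lborel_on (square n \<union> ?J))"
        using measurable_compose[OF measurable_Pair1'[OF A] measurable_merge] .
    qed
    let ?in = "\<lambda>a. \<integral>\<^sup>+r. (if \<forall>j<n. 0 < r j then F (roots (Suc n) (arrow_coeffs n (eigs n A) a r)) else 0) \<partial>lborel_on {..<n}"
    have "(\<integral>\<^sup>+y. F (eigs (Suc n) (merge (square n) ?J (A, y))) \<partial>lborel_on ?J)
      = (\<integral>\<^sup>+a. \<integral>\<^sup>+y. F (eigs (Suc n) (merge (square n) ?J (A, y((n, n) := a)))) \<partial>lborel_on (edges n n) \<partial>lborel)"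
      by (rule lborel_prod.product_nn_integral_insert_rev[OF finite_edges edges_notin(3) Am])
    also have "\<dots> = (\<integral>\<^sup>+a. ennreal ((2 * pi) ^ n) * ?in a \<partial>lborel)"
      unfolding e nn_integral_border[OF F] ..
    also have "\<dots> = ennreal ((2 * pi) ^ n) * (\<integral>\<^sup>+a. ?in a \<partial>lborel)"
    proof (rule nn_integral_cmult)
      let ?P = "lborel \<Otimes>\<^sub>M lborel_on {..<n} :: (real \<times> (nat \<Rightarrow> real)) measure"
      have r: "(\<lambda>p. snd p k) \<in> borel_measurable ?P" if "k < n" for k
        by (rule measurable_compose[OF measurable_snd measurable_component_lborel[OF that]])
      have [measurable]: "(\<lambda>p. F (roots (Suc n) (arrow_coeffs n (eigs n A) (fst p) (snd p)))) \<in> borel_measurable ?P"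
        by (rule measurable_arrow_roots[OF F _ r]) simp_all
      have [measurable]: "Measurable.pred ?P (\<lambda>p. \<forall>j<n. 0 < snd p j)" by (rule measurable_pred_all_pos[OF r])
      have m: "(\<lambda>p. if \<forall>j<n. 0 < snd p j then F (roots (Suc n) (arrow_coeffs n (eigs n A) (fst p) (snd p))) else 0) \<in> borel_measurable ?P"
        by measurable
      show "?in \<in> borel_measurable lborel"
        by (rule measurable_nn_integral_lborel_on[OF finite_lessThan]) (simp only: case_prod_beta' m)
    qed
    finally show ?thesis unfolding border_kernel_def .
  qed
  have "(\<integral>\<^sup>+Y. F (eigs (Suc n) Y) \<partial>lborel_on (square (Suc n))) = (\<integral>\<^sup>+Y. F (eigs (Suc n) Y) \<partial>lborel_on (square n \<union> ?J))"
    unfolding square_Suc ..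
  also have "\<dots> = (\<integral>\<^sup>+A. \<integral>\<^sup>+y. F (eigs (Suc n) (merge (square n) ?J (A, y))) \<partial>lborel_on ?J \<partial>lborel_on (square n))"
    by (rule lborel_prod.product_nn_integral_fold[OF square_disjoint _ _ Fm]) simp_all
  also have "\<dots> = (\<integral>\<^sup>+A. ennreal ((2 * pi) ^ n) * border_kernel n F (eigs n A) \<partial>lborel_on (square n))"
    by (rule nn_integral_cong) (rule inner)
  also have "\<dots> = ennreal ((2 * pi) ^ n) * (\<integral>\<^sup>+A. border_kernel n F (eigs n A) \<partial>lborel_on (square n))"
    by (rule nn_integral_cmult[OF measurable_compose[OF measurable_eigs measurable_border_kernel[OF F]]])
  finally show ?thesis .
qed

text \<open>
  The factor \<open>vdm n mu\<close> of the density of the old spectrum is absorbed by \<open>nn_integral_arrow_roots\<close>, and exchanging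
  the order of integration leaves the integral over \<open>mu\<close> that defines \<open>gt_volume (Suc n)\<close>.
\<close>
lemma nn_integral_gt_step:
  assumes F: "F \<in> borel_measurable (lborel_on {..<Suc n})"
  shows "(\<integral>\<^sup>+mu. vdm_weighted n (\<lambda>mu. gt_volume n mu * border_kernel n F mu) mu \<partial>lborel_on {..<n})
    = (\<integral>\<^sup>+z. vdm_weighted (Suc n) (\<lambda>z. gt_volume (Suc n) z * F z) z \<partial>lborel_on {..<Suc n})"
proof -
  let ?P = "lborel_on {..<n} \<Otimes>\<^sub>M lborel_on {..<Suc n}"
  define h where "h mu = (if strict_incr n mu then gt_volume n mu else 0)" for mu
  define Q where "Q mu z = vdm_weighted (Suc n) (\<lambda>z. if interlaces n mu z then F z else 0) z" for mu z
  define R where "R mu z = (if strict_incr n mu \<and> interlaces n mu z then gt_volume n mu else 0)" for mu z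
  interpret s1: sigma_finite_measure "lborel_on {..<n}" by (rule sigma_finite_lborel_on) simp
  interpret s2: sigma_finite_measure "lborel_on {..<Suc n}" by (rule sigma_finite_lborel_on) simp
  interpret pf: pair_sigma_finite "lborel_on {..<n}" "lborel_on {..<Suc n}" ..
  have m: "(\<lambda>p. fst p k) \<in> borel_measurable ?P" if "k < n" for k
    by (rule measurable_compose[OF measurable_fst measurable_component_lborel[OF that]])
  have z: "(\<lambda>p. snd p k) \<in> borel_measurable ?P" if "k \<le> n" for k
    by (rule measurable_compose[OF measurable_snd measurable_component_lborel]) (use that in simp)
  have VF: "vdm_weighted (Suc n) F \<in> borel_measurable (lborel_on {..<Suc n})" by (rule measurable_vdm_weighted[OF F])
  have [measurable]: "Measurable.pred ?P (\<lambda>p. interlaces n (fst p) (snd p))"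
    by (rule measurable_interlaces) (rule m z, assumption)+
  have [measurable]: "Measurable.pred ?P (\<lambda>p. strict_incr n (fst p))"
    by (rule measurable_strict_incr) (rule m)
  have [measurable]: "(\<lambda>p. gt_volume n (fst p)) \<in> borel_measurable ?P"
    by (rule measurable_compose[OF measurable_fst measurable_gt_volume])
  have [measurable]: "(\<lambda>p. vdm_weighted (Suc n) F (snd p)) \<in> borel_measurable ?P"
    by (rule measurable_compose[OF measurable_snd VF])
  have hQ: "h mu * Q mu z = vdm_weighted (Suc n) F z * R mu z" for mu z
    unfolding h_def Q_def R_def vdm_weighted_def
    by (cases "strict_incr n mu"; cases "interlaces n mu z"; cases "strict_incr (Suc n) z") (simp_all add: mult.commute)
  have pair: "(\<lambda>p. vdm_weighted (Suc n) F (snd p) * R (fst p) (snd p)) \<in> borel_measurable ?P"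
    unfolding R_def by measurable
  have Rz: "(\<lambda>mu. R mu z) \<in> borel_measurable (lborel_on {..<n})" for z
  proof -
    have [measurable]: "Measurable.pred (lborel_on {..<n}) (\<lambda>mu. interlaces n mu z)"
      by (rule measurable_interlaces) (simp_all add: measurable_component_lborel)
    have [measurable]: "Measurable.pred (lborel_on {..<n}) (\<lambda>mu. strict_incr n mu)"
      by (rule measurable_strict_incr) (rule measurable_component_lborel)
    note measurable_gt_volume[measurable]
    show ?thesis unfolding R_def by measurable
  qed
  have Qm: "Q mu \<in> borel_measurable (lborel_on {..<Suc n})" for mu
  proof -
    note F[measurable]
    have [measurable]: "Measurable.pred (lborel_on {..<Suc n}) (interlaces n mu)"
      by (rule measurable_interlaces) (simp_all add: measurable_component_lborel)
    have "(\<lambda>z. if interlaces n mu z then F z else 0) \<in> borel_measurable (lborel_on {..<Suc n})" by measurable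
    from measurable_vdm_weighted[OF this] show ?thesis unfolding Q_def[abs_def] .
  qed
  have pt: "vdm_weighted n (\<lambda>mu. gt_volume n mu * border_kernel n F mu) mu
    = (\<integral>\<^sup>+z. vdm_weighted (Suc n) F z * R mu z \<partial>lborel_on {..<Suc n})" for mu
  proof -
    have "vdm_weighted n (\<lambda>mu. gt_volume n mu * border_kernel n F mu) mu
      = h mu * (\<integral>\<^sup>+z. Q mu z \<partial>lborel_on {..<Suc n})"
    proof (cases "strict_incr n mu")
      case True
      have "ennreal (vdm n mu) * border_kernel n F mu = (\<integral>\<^sup>+z. Q mu z \<partial>lborel_on {..<Suc n})"
        unfolding border_kernel_def Q_def by (rule nn_integral_arrow_roots[OF F True])
      then show ?thesis unfolding vdm_weighted_def h_def if_P[OF True] by (metis mult.left_commute)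
    qed (simp add: vdm_weighted_def h_def)
    also have "\<dots> = (\<integral>\<^sup>+z. h mu * Q mu z \<partial>lborel_on {..<Suc n})"
      by (rule nn_integral_cmult[OF Qm, symmetric])
    finally show ?thesis unfolding hQ .
  qed
  have "(\<integral>\<^sup>+mu. vdm_weighted n (\<lambda>mu. gt_volume n mu * border_kernel n F mu) mu \<partial>lborel_on {..<n})
    = (\<integral>\<^sup>+mu. \<integral>\<^sup>+z. vdm_weighted (Suc n) F z * R mu z \<partial>lborel_on {..<Suc n} \<partial>lborel_on {..<n})"
    unfolding pt ..
  also have "\<dots> = (\<integral>\<^sup>+z. \<integral>\<^sup>+mu. vdm_weighted (Suc n) F z * R mu z \<partial>lborel_on {..<n} \<partial>lborel_on {..<Suc n})"
    by (rule pf.Fubini'[symmetric]) (simp only: case_prod_beta' pair)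
  also have "\<dots> = (\<integral>\<^sup>+z. vdm_weighted (Suc n) F z * gt_volume (Suc n) z \<partial>lborel_on {..<Suc n})"
  proof (rule nn_integral_cong)
    fix z
    have "(\<integral>\<^sup>+mu. R mu z \<partial>lborel_on {..<n}) = gt_volume (Suc n) z" by (simp add: R_def)
    then show "(\<integral>\<^sup>+mu. vdm_weighted (Suc n) F z * R mu z \<partial>lborel_on {..<n}) = vdm_weighted (Suc n) F z * gt_volume (Suc n) z"
      unfolding nn_integral_cmult[OF Rz] by (simp only:)
  qed
  also have "\<dots> = (\<integral>\<^sup>+z. vdm_weighted (Suc n) (\<lambda>z. gt_volume (Suc n) z * F z) z \<partial>lborel_on {..<Suc n})"
    by (rule nn_integral_cong) (simp add: vdm_weighted_def mult_ac del: gt_volume.simps)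
  finally show ?thesis .
qed

text \<open>
  The image of Lebesgue measure on Hermitian matrices under the ordered spectrum. The Gaussian
  weight enters only later, through \<open>F\<close>, since it depends on the matrix only through its eigenvalues.
\<close>
theorem nn_integral_eigs:
  assumes "F \<in> borel_measurable (lborel_on {..<n})"
  shows "(\<integral>\<^sup>+Y. F (eigs n Y) \<partial>lborel_on (square n))
    = ennreal (\<Prod>k<n. (2 * pi) ^ k) * (\<integral>\<^sup>+z. vdm_weighted n (\<lambda>z. gt_volume n z * F z) z \<partial>lborel_on {..<n})"
  using assms
proof (induction n arbitrary: F)
  case 0
  have "square 0 = {}" by simp
  then show ?case
    by (simp add: lborel_prod.nn_integral_empty eigs_def vdm_weighted_def strict_incr_def vdm_def del: nn_integral_const)
next
  case (Suc n)
  note K = measurable_border_kernel[OF Suc.prems]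
  have c: "ennreal (\<Prod>k<Suc n. (2 * pi) ^ k) = ennreal ((2 * pi) ^ n) * ennreal (\<Prod>k<n. (2 * pi) ^ k)"
    unfolding prod.lessThan_Suc by (subst mult.commute) (rule ennreal_mult, simp_all add: prod_nonneg)
  show ?case
    unfolding nn_integral_eigs_Suc[OF Suc.prems] Suc.IH[OF K] nn_integral_gt_step[OF Suc.prems] c
    by (rule mult.assoc[symmetric])
qed

section \<open>Log-concavity of the eigenvalue density\<close>

lemma pl_le_mult:
  assumes pl: "pl_le l u v w" and p: "0 < p" "0 < q" and r: "p powr l * q powr (1 - l) \<le> r"
  shows "pl_le l (ennreal p * u) (ennreal q * v) (ennreal r * w)"
  unfolding pl_le_def
proof (intro allI impI)
  fix a b :: real assume ab: "0 < a" "0 < b" and a: "ennreal a \<le> ennreal p * u" and b: "ennreal b \<le> ennreal q * v"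
  have div: "ennreal (s / t) \<le> k" if "0 < s" "0 < t" "ennreal s \<le> ennreal t * k" for s t k
  proof (cases k)
    case (real k')
    then have "s \<le> t * k'" using that by (simp flip: ennreal_mult add: ennreal_le_iff)
    then show ?thesis using that real by (simp add: ennreal_le_iff field_simps)
  qed simp
  have "ennreal ((a / p) powr l * (b / q) powr (1 - l)) \<le> w"
    using pl[unfolded pl_le_def, rule_format, of "a / p" "b / q"] div[OF ab(1) p(1) a] div[OF ab(2) p(2) b] ab p by simp
  moreover have "a powr l * b powr (1 - l) = (p powr l * q powr (1 - l)) * ((a / p) powr l * (b / q) powr (1 - l))"
    using ab p by (simp add: powr_divide)
  moreover have "(p powr l * q powr (1 - l)) * ((a / p) powr l * (b / q) powr (1 - l)) \<le> r * ((a / p) powr l * (b / q) powr (1 - l))"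
    by (rule mult_right_mono[OF r]) simp
  moreover have "0 \<le> r" using r by (meson mult_nonneg_nonneg order_trans powr_ge_zero)
  ultimately show "ennreal (a powr l * b powr (1 - l)) \<le> ennreal r * w"
    by (metis ennreal_leI ennreal_mult' mult_left_mono order_trans zero_le)
qed

lemma pl_le_if:
  assumes "P \<Longrightarrow> Q \<Longrightarrow> R \<and> pl_le l u v w"
  shows "pl_le l (if P then u else 0) (if Q then v else 0) (if R then w else 0)"
  using assms by (cases P; cases Q) (auto simp: pl_le_def)

abbreviation cconv :: "real \<Rightarrow> nat \<Rightarrow> (nat \<Rightarrow> real) \<Rightarrow> (nat \<Rightarrow> real) \<Rightarrow> nat \<Rightarrow> real" where
  "cconv l n x y \<equiv> \<lambda>i\<in>{..<n}. l * x i + (1 - l) * y i"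

lemma convex_comb_less:
  fixes l :: real
  assumes "0 < l" "l < 1" "a < b" "c < d"
  shows "l * a + (1 - l) * c < l * b + (1 - l) * d"
  using assms by (intro add_strict_mono) simp_all

lemma strict_incr_cconv:
  assumes "0 < l" "l < 1" "strict_incr n x" "strict_incr n y"
  shows "strict_incr n (cconv l n x y)"
  using assms unfolding strict_incr_def by (auto intro!: convex_comb_less)

lemma interlaces_cconv:
  assumes "0 < l" "l < 1" "interlaces n mu x" "interlaces n nu y"
  shows "interlaces n (cconv l n mu nu) (cconv l (Suc n) x y)"
  using assms unfolding interlaces_def by (auto intro!: convex_comb_less)

text \<open>
  The indicator of interlacing patterns satisfies the hypothesis of the Prekopa-Leindler inequality, as the
  pattern conditions are linear inequalities in the two rows jointly.
\<close>
lemma pl_le_gt_volume: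
  assumes l: "0 < l" "l < 1"
  shows "pl_le l (gt_volume n x) (gt_volume n y) (gt_volume n (cconv l n x y))"
proof (induction n arbitrary: x y)
  case 0
  have "a powr l * b powr (1 - l) \<le> 1" if "0 < a" "a \<le> 1" "0 < b" "b \<le> 1" for a b :: real
    using that l by (intro mult_le_one) (simp_all add: powr_le1)
  then show ?case by (simp add: pl_le_def)
next
  case (Suc n)
  define D where "D z mu = (if strict_incr n mu \<and> interlaces n mu z then gt_volume n mu else 0)" for z mu
  have m: "D z \<in> borel_measurable (lborel_on {..<n})" for z
  proof -
    have [measurable]: "Measurable.pred (lborel_on {..<n}) (\<lambda>p. strict_incr n p)"
      by (rule measurable_strict_incr) (rule measurable_component_lborel)
    have [measurable]: "Measurable.pred (lborel_on {..<n}) (\<lambda>p. interlaces n p z)"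
      by (rule measurable_interlaces) (rule measurable_component_lborel, assumption, simp)
    note [measurable] = measurable_gt_volume
    show ?thesis unfolding D_def by measurable
  qed
  have "pl_le l (\<integral>\<^sup>+mu. D x mu \<partial>lborel_on {..<n}) (\<integral>\<^sup>+mu. D y mu \<partial>lborel_on {..<n})
     (\<integral>\<^sup>+mu. D (cconv l (Suc n) x y) mu \<partial>lborel_on {..<n})"
  proof (rule prekopa_leindler[OF _ l m m m])
    fix mu nu :: "nat \<Rightarrow> real"
    show "pl_le l (D x mu) (D y nu) (D (cconv l (Suc n) x y) (cconv l n mu nu))"
      unfolding D_def
    proof (rule pl_le_if)
      assume "strict_incr n mu \<and> interlaces n mu x" "strict_incr n nu \<and> interlaces n nu y"
      then show "(strict_incr n (cconv l n mu nu) \<and> interlaces n (cconv l n mu nu) (cconv l (Suc n) x y)) \<and>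
        pl_le l (gt_volume n mu) (gt_volume n nu) (gt_volume n (cconv l n mu nu))"
        using strict_incr_cconv[OF l] interlaces_cconv[OF l] Suc.IH by blast
    qed
  qed simp
  then show ?case by (simp only: D_def gt_volume.simps)
qed

text \<open>
  Each factor is a positive linear form, so the weighted inequality of arithmetic and geometric means
  applies factor by factor.
\<close>
lemma vdm_log_concave:
  assumes l: "0 < l" "l < 1" and s: "strict_incr n x" "strict_incr n y"
  shows "vdm n x powr l * vdm n y powr (1 - l) \<le> vdm n (cconv l n x y)"
proof -
  have "vdm n x powr l * vdm n y powr (1 - l)
    = (\<Prod>j<n. \<Prod>i<j. (x j - x i) powr l * (y j - y i) powr (1 - l))"
    by (simp only: vdm_def prod_powr_distrib prod.distrib)
  also have "\<dots> \<le> (\<Prod>j<n. \<Prod>i<j. cconv l n x y j - cconv l n x y i)"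
  proof (intro prod_mono conjI prod_nonneg ballI mult_nonneg_nonneg powr_ge_zero)
    fix j i assume ji: "j \<in> {..<n}" "i \<in> {..<j}"
    have "(x j - x i) powr l * (y j - y i) powr (1 - l) \<le> l * (x j - x i) + (1 - l) * (y j - y i)"
      by (rule weighted_am_gm) (use ji s l in \<open>auto simp: strict_incr_def\<close>)
    also have "\<dots> = cconv l n x y j - cconv l n x y i" using ji by (simp add: algebra_simps)
    finally show "(x j - x i) powr l * (y j - y i) powr (1 - l) \<le> cconv l n x y j - cconv l n x y i" .
  qed
  finally show ?thesis by (simp only: vdm_def)
qed

lemma gauss_log_concave:
  assumes l: "0 < l" "l < 1"
  shows "exp (- (\<Sum>k<n. (x k)\<^sup>2)) powr l * exp (- (\<Sum>k<n. (y k)\<^sup>2)) powr (1 - l)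
     \<le> exp (- (\<Sum>k<n. (cconv l n x y k)\<^sup>2))"
proof -
  have sq: "(l * s + (1 - l) * t)\<^sup>2 \<le> l * s\<^sup>2 + (1 - l) * t\<^sup>2" for s t :: real
  proof -
    have "l * s\<^sup>2 + (1 - l) * t\<^sup>2 - (l * s + (1 - l) * t)\<^sup>2 = l * (1 - l) * (s - t)\<^sup>2"
      by (simp add: power2_eq_square algebra_simps)
    moreover have "0 \<le> l * (1 - l) * (s - t)\<^sup>2" using l by simp
    ultimately show ?thesis by linarith
  qed
  have "(\<Sum>k<n. (cconv l n x y k)\<^sup>2) \<le> (\<Sum>k<n. l * (x k)\<^sup>2 + (1 - l) * (y k)\<^sup>2)"
    by (rule sum_mono) (simp add: sq)
  also have "\<dots> = l * (\<Sum>k<n. (x k)\<^sup>2) + (1 - l) * (\<Sum>k<n. (y k)\<^sup>2)"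
    by (simp only: sum.distrib sum_distrib_left)
  finally show ?thesis by (simp add: exp_powr_real mult_ac flip: exp_add)
qed

text \<open>
  The unnormalised density of the ordered spectrum.
\<close>
definition eig_density :: "nat \<Rightarrow> (nat \<Rightarrow> real) \<Rightarrow> ennreal" where
  "eig_density n = vdm_weighted n (\<lambda>z. gt_volume n z * ennreal (exp (- (\<Sum>k<n. (z k)\<^sup>2))))"

lemma measurable_gauss:
  "(\<lambda>z::nat \<Rightarrow> real. ennreal (exp (- (\<Sum>k<n. (z k)\<^sup>2)))) \<in> borel_measurable (lborel_on {..<n})"
proof -
  have "(\<lambda>z::nat \<Rightarrow> real. (z k)\<^sup>2) \<in> borel_measurable (lborel_on {..<n})" if "k \<in> {..<n}" for k :: nat
    using measurable_component_lborel[of k n] that by (intro borel_measurable_power) simp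
  then have [measurable]: "(\<lambda>z::nat \<Rightarrow> real. \<Sum>k<n. (z k)\<^sup>2) \<in> borel_measurable (lborel_on {..<n})"
    by (rule borel_measurable_sum)
  show ?thesis by measurable
qed

lemma measurable_eig_density: "eig_density n \<in> borel_measurable (lborel_on {..<n})"
  unfolding eig_density_def
  by (rule measurable_vdm_weighted) (rule borel_measurable_times_ennreal[OF measurable_gt_volume measurable_gauss])

lemma pl_le_eig_density:
  assumes l: "0 < l" "l < 1"
  shows "pl_le l (eig_density n x) (eig_density n y) (eig_density n (cconv l n x y))"
  unfolding eig_density_def vdm_weighted_def
proof (rule pl_le_if, rule conjI)
  assume s: "strict_incr n x" "strict_incr n y"
  show "strict_incr n (cconv l n x y)" by (rule strict_incr_cconv[OF l s])
  have "pl_le l (ennreal (exp (- (\<Sum>k<n. (x k)\<^sup>2))) * gt_volume n x) (ennreal (exp (- (\<Sum>k<n. (y k)\<^sup>2))) * gt_volume n y)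
    (ennreal (exp (- (\<Sum>k<n. (cconv l n x y k)\<^sup>2))) * gt_volume n (cconv l n x y))"
    by (rule pl_le_mult[OF pl_le_gt_volume[OF l] exp_gt_zero exp_gt_zero gauss_log_concave[OF l]])
  from pl_le_mult[OF this vdm_pos[OF s(1)] vdm_pos[OF s(2)] vdm_log_concave[OF l s]]
  show "pl_le l (ennreal (vdm n x) * (gt_volume n x * ennreal (exp (- (\<Sum>k<n. (x k)\<^sup>2)))))
    (ennreal (vdm n y) * (gt_volume n y * ennreal (exp (- (\<Sum>k<n. (y k)\<^sup>2)))))
    (ennreal (vdm n (cconv l n x y)) * (gt_volume n (cconv l n x y) * ennreal (exp (- (\<Sum>k<n. (cconv l n x y k)\<^sup>2)))))"
    by (simp only: mult.commute[of "ennreal (exp _)"])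
qed

lemma pl_le_marginal:
  fixes psi :: "(nat \<Rightarrow> real) \<Rightarrow> real"
  assumes l: "0 < l" "l < 1" and psi: "psi \<in> borel_measurable (lborel_on {..<n})"
    and lin: "\<And>x y. psi (cconv l n x y) = l * psi x + (1 - l) * psi y"
    and sets: "A \<in> sets borel" "B \<in> sets borel" "C \<in> sets borel"
    and AB: "\<And>a b. a \<in> A \<Longrightarrow> b \<in> B \<Longrightarrow> l * a + (1 - l) * b \<in> C"
  shows "pl_le l (\<integral>\<^sup>+z. (if psi z \<in> A then eig_density n z else 0) \<partial>lborel_on {..<n})
     (\<integral>\<^sup>+z. (if psi z \<in> B then eig_density n z else 0) \<partial>lborel_on {..<n})
     (\<integral>\<^sup>+z. (if psi z \<in> C then eig_density n z else 0) \<partial>lborel_on {..<n})"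
proof -
  have m: "(\<lambda>z. if psi z \<in> S then eig_density n z else 0) \<in> borel_measurable (lborel_on {..<n})" if "S \<in> sets borel" for S
  proof -
    note [measurable] = psi measurable_eig_density that
    show ?thesis by measurable
  qed
  show ?thesis
  proof (rule prekopa_leindler[OF _ l m[OF sets(1)] m[OF sets(2)] m[OF sets(3)]])
    fix x y :: "nat \<Rightarrow> real"
    show "pl_le l (if psi x \<in> A then eig_density n x else 0) (if psi y \<in> B then eig_density n y else 0)
       (if psi (cconv l n x y) \<in> C then eig_density n (cconv l n x y) else 0)"
      by (rule pl_le_if) (simp add: lin AB pl_le_eig_density[OF l])
  qed simp
qed

section \<open>Matrices over a finite index type\<close>

unbundle vec_syntax
no_notation Matrix.vec_index (infixl \<open>$\<close> 100)

text \<open>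
  An arbitrary enumeration of the index type, with inverse \<open>num\<close>. The results do not depend on it.
\<close>
definition idx :: "nat \<Rightarrow> 'n::finite" where
  "idx = (SOME e. bij_betw e {..<CARD('n)} UNIV)"

definition num :: "'n::finite \<Rightarrow> nat" where
  "num = inv_into {..<CARD('n)} idx"

lemma bij_betw_idx: "bij_betw (idx :: nat \<Rightarrow> 'n::finite) {..<CARD('n)} UNIV"
proof -
  obtain e :: "nat \<Rightarrow> 'n" where "bij_betw e {0..<CARD('n)} UNIV"
    using ex_bij_betw_nat_finite[of "UNIV :: 'n set"] by auto
  then have "bij_betw e {..<CARD('n)} UNIV" by (simp only: lessThan_atLeast0)
  then show ?thesis unfolding idx_def by (rule someI[of "\<lambda>e. bij_betw e {..<CARD('n)} UNIV"])
qed

lemma idx_num [simp]: "idx (num i) = i"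
  unfolding num_def by (rule f_inv_into_f) (use bij_betw_idx in \<open>auto simp: bij_betw_def\<close>)

lemma num_idx [simp]: "a < CARD('n) \<Longrightarrow> num (idx a :: 'n::finite) = a"
  unfolding num_def by (rule inv_into_f_f) (use bij_betw_idx in \<open>auto simp: bij_betw_def\<close>)

lemma num_less [simp]: "num (i :: 'n::finite) < CARD('n)"
  using inv_into_into[of i idx "{..<CARD('n)}"] bij_betw_idx[where 'n='n]
  by (simp add: num_def bij_betw_def)

definition vec_of :: "(nat \<times> nat \<Rightarrow> real) \<Rightarrow> real^'n^'n" where
  "vec_of Y = (\<chi> i j. Y (num i, num j))"

lemma bij_betw_matrix_Basis:
  "bij_betw (\<lambda>(a, b). axis (idx a) (axis (idx b) 1)) (square CARD('n)) (Basis :: (real^'n^'n) set)"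
proof -
  have 1: "bij_betw (\<lambda>(a, b). (idx a, idx b)) (square CARD('n)) (UNIV :: ('n \<times> 'n) set)"
    using bij_betw_map_prod[OF bij_betw_idx[where 'n='n] bij_betw_idx[where 'n='n]]
    by (simp add: map_prod_def)
  have 2: "bij_betw (\<lambda>(i, j). axis i (axis j 1)) (UNIV :: ('n \<times> 'n) set) (Basis :: (real^'n^'n) set)"
    by (auto simp: bij_betw_def inj_on_def axis_eq_axis Basis_vec_def)
  show ?thesis using bij_betw_trans[OF 1 2] by (simp add: comp_def case_prod_beta')
qed

lemma measurable_vec_of:
  "(vec_of :: _ \<Rightarrow> real^'n^'n) \<in> borel_measurable (lborel_on (square CARD('n)))"
proof (subst borel_measurable_euclidean_space, rule ballI)
  fix b :: "real^'n^'n" assume "b \<in> Basis"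
  then obtain i j where b: "b = axis i (axis j 1)" by (auto simp: Basis_vec_def)
  show "(\<lambda>Y. vec_of Y \<bullet> b) \<in> borel_measurable (lborel_on (square CARD('n)))"
    by (simp add: b inner_axis vec_of_def measurable_lborel_on_component)
qed

text \<open>
  Lebesgue measure on matrices over a finite type is the product of copies of the Lebesgue measure of the line, one for each
  entry; both agree on boxes.
\<close>
lemma distr_vec_of: "distr (lborel_on (square CARD('n))) borel vec_of = (lborel :: (real^'n^'n) measure)"
proof (rule lborel_eqI[symmetric])
  fix l u :: "real^'n^'n" assume lu: "\<And>b. b \<in> Basis \<Longrightarrow> l \<bullet> b \<le> u \<bullet> b"
  let ?g = "\<lambda>(a, b). axis (idx a) (axis (idx b) 1) :: real^'n^'n"
  let ?I = "square CARD('n)"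
  have "(\<forall>b\<in>Basis. l \<bullet> b < vec_of Y \<bullet> b \<and> vec_of Y \<bullet> b < u \<bullet> b)
      \<longleftrightarrow> (\<forall>p\<in>?I. l \<bullet> ?g p < Y p \<and> Y p < u \<bullet> ?g p)" for Y
  proof -
    have "vec_of Y \<bullet> ?g p = Y p" if pI: "p \<in> ?I" for p
    proof -
      obtain a b where p: "p = (a, b)" "a < CARD('n)" "b < CARD('n)" using pI by auto
      show ?thesis
        unfolding p(1) prod.case inner_axis vec_of_def vec_lambda_beta num_idx[OF p(2)] num_idx[OF p(3)]
        unfolding inner_real_def by (rule mult_1_right)
    qed
    then have iff: "(l \<bullet> ?g p < Y p \<and> Y p < u \<bullet> ?g p)
      \<longleftrightarrow> (l \<bullet> ?g p < vec_of Y \<bullet> ?g p \<and> vec_of Y \<bullet> ?g p < u \<bullet> ?g p)" if "p \<in> ?I" for p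
      using that by presburger
    have "(\<forall>p\<in>?I. l \<bullet> ?g p < Y p \<and> Y p < u \<bullet> ?g p)
      \<longleftrightarrow> (\<forall>p\<in>?I. l \<bullet> ?g p < vec_of Y \<bullet> ?g p \<and> vec_of Y \<bullet> ?g p < u \<bullet> ?g p)"
      by (rule ball_cong[OF refl iff])
    also have "\<dots> \<longleftrightarrow> (\<forall>b\<in>?g ` ?I. l \<bullet> b < vec_of Y \<bullet> b \<and> vec_of Y \<bullet> b < u \<bullet> b)"
      by (rule Set.ball_simps(9)[symmetric])
    also have "?g ` ?I = Basis" using bij_betw_matrix_Basis[where 'n='n] by (simp add: bij_betw_def)
    finally show ?thesis by (rule sym)
  qed
  then have vim: "vec_of -` box l u \<inter> space (lborel_on ?I) = PiE ?I (\<lambda>p. {l \<bullet> ?g p <..< u \<bullet> ?g p})"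
    unfolding set_eq_iff Int_iff vimage_eq mem_box space_PiM PiE_iff space_lborel space_borel greaterThanLessThan_iff
    by blast
  have "emeasure (distr (lborel_on ?I) borel vec_of) (box l u)
    = emeasure (lborel_on ?I) (PiE ?I (\<lambda>p. {l \<bullet> ?g p <..< u \<bullet> ?g p}))"
    by (subst emeasure_distr[OF measurable_vec_of]) (simp_all add: vim)
  also have "\<dots> = (\<Prod>p\<in>?I. emeasure lborel {l \<bullet> ?g p <..< u \<bullet> ?g p})"
    by (rule lborel_prod.emeasure_PiM) simp_all
  also have "\<dots> = (\<Prod>p\<in>?I. ennreal ((u - l) \<bullet> ?g p))"
  proof (rule prod.cong[OF refl])
    fix p assume "p \<in> ?I"
    then have "?g p \<in> Basis" using bij_betw_matrix_Basis[where 'n='n] by (auto simp: bij_betw_def)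
    from lu[OF this] show "emeasure lborel {l \<bullet> ?g p <..< u \<bullet> ?g p} = ennreal ((u - l) \<bullet> ?g p)"
      by (simp add: inner_diff_left)
  qed
  also have "\<dots> = (\<Prod>b\<in>Basis. ennreal ((u - l) \<bullet> b))"
    by (rule prod.reindex_bij_betw[OF bij_betw_matrix_Basis])
  also have "\<dots> = ennreal (\<Prod>b\<in>Basis. (u - l) \<bullet> b)"
    by (rule prod_ennreal) (simp add: inner_diff_left lu)
  finally show "emeasure (distr (lborel_on ?I) borel vec_of) (box l u) = ennreal (\<Prod>b\<in>Basis. (u - l) \<bullet> b)" .
qed simp

text \<open>
  Conjugation by \<open>idx\<close> identifies the permutations of the index type with those of \<open>{0..<N}\<close> and preserves
  signs. This connects the two notions of determinant, hence of characteristic polynomial.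
\<close>
lemma det_reindex:
  fixes A :: "'a::comm_ring_1^'n^'n"
  assumes B: "B \<in> carrier_mat CARD('n) CARD('n)" and AB: "\<And>i j. A $ i $ j = B $$ (num i, num j)"
  shows "Determinants.det A = det B"
proof -
  let ?N = "{0..<CARD('n)}"
  have e: "bij_betw (idx :: nat \<Rightarrow> 'n) ?N UNIV" using bij_betw_idx[where 'n='n] by (simp only: lessThan_atLeast0)
  then have inj: "inj_on (idx :: nat \<Rightarrow> 'n) ?N" and im: "(idx :: nat \<Rightarrow> 'n) ` ?N = UNIV" by (simp_all add: bij_betw_def)
  let ?q = "map_permutation ?N (idx :: nat \<Rightarrow> 'n)"
  have "?q p = (\<lambda>x. if x \<in> UNIV then idx (p (inv_into ?N idx x)) else x)" for p
    unfolding map_permutation_def im by (simp add: restrict_id_def fun_eq_iff)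
  then have bij: "bij_betw ?q {p. p permutes ?N} {p. p permutes UNIV}"
    using bij_betw_permutations[OF e] by presburger
  have "Determinants.det A = (\<Sum>p\<in>{p. p permutes ?N}. of_int (sign (?q p)) * (\<Prod>i\<in>UNIV. A $ i $ ?q p i))"
    unfolding Determinants.det_def by (rule sum.reindex_bij_betw[OF bij, symmetric])
  also have "\<dots> = (\<Sum>p\<in>{p. p permutes ?N}. signof p * (\<Prod>a\<in>?N. B $$ (a, p a)))"
  proof (rule sum.cong[OF refl])
    fix p assume p: "p \<in> {p. p permutes ?N}"
    have "(\<Prod>i\<in>UNIV. A $ i $ ?q p i) = (\<Prod>a\<in>?N. A $ idx a $ ?q p (idx a))"
      by (rule prod.reindex_bij_betw[OF e, symmetric])
    also have "\<dots> = (\<Prod>a\<in>?N. B $$ (a, p a))"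
    proof (rule prod.cong[OF refl])
      fix a assume a: "a \<in> ?N"
      then have "p a \<in> ?N" using p by (simp only: mem_Collect_eq permutes_in_image)
      then show "A $ idx a $ ?q p (idx a) = B $$ (a, p a)"
        using a by (simp add: AB map_permutation_apply[OF inj a])
    qed
    finally show "of_int (sign (?q p)) * (\<Prod>i\<in>UNIV. A $ i $ ?q p i) = signof p * (\<Prod>a\<in>?N. B $$ (a, p a))"
      using sign_map_permutation[OF inj, of p] p by simp
  qed
  finally show ?thesis by (simp only: det_def'[OF B])
qed

lemma herm_of_vec_of: "herm_of (vec_of Y :: real^'n^'n) $ i $ j = hmat CARD('n) Y $$ (num i, num j)"
  by (simp add: herm_of_def vec_of_def hmat_def)

lemma charpoly_herm_of:
  "charpoly (herm_of (vec_of Y :: real^'n^'n)) = char_poly (hmat CARD('n) Y)"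
  unfolding charpoly_def char_poly_def
proof (rule det_reindex)
  show "char_poly_matrix (hmat CARD('n) Y) \<in> carrier_mat CARD('n) CARD('n)"
    by (rule char_poly_matrix_closed[OF hmat_carrier])
  fix i j :: 'n
  have inj: "num i = num j \<longleftrightarrow> i = j" by (metis idx_num)
  show "(\<chi> i j. (if i = j then [:0, 1:] else 0) - [:herm_of (vec_of Y) $ i $ j:]) $ i $ j
     = char_poly_matrix (hmat CARD('n) Y) $$ (num i, num j)"
    using carrier_matD[OF hmat_carrier[of "CARD('n)" Y]] by (simp add: herm_of_vec_of char_poly_matrix_def inj)
qed

text \<open>
  The roots of the characteristic polynomial are already known to be real and in increasing order, so sorting their
  multiset returns the same list.
\<close>
lemma ordered_eigenvalue_herm_of:
  assumes k: "1 \<le> k" "k \<le> CARD('n)"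
  shows "ordered_eigenvalue k (herm_of (vec_of Y :: real^'n^'n)) = eigs CARD('n) Y (k - 1)"
proof -
  let ?N = "CARD('n)"
  note ch = char_poly_hermitian(1,2)[OF hmat_carrier[of ?N Y] adj_hmat[of ?N Y], folded eigs_def]
  have "proots (charpoly (herm_of (vec_of Y :: real^'n^'n))) = (\<Sum>i<?N. {#complex_of_real (eigs ?N Y i)#})"
    by (simp add: charpoly_herm_of ch(1) proots_prod)
  moreover have "image_mset Re (\<Sum>i<n. {#complex_of_real (f i)#}) = mset (map f [0..<n])" for f n
    by (induction n) simp_all
  ultimately have "eigenvalue_list (herm_of (vec_of Y :: real^'n^'n)) = sort (map (eigs ?N Y) [0..<?N])"
    by (simp only: eigenvalue_list_def sorted_list_of_multiset_mset)
  also have "\<dots> = map (eigs ?N Y) [0..<?N]"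
    by (rule sorted_sort_id) (use ch(2) in \<open>auto simp: sorted_iff_nth_mono\<close>)
  finally show ?thesis using k by (simp add: ordered_eigenvalue_def)
qed

lemma trace_mult_swap:
  fixes A B :: "complex mat"
  assumes "A \<in> carrier_mat n n" "B \<in> carrier_mat n n"
  shows "(\<Sum>a<n. (A * B) $$ (a, a)) = (\<Sum>a<n. (B * A) $$ (a, a))"
proof -
  have "(\<Sum>a<n. (A * B) $$ (a, a)) = (\<Sum>a<n. \<Sum>b<n. A $$ (a, b) * B $$ (b, a))"
    by (rule sum.cong[OF refl]) (simp add: mat_mult_entry[OF assms])
  also have "\<dots> = (\<Sum>b<n. \<Sum>a<n. A $$ (a, b) * B $$ (b, a))" by (rule sum.swap)
  also have "\<dots> = (\<Sum>b<n. (B * A) $$ (b, b))"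
    by (rule sum.cong[OF refl]) (simp add: mat_mult_entry[OF assms(2,1)] mult.commute)
  finally show ?thesis .
qed

text \<open>
  The trace of the square is invariant under unitary conjugation.
\<close>
lemma trace_square_eigenvalues:
  assumes H: "H \<in> carrier_mat n n" "adj H = H"
  shows "(\<Sum>a<n. (H * H) $$ (a, a)) = complex_of_real (\<Sum>k<n. (roots n (hcoeffs n H) k)\<^sup>2)"
proof -
  obtain U where U: "U \<in> carrier_mat n n" "adj U * U = 1\<^sub>m n"
    and D: "adj U * H * U = mat_diag n (\<lambda>i. complex_of_real (roots n (hcoeffs n H) i))"
    using spectral_roots[OF H] by blast
  let ?D = "mat_diag n (\<lambda>i. complex_of_real (roots n (hcoeffs n H) i))"
  have aU: "adj U \<in> carrier_mat n n" using U(1) by simp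
  have UU: "U * adj U = 1\<^sub>m n" by (rule mat_mult_left_right_inverse[OF aU U(1,2)])
  have mc: "A * B \<in> carrier_mat n n" if "A \<in> carrier_mat n n" "B \<in> carrier_mat n n" for A B :: "complex mat"
    using that by (rule mult_carrier_mat)
  have as: "A * B * C = A * (B * C)"
    if "A \<in> carrier_mat n n" "B \<in> carrier_mat n n" "C \<in> carrier_mat n n" for A B C :: "complex mat"
    using that by (rule assoc_mult_mat)
  have "?D * ?D = adj U * H * (U * adj U) * (H * U)"
    unfolding D[symmetric] by (simp only: as mc aU U(1) H(1))
  also have "\<dots> = adj U * (H * H * U)"
    unfolding UU right_mult_one_mat[OF mc[OF aU H(1)]] by (simp only: as mc aU U(1) H(1))
  finally have "(\<Sum>a<n. (?D * ?D) $$ (a, a)) = (\<Sum>a<n. (H * H * U * adj U) $$ (a, a))"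
    using trace_mult_swap[OF aU mc[OF mc[OF H(1) H(1)] U(1)]] by (simp only:)
  also have "H * H * U * adj U = H * H"
    unfolding as[OF mc[OF H(1) H(1)] U(1) aU] UU by (rule right_mult_one_mat[OF mc[OF H(1) H(1)]])
  finally have "(\<Sum>a<n. (H * H) $$ (a, a)) = (\<Sum>a<n. (?D * ?D) $$ (a, a))" by (rule sym)
  also have "\<dots> = (\<Sum>a<n. complex_of_real ((roots n (hcoeffs n H) a)\<^sup>2))"
    by (rule sum.cong[OF refl], subst mat_diag_diag) (simp add: mat_diag_def power2_eq_square)
  finally show ?thesis by (simp only: of_real_sum)
qed

lemma trace_herm_of:
  "Re (trace (herm_of (vec_of Y :: real^'n^'n) ** herm_of (vec_of Y))) = (\<Sum>k<CARD('n). (eigs CARD('n) Y k)\<^sup>2)"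
proof -
  let ?N = "CARD('n)" and ?H = "hmat CARD('n) Y"
  have r: "(\<Sum>i\<in>UNIV. f (num (i :: 'n))) = (\<Sum>a<?N. f a)" for f :: "nat \<Rightarrow> complex"
    using sum.reindex_bij_betw[OF bij_betw_idx[where 'n='n], of "\<lambda>i. f (num i)"] by simp
  have "trace (herm_of (vec_of Y :: real^'n^'n) ** herm_of (vec_of Y))
    = (\<Sum>i\<in>UNIV. \<Sum>k\<in>UNIV. ?H $$ (num (i :: 'n), num (k :: 'n)) * ?H $$ (num k, num i))"
    by (simp only: trace_def matrix_matrix_mult_def vec_lambda_beta herm_of_vec_of)
  also have "\<dots> = (\<Sum>a<?N. \<Sum>b<?N. ?H $$ (a, b) * ?H $$ (b, a))"
    unfolding r[of "\<lambda>a. \<Sum>k\<in>UNIV. ?H $$ (a, num (k :: 'n)) * ?H $$ (num k, a)"]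
  proof (rule sum.cong[OF refl])
    show "(\<Sum>k\<in>UNIV. ?H $$ (a, num (k :: 'n)) * ?H $$ (num k, a)) = (\<Sum>b<?N. ?H $$ (a, b) * ?H $$ (b, a))" for a
      by (rule r[of "\<lambda>b. ?H $$ (a, b) * ?H $$ (b, a)"])
  qed
  also have "\<dots> = (\<Sum>a<?N. (?H * ?H) $$ (a, a))"
    by (rule sum.cong[OF refl], rule mat_mult_entry[OF hmat_carrier hmat_carrier, symmetric]) simp_all
  also have "\<dots> = complex_of_real (\<Sum>k<?N. (eigs ?N Y k)\<^sup>2)"
    unfolding eigs_def by (rule trace_square_eigenvalues[OF hmat_carrier adj_hmat])
  finally have "Re (trace (herm_of (vec_of Y :: real^'n^'n) ** herm_of (vec_of Y)))
    = Re (complex_of_real (\<Sum>k<?N. (eigs ?N Y k)\<^sup>2))" by (rule arg_cong)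
  then show ?thesis unfolding Re_complex_of_real .
qed

section \<open>The law of an eigengap\<close>

text \<open>
  The inverse of \<open>herm_of\<close> on Hermitian matrices. It is defined and measurable on all matrices, which
  is used to replace \<open>eigengap\<close> by a Borel function with the same values on Hermitian matrices.
\<close>
definition herm_coords :: "complex^'n^'n \<Rightarrow> nat \<times> nat \<Rightarrow> real" where
  "herm_coords A = (\<lambda>(a, b). Re (A $ idx a $ idx b) + Im (A $ idx a $ idx b))"

lemma herm_of_coords:
  assumes A: "hermitian A"
  shows "herm_of (vec_of (herm_coords A)) = (A :: complex^'n^'n)"
proof -
  have v: "vec_of (herm_coords A) = (\<chi> i j. Re (A $ i $ j) + Im (A $ i $ j))"
    by (simp add: vec_of_def herm_coords_def)
  have "herm_of (vec_of (herm_coords A)) $ i $ j = A $ i $ j" for i j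
  proof -
    have "A $ j $ i = cnj (A $ i $ j)" using A unfolding hermitian_def by blast
    then show ?thesis by (simp add: v herm_of_def complex_eq_iff)
  qed
  then show ?thesis by (simp add: Finite_Cartesian_Product.vec_eq_iff)
qed

lemma measurable_eigs_herm_coords:
  "k < CARD('n) \<Longrightarrow> (\<lambda>A :: complex^'n^'n. eigs CARD('n) (herm_coords A) k) \<in> borel_measurable borel"
proof (rule measurable_compose[OF measurable_eigs_compose measurable_component_lborel])
  fix i j :: nat
  show "(\<lambda>A :: complex^'n^'n. herm_coords A (i, j)) \<in> borel_measurable borel"
    unfolding herm_coords_def prod.case
    by (rule borel_measurable_continuous_onI) (intro continuous_intros)
qed

lemma eigengap_herm_of:
  assumes i: "1 \<le> i" "i \<le> CARD('n) - 1"
  shows "eigengap i (herm_of (vec_of Y :: real^'n^'n))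
    = sqrt (real CARD('n) / 2) * semicircle_density (semicircle_quantile (real i / real CARD('n))) *
      (eigs CARD('n) Y i - eigs CARD('n) Y (i - 1))"
proof -
  have "ordered_eigenvalue (i + 1) (herm_of (vec_of Y :: real^'n^'n)) = eigs CARD('n) Y i"
    using ordered_eigenvalue_herm_of[where 'n='n, of "i + 1" Y] i by simp
  moreover have "ordered_eigenvalue i (herm_of (vec_of Y :: real^'n^'n)) = eigs CARD('n) Y (i - 1)"
    by (rule ordered_eigenvalue_herm_of) (use i in linarith)+
  ultimately show ?thesis by (simp only: eigengap_def)
qed

lemma nn_integral_herm_lborel:
  fixes f :: "complex^'n^'n \<Rightarrow> ennreal"
  assumes f: "f \<in> borel_measurable borel"
  shows "(\<integral>\<^sup>+A. f A \<partial>herm_lborel) = (\<integral>\<^sup>+Y. f (herm_of (vec_of Y)) \<partial>lborel_on (square CARD('n)))"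
proof -
  have m: "(herm_of :: real^'n^'n \<Rightarrow> _) \<in> measurable borel borel"
    by (rule borel_measurable_continuous_onI) (rule linear_continuous_on[OF linear_herm_of[THEN linear_conv_bounded_linear[THEN iffD1]]])
  have "(\<integral>\<^sup>+A. f A \<partial>herm_lborel) = (\<integral>\<^sup>+Y. f (herm_of Y) \<partial>lborel)"
    unfolding herm_lborel_def by (rule nn_integral_distr) (use m f in simp_all)
  also have "\<dots> = (\<integral>\<^sup>+Y. f (herm_of Y) \<partial>distr (lborel_on (square CARD('n))) borel vec_of)"
    by (simp only: distr_vec_of)
  also have "\<dots> = (\<integral>\<^sup>+Y. f (herm_of (vec_of Y)) \<partial>lborel_on (square CARD('n)))"
    by (rule nn_integral_distr[OF measurable_vec_of]) (use measurable_compose[OF m f] in simp)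
  finally show ?thesis .
qed

text \<open>
  The gap is the linear form \<open>kappa * (z i - z (i - 1))\<close> of the ordered spectrum, where \<open>kappa\<close> is the semicircle
  normalisation, and the law of the matrix depends on the spectrum only, since \<open>Re (trace (A ** A))\<close> is the
  sum of the squared eigenvalues.
\<close>
lemma eigengap_law:
  fixes X :: "'w \<Rightarrow> complex^'n^'n"
  assumes X: "GUE_matrix M X" and i: "1 \<le> i" "i \<le> CARD('n) - 1"
  obtains kappa K :: real where "0 \<le> kappa" "0 < K"
    "(\<lambda>w. eigengap i (X w)) \<in> borel_measurable M"
    "\<forall>B\<in>sets borel. emeasure (distr M borel (\<lambda>w. eigengap i (X w))) B = ennreal K *
      (\<integral>\<^sup>+z. (if kappa * (z i - z (i - 1)) \<in> B then eig_density CARD('n) z else 0) \<partial>lborel_on {..<CARD('n)})"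
proof -
  let ?N = "CARD('n)"
  define kappa where "kappa = sqrt (real ?N / 2) * semicircle_density (semicircle_quantile (real i / real ?N))"
  define psi where "psi z = kappa * (z i - z (i - 1))" for z :: "nat \<Rightarrow> real"
  define G where "G A = psi (eigs ?N (herm_coords A))" for A :: "complex^'n^'n"
  have iN: "i < ?N" "i - 1 < ?N" using i by auto
  obtain c where c: "0 < c"
    and dist: "distributed M herm_lborel X (\<lambda>A. ennreal (c * exp (- Re (trace (A ** A)))))"
    and herm: "\<And>w. w \<in> space M \<Longrightarrow> hermitian (X w)"
    using X unfolding GUE_matrix_def by blast
  define f where "f A = ennreal (c * exp (- Re (trace (A ** A))))" for A :: "complex^'n^'n"
  have sets_h: "sets (herm_lborel :: (complex^'n^'n) measure) = sets borel" by (simp add: herm_lborel_def)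
  have D: "distr M herm_lborel X = density herm_lborel f" and f: "f \<in> borel_measurable borel"
    and XM: "X \<in> measurable M borel"
    using dist unfolding distributed_def f_def[symmetric]
    by (simp_all add: measurable_cong_sets[OF sets_h refl] measurable_cong_sets[OF refl sets_h])
  have G_vec: "eigengap i (herm_of (vec_of Y :: real^'n^'n)) = psi (eigs ?N Y)" for Y
    by (simp only: eigengap_herm_of[OF i] psi_def kappa_def)
  have G: "eigengap i A = G A" if "hermitian A" for A :: "complex^'n^'n"
    using G_vec[of "herm_coords A"] herm_of_coords[OF that] by (simp only: G_def)
  have G_m: "G \<in> borel_measurable borel"
    unfolding G_def psi_def
    by (intro borel_measurable_times borel_measurable_const borel_measurable_diff measurable_eigs_herm_coords iN)
  have GX: "(\<lambda>w. G (X w)) \<in> borel_measurable M" by (rule measurable_compose[OF XM G_m])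
  have eq: "eigengap i (X w) = G (X w)" if "w \<in> space M" for w using G herm that by blast
  have meas: "(\<lambda>w. eigengap i (X w)) \<in> borel_measurable M"
    by (rule measurable_cong[THEN iffD2, OF eq GX])
  have psi_m: "psi \<in> borel_measurable (lborel_on {..<?N})"
    unfolding psi_def
    by (intro borel_measurable_times borel_measurable_const borel_measurable_diff measurable_component_lborel iN)
  define C where "C = (\<Prod>k<?N. (2 * pi) ^ k)"
  have C: "0 < C" unfolding C_def by (rule prod_pos) simp
  have law: "emeasure (distr M borel (\<lambda>w. eigengap i (X w))) B = ennreal (C * c) *
      (\<integral>\<^sup>+z. (if psi z \<in> B then eig_density ?N z else 0) \<partial>lborel_on {..<?N})" if B: "B \<in> sets borel" for B
  proof -
    define F where "F z = ennreal (c * exp (- (\<Sum>k<?N. (z k)\<^sup>2))) * indicator B (psi z)" for z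
    have ind: "(\<lambda>x. indicator B x :: ennreal) \<in> borel_measurable borel" using B by simp
    have F_m: "F \<in> borel_measurable (lborel_on {..<?N})"
    proof -
      have "F = (\<lambda>z. ennreal c * ennreal (exp (- (\<Sum>k<?N. (z k)\<^sup>2))) * indicator B (psi z))"
        using c by (simp add: F_def fun_eq_iff ennreal_mult')
      then show ?thesis
        by (simp only:) (intro borel_measurable_times_ennreal borel_measurable_const measurable_gauss measurable_compose[OF psi_m ind])
    qed
    have "emeasure (distr M borel (\<lambda>w. eigengap i (X w))) B = emeasure (distr M borel (\<lambda>w. G (X w))) B"
      by (rule arg_cong[of _ _ "\<lambda>L. emeasure L B"], rule distr_cong) (simp_all add: eq)
    also have "\<dots> = emeasure (distr M herm_lborel X) (G -` B)"
    proof -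
      have X': "X \<in> measurable M herm_lborel" using XM by (simp only: measurable_cong_sets[OF refl sets_h])
      have GB: "G -` B \<in> sets herm_lborel" using measurable_sets[OF G_m B] by (simp add: sets_h)
      show ?thesis
        unfolding emeasure_distr[OF GX B] emeasure_distr[OF X' GB] by (simp add: vimage_def)
    qed
    also have "\<dots> = (\<integral>\<^sup>+A. f A * indicator (G -` B) A \<partial>herm_lborel)"
      unfolding D
    proof (rule emeasure_density)
      show "f \<in> borel_measurable herm_lborel" using f by (simp only: measurable_cong_sets[OF sets_h refl])
      show "G -` B \<in> sets herm_lborel" using measurable_sets[OF G_m B] by (simp add: sets_h)
    qed
    also have "\<dots> = (\<integral>\<^sup>+A. f A * indicator B (G A) \<partial>herm_lborel)"
      by (simp only: indicator_vimage comp_def)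
    also have "\<dots> = (\<integral>\<^sup>+Y. f (herm_of (vec_of Y)) * indicator B (G (herm_of (vec_of Y))) \<partial>lborel_on (square ?N))"
      by (rule nn_integral_herm_lborel)
        (rule borel_measurable_times_ennreal[OF f measurable_compose[OF G_m ind]])
    also have "\<dots> = (\<integral>\<^sup>+Y. F (eigs ?N Y) \<partial>lborel_on (square ?N))"
      by (simp only: G[OF hermitian_herm_of, symmetric] G_vec f_def trace_herm_of F_def)
    also have "\<dots> = ennreal C * (\<integral>\<^sup>+z. vdm_weighted ?N (\<lambda>z. gt_volume ?N z * F z) z \<partial>lborel_on {..<?N})"
      unfolding C_def by (rule nn_integral_eigs[OF F_m])
    also have "(\<integral>\<^sup>+z. vdm_weighted ?N (\<lambda>z. gt_volume ?N z * F z) z \<partial>lborel_on {..<?N})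
      = (\<integral>\<^sup>+z. ennreal c * (if psi z \<in> B then eig_density ?N z else 0) \<partial>lborel_on {..<?N})"
      by (rule nn_integral_cong)
        (use c in \<open>simp add: vdm_weighted_def eig_density_def F_def ennreal_mult' mult_ac split: split_indicator\<close>)
    also have "\<dots> = ennreal c * (\<integral>\<^sup>+z. (if psi z \<in> B then eig_density ?N z else 0) \<partial>lborel_on {..<?N})"
    proof (rule nn_integral_cmult)
      note [measurable] = psi_m measurable_eig_density B
      show "(\<lambda>z. if psi z \<in> B then eig_density ?N z else 0) \<in> borel_measurable (lborel_on {..<?N})" by measurable
    qed
    finally show ?thesis using c C by (simp add: ennreal_mult mult.assoc)
  qed
  have kappa: "0 \<le> kappa" by (simp add: kappa_def semicircle_density_def)
  have K: "0 < C * c" using c C by simp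
  show ?thesis by (rule that[OF kappa K meas]) (rule ballI, rule law[unfolded psi_def])
qed

theorem mainTheorem4:
  fixes M :: "'w measure" and X :: "'w \<Rightarrow> complex^'n^'n" and i :: nat
  assumes "prob_space M"
    and "CARD('n) \<ge> 2"
    and "GUE_matrix M X"
    and "1 \<le> i" and "i \<le> CARD('n) - 1"
  shows "log_concave_measure (distr M borel (\<lambda>\<omega>. eigengap i (X \<omega>))) \<and>
         measure (distr M borel (\<lambda>\<omega>. eigengap i (X \<omega>))) {0..} = 1"
proof -
  let ?N = "CARD('n)" and ?L = "distr M borel (\<lambda>\<omega>. eigengap i (X \<omega>))"
  obtain kappa K where kappa: "0 \<le> kappa" and K: "0 < K"
    and meas: "(\<lambda>w. eigengap i (X w)) \<in> borel_measurable M"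
    and law_all: "\<forall>B\<in>sets borel. emeasure ?L B = ennreal K *
      (\<integral>\<^sup>+z. (if kappa * (z i - z (i - 1)) \<in> B then eig_density ?N z else 0) \<partial>lborel_on {..<?N})"
    by (rule eigengap_law[OF assms(3-5)])
  note law = bspec[OF law_all]
  have iN: "i < ?N" "i - 1 < ?N" "i - 1 < i" using assms(4,5) by auto
  interpret M: prob_space M by (rule assms(1))
  interpret L: prob_space ?L by (rule M.prob_space_distr[OF meas])
  define psi where "psi z = kappa * (z i - z (i - 1))" for z :: "nat \<Rightarrow> real"
  have psi_m: "psi \<in> borel_measurable (lborel_on {..<?N})"
    unfolding psi_def
    by (intro borel_measurable_times borel_measurable_const borel_measurable_diff measurable_component_lborel iN)
  have lin: "psi (cconv l ?N x y) = l * psi x + (1 - l) * psi y" for l x y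
    using iN by (simp add: psi_def algebra_simps)
  have conc: "ennreal (measure ?L A powr l * measure ?L B powr (1 - l))
      \<le> outer_measure_of ?L {l *\<^sub>R a + (1 - l) *\<^sub>R b |a b. a \<in> A \<and> b \<in> B}"
    if A: "A \<in> sets borel" and B: "B \<in> sets borel" and l: "l \<in> {0<..<1}" for A B l
  proof (cases "measure ?L A = 0 \<or> measure ?L B = 0")
    case False
    have l01: "0 < l" "l < 1" using l by auto
    have pos: "0 < measure ?L A" "0 < measure ?L B" using False by (simp_all add: zero_less_measure_iff)
    show ?thesis unfolding outer_measure_of_def
    proof (rule INF_greatest)
      fix C assume "C \<in> {C \<in> sets ?L. {l *\<^sub>R a + (1 - l) *\<^sub>R b |a b. a \<in> A \<and> b \<in> B} \<subseteq> C}"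
      then have C: "C \<in> sets borel" and AB: "{l *\<^sub>R a + (1 - l) *\<^sub>R b |a b. a \<in> A \<and> b \<in> B} \<subseteq> C"
        by simp_all
      have Kl: "K powr l * K powr (1 - l) \<le> K" using K by (simp flip: powr_add)
      have ab: "l * a + (1 - l) * b \<in> C" if "a \<in> A" "b \<in> B" for a b
        using AB that by (auto simp: subset_iff)
      have "pl_le l (emeasure ?L A) (emeasure ?L B) (emeasure ?L C)"
        unfolding law[OF A] law[OF B] law[OF C]
        by (rule pl_le_mult[OF pl_le_marginal[OF l01 psi_m lin A B C ab, unfolded psi_def] K K Kl])
      then show "ennreal (measure ?L A powr l * measure ?L B powr (1 - l)) \<le> emeasure ?L C"
        unfolding pl_le_def using pos by (simp add: L.emeasure_eq_measure)
    qed
  qed (use l in auto)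
  have "emeasure ?L {0..} = emeasure ?L UNIV"
  proof -
    have "(if kappa * (z i - z (i - 1)) \<in> {0..} then eig_density ?N z else 0)
        = (if kappa * (z i - z (i - 1)) \<in> UNIV then eig_density ?N z else 0)" for z
    proof (cases "strict_incr ?N z")
      case True
      then have "z (i - 1) < z i" using iN unfolding strict_incr_def by blast
      then show ?thesis using kappa by simp
    qed (simp add: eig_density_def vdm_weighted_def)
    then have *: "(\<integral>\<^sup>+z. (if kappa * (z i - z (i - 1)) \<in> {0..} then eig_density ?N z else 0) \<partial>lborel_on {..<?N})
      = (\<integral>\<^sup>+z. (if kappa * (z i - z (i - 1)) \<in> UNIV then eig_density ?N z else 0) \<partial>lborel_on {..<?N})"
      by (intro nn_integral_cong)
    have "{0..} \<in> sets (borel :: real measure)" "UNIV \<in> sets (borel :: real measure)" by simp_all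
    then show ?thesis by (simp only: law *)
  qed
  moreover have "emeasure ?L UNIV = 1"
    using L.emeasure_space_1 by (simp only: space_distr space_borel)
  ultimately have supp: "measure ?L {0..} = 1"
    by (simp only: measure_def enn2real_1)
  show ?thesis
    unfolding log_concave_measure_def
    by (intro conjI ballI L.prob_space_axioms sets_distr conc supp)
qed

end
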